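(* Let $d\ge2$ and $1\le p<\infty$, and let $\lceil p\rceil_2$ denote the smallest even integer larger than or equal to $p$. Let $T$ be a $\lceil p\rceil_2$-weakly isotropic random field on $\mathbb{S}^d$. Let $h$ be a needlet filter satisfying $h\in C^\kappa(\mathbb{R}_+)$ with $\kappa\ge\lfloor\frac{d+3}{2}\rfloor$. Then, for each $x\in\mathbb{S}^d$, $$\lim_{J\to\infty}\mathbb{E}\big[|T(x)-V_J(T;x)|^p\big]=0.$$
   Context: $\mathbb{S}^d\subset\mathbb{R}^{d+1}$ is the unit sphere, $\sigma_d$ its normalised surface measure ($\sigma_d(\mathbb{S}^d)=1$), $L_p(\mathbb{S}^d)=L_p(\mathbb{S}^d,\sigma_d)$. $(\Omega,\mathcal{F},P)$ is a probability space with expectation $\mathbb{E}$. Random fields. A random field on $\mathbb{S}^d$ is an $\mathcal{F}\otimes\mathscr{B}(\mathbb{S}^d)$-measurable function $T:\Omega\times\mathbb{S}^d\to\mathbb{R}$; write $T(x)=T(\cdot,x)$ and $T(\omega)=T(\omega,\cdot)$. For an integer $n\ge1$, $T$ is $n$-weakly isotropic if $\mathbb{E}[|T(x)|^n]<\infty$ for all $x\in\mathbb{S}^d$ and, for $k=1,\dots,n$, all $x_1,\dots,x_k\in\mathbb{S}^d$ and all rotations $\rho\in SO(d+1)$, $\mathbb{E}[T(x_1)\cdots T(x_k)]=\mathbb{E}[T(\rho x_1)\cdots T(\rho x_k)]$. Needlets. $Z(d,\ell)=(2\ell+d-1)\frac{\Gamma(\ell+d-1)}{\Gamma(d)\Gamma(\ell+1)}$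 is the dimension of the space of spherical harmonics of degree $\ell$, and $P_\ell^{(d+1)}$ is the Gegenbauer (Jacobi, with parameters $(\frac{d-2}{2},\frac{d-2}{2})$) polynomial of degree $\ell$ normalised by $P_\ell^{(d+1)}(1)=1$. A needlet filter of smoothness $\kappa\ge1$ is $h:[0,\infty)\to[0,\infty)$ with $h\in C^\kappa(\mathbb{R}_+)$, $\operatorname{supp}h=[1/2,2]$ and $h(t)^2+h(2t)^2=1$ for $t\in[1/2,1]$. For each $j\ge0$ fix a needlet quadrature $\{(w_{jk},x_{jk}):k=1,\dots,N_j\}$, with $w_{jk}>0$, $x_{jk}\in\mathbb{S}^d$, exact (with respect to $\sigma_d$) for spherical polynomials of degree up to $2^{j+1}-1$. The needlets are $\psi_{0k}(x):=\sqrt{w_{0k}}$ and, for $j\ge1$, $\psi_{jk}(x):=\sqrt{w_{jk}}\sum_{\ell=0}^\infty h\big(\frac{\ell}{2^{j-1}}\big)Z(d,\ell)P_\ell^{(d+1)}(x\cdot x_{jk})$. For $f\in L_1(\mathbb{S}^d)$, $(f,\psi_{jk})=\int_{\mathbb{S}^d}f\psi_{jk}\,d\sigma_d$. The semidiscrete needlet approximation of order $J\in\mathbb{N}_0$ is $V_J(T;\omega,x)=\sum_{j=0}^J\sum_{k=1}^{N_j}(T(\omega),\psi_{jk})\psi_{jk}(x)$; $V_J(T;x)$ denotes the random variable $\omega\mapsto V_J(T;\omega,x)$. *)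

theory Defs
  imports "HOL-Probability.Probability"
begin

section \<open>The sphere\<close>

text \<open>
  The normalised surface measure on the unit sphere, constructed as the cone measure: the image
  of the uniform distribution on the punctured unit ball under the radial projection
  \<^term>\<open>sgn\<close>, so that the measure of \<open>A\<close> is the volume of
  \<open>{r x | x \<in> A, 0 < r < 1}\<close> divided by that of the ball. Integration in polar coordinates
  identifies it with normalised surface area. It is a probability measure that is invariant under
  orthogonal maps, as shown below.
\<close>

definition sphere_measure :: "(real ^ 'n) measure" where
  "sphere_measure =
     distr (restrict_space (uniform_measure lborel (ball 0 1)) (ball 0 1 - {0}))
           (restrict_space borel (sphere 0 1)) sgn"

lemma space_sphere_measure [simp]: "space sphere_measure = sphere 0 1"
  by (simp add: sphere_measure_def space_restrict_space)

lemma sets_sphere_measure [measurable_cong]: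
  "sets sphere_measure = sets (restrict_space borel (sphere 0 1))"
  by (simp add: sphere_measure_def)

lemma measurable_sgn_sphere:
  "sgn \<in> measurable
     (restrict_space (uniform_measure lborel (ball 0 1)) (ball (0 :: real ^ 'n) 1 - {0}))
     (restrict_space borel (sphere 0 1))"
proof (rule measurable_restrict_space2)
  have "(sgn :: real ^ 'n \<Rightarrow> _) \<in> borel_measurable borel"
    unfolding sgn_div_norm by measurable
  then show "sgn \<in> borel_measurable
      (restrict_space (uniform_measure lborel (ball 0 1)) (ball (0 :: real ^ 'n) 1 - {0}))"
    by (intro measurable_restrict_space1) (simp add: measurable_def)
qed (auto simp: space_restrict_space norm_sgn)

lemma sets_cone:
  assumes "A \<in> sets (restrict_space borel (sphere (0 :: real ^ 'n) 1))"
  shows "{x \<in> ball (0 :: real ^ 'n) 1 - {0}. sgn x \<in> A} \<in> sets borel"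
proof -
  let ?R = "restrict_space (uniform_measure lborel (ball 0 1)) (ball (0 :: real ^ 'n) 1 - {0})"
  have "{x \<in> ball (0 :: real ^ 'n) 1 - {0}. sgn x \<in> A} = sgn -` A \<inter> space ?R"
    by (auto simp: space_restrict_space)
  then have "{x \<in> ball (0 :: real ^ 'n) 1 - {0}. sgn x \<in> A} \<in> sets ?R"
    using measurable_sets[OF measurable_sgn_sphere assms] by metis
  then show ?thesis
    by (subst (asm) sets_restrict_space_iff) auto
qed

lemma emeasure_sphere_measure:
  assumes "A \<in> sets (restrict_space borel (sphere (0 :: real ^ 'n) 1))"
  shows "emeasure sphere_measure A =
    emeasure lborel {x \<in> ball 0 1 - {0}. sgn x \<in> A} / emeasure lborel (ball (0 :: real ^ 'n) 1)"
proof -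
  let ?B = "ball (0 :: real ^ 'n) 1" and ?U = "uniform_measure lborel (ball (0 :: real ^ 'n) 1)"
  let ?S = "{x \<in> ?B - {0}. sgn x \<in> A}"
  have eq: "sgn -` A \<inter> space (restrict_space ?U (?B - {0})) = ?S"
    by (auto simp: space_restrict_space)
  have "?S \<in> sets lborel"
    using sets_cone[OF assms] by simp
  then have "emeasure ?U ?S = emeasure lborel (?B \<inter> ?S) / emeasure lborel ?B"
    by (intro emeasure_uniform_measure) auto
  moreover have "?B \<inter> ?S = ?S" by auto
  moreover have "emeasure sphere_measure A = emeasure ?U ?S"
    unfolding sphere_measure_def emeasure_distr[OF measurable_sgn_sphere assms] eq
    by (rule emeasure_restrict_space) auto
  ultimately show ?thesis by simp
qed

lemma emeasure_ball_unit:
  "emeasure lborel (ball (0 :: real ^ 'n) 1) \<noteq> 0" "emeasure lborel (ball (0 :: real ^ 'n) 1) \<noteq> \<infinity>"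
  using emeasure_lborel_ball_finite[of "0 :: real ^ 'n" 1] content_ball_pos[of 1 "0 :: real ^ 'n"]
  by (auto simp: measure_def)

lemma prob_space_sphere_measure: "prob_space (sphere_measure :: (real ^ 'n) measure)"
proof (rule prob_spaceI)
  let ?B = "ball (0 :: real ^ 'n) 1"
  have "{x \<in> ?B - {0}. sgn x \<in> sphere (0 :: real ^ 'n) 1} = ?B - {0}"
    by (auto simp: norm_sgn)
  moreover have "emeasure lborel (?B - {0}) = emeasure lborel ?B"
    by (rule emeasure_Diff_null_set) auto
  moreover have "sphere 0 1 \<in> sets (restrict_space borel (sphere (0 :: real ^ 'n) 1))"
    using sets.top[of "restrict_space borel (sphere (0 :: real ^ 'n) 1)"]
    by (simp add: space_restrict_space)
  ultimately show "emeasure (sphere_measure :: (real ^ 'n) measure) (space sphere_measure) = 1"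
    using emeasure_ball_unit[where 'n = 'n] by (simp add: emeasure_sphere_measure ennreal_divide_self less_top)
qed

lemma nn_integral_lborel_translate:
  fixes f :: "'a::euclidean_space \<Rightarrow> ennreal"
  assumes [measurable]: "f \<in> borel_measurable borel"
  shows "(\<integral>\<^sup>+x. f (c + x) \<partial>lborel) = (\<integral>\<^sup>+x. f x \<partial>lborel)"
proof -
  have "(\<integral>\<^sup>+x. f x \<partial>lborel) = (\<integral>\<^sup>+x. f x \<partial>distr lborel borel ((+) c))"
    by (simp add: lborel_distr_plus)
  also have "\<dots> = (\<integral>\<^sup>+x. f (c + x) \<partial>lborel)"
    by (rule nn_integral_distr) auto
  finally show ?thesis by simp
qed

text \<open>The library has the orthogonal invariance of Lebesgue measure only for well-ordered index
  types. The general case follows from translation invariance and Fubini.\<close>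

lemma distr_lborel_orthogonal:
  fixes Q :: "real ^ 'n ^ 'n"
  assumes "orthogonal_matrix Q"
  shows "distr lborel borel ((*v) Q) = lborel"
proof (rule measure_eqI)
  fix A assume "A \<in> sets (distr lborel borel ((*v) Q))"
  then have A [measurable]: "A \<in> sets borel" by simp
  define f :: "real ^ 'n \<Rightarrow> ennreal" where "f = indicator A"
  define g :: "real ^ 'n \<Rightarrow> ennreal" where "g = indicator (ball 0 1)"
  have [measurable]: "f \<in> borel_measurable borel" "g \<in> borel_measurable borel"
    unfolding f_def g_def by (intro borel_measurable_indicator; simp)+
  have [measurable]: "((*v) Q) \<in> borel_measurable borel"
    by (intro borel_measurable_continuous_onI linear_continuous_on matrix_vector_mul_bounded_linear)
  have norm: "norm (Q *v x) = norm x" for x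
    using assms by (simp add: orthogonal_transformation_matrix orthogonal_transformation_norm)
  have Qt: "Q *v (transpose Q *v y) = y" for y
  proof -
    have "Q *v (transpose Q *v y) = (Q ** transpose Q) *v y"
      by (rule matrix_vector_mul_assoc)
    then show ?thesis using assms by (simp add: orthogonal_matrix_def)
  qed
  have g: "g (y - Q *v x) = g (- (transpose Q *v y) + x)" for x y
  proof -
    have "norm (y - Q *v x) = norm (Q *v (transpose Q *v y - x))"
      by (simp only: matrix_vector_mult_diff_distrib Qt)
    also have "\<dots> = norm (- (transpose Q *v y) + x)"
      unfolding norm by (metis minus_diff_eq norm_minus_cancel uminus_add_conv_diff)
    finally show ?thesis by (simp add: g_def indicator_def)
  qed
  let ?G = "\<integral>\<^sup>+y. g y \<partial>lborel"
  have "(\<integral>\<^sup>+x. f (Q *v x) \<partial>lborel) * ?G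
      = (\<integral>\<^sup>+y. (\<integral>\<^sup>+x. f (Q *v x) \<partial>lborel) * g y \<partial>lborel)"
    by (rule nn_integral_cmult[symmetric]) auto
  also have "\<dots> = (\<integral>\<^sup>+y. (\<integral>\<^sup>+x. f (y + Q *v x) * g y \<partial>lborel) \<partial>lborel)"
  proof (rule nn_integral_cong)
    fix y :: "real ^ 'n"
    have "(\<integral>\<^sup>+x. f (Q *v x) \<partial>lborel) = (\<integral>\<^sup>+x. f (Q *v (transpose Q *v y + x)) \<partial>lborel)"
      by (rule nn_integral_lborel_translate[symmetric]) measurable
    also have "\<dots> = (\<integral>\<^sup>+x. f (y + Q *v x) \<partial>lborel)"
      by (simp only: matrix_vector_right_distrib Qt)
    finally show "(\<integral>\<^sup>+x. f (Q *v x) \<partial>lborel) * g y = (\<integral>\<^sup>+x. f (y + Q *v x) * g y \<partial>lborel)"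
      by (simp add: nn_integral_multc)
  qed
  also have "\<dots> = (\<integral>\<^sup>+x. (\<integral>\<^sup>+y. f (y + Q *v x) * g y \<partial>lborel) \<partial>lborel)"
    by (rule lborel_pair.Fubini') measurable
  also have "\<dots> = (\<integral>\<^sup>+x. (\<integral>\<^sup>+y. f y * g (y - Q *v x) \<partial>lborel) \<partial>lborel)"
  proof (rule nn_integral_cong)
    fix x :: "real ^ 'n"
    have "(\<integral>\<^sup>+y. f y * g (y - Q *v x) \<partial>lborel)
        = (\<integral>\<^sup>+y. f (Q *v x + y) * g (Q *v x + y - Q *v x) \<partial>lborel)"
      by (rule nn_integral_lborel_translate[symmetric]) measurable
    then show "(\<integral>\<^sup>+y. f (y + Q *v x) * g y \<partial>lborel) = (\<integral>\<^sup>+y. f y * g (y - Q *v x) \<partial>lborel)"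
      by (simp add: add.commute)
  qed
  also have "\<dots> = (\<integral>\<^sup>+y. (\<integral>\<^sup>+x. f y * g (y - Q *v x) \<partial>lborel) \<partial>lborel)"
    by (rule lborel_pair.Fubini') measurable
  also have "\<dots> = (\<integral>\<^sup>+y. f y * ?G \<partial>lborel)"
  proof (rule nn_integral_cong)
    fix y :: "real ^ 'n"
    have "(\<integral>\<^sup>+x. g (- (transpose Q *v y) + x) \<partial>lborel) = ?G"
      by (rule nn_integral_lborel_translate) measurable
    then show "(\<integral>\<^sup>+x. f y * g (y - Q *v x) \<partial>lborel) = f y * ?G"
      unfolding g by (subst nn_integral_cmult) auto
  qed
  also have "\<dots> = (\<integral>\<^sup>+y. f y \<partial>lborel) * ?G"
    by (rule nn_integral_multc) auto
  finally have "(\<integral>\<^sup>+x. f (Q *v x) \<partial>lborel) * ?G = (\<integral>\<^sup>+y. f y \<partial>lborel) * ?G" .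
  moreover have "?G \<noteq> 0" "?G \<noteq> \<infinity>"
    using emeasure_ball_unit[where 'n = 'n] by (simp_all add: g_def)
  ultimately have "(\<integral>\<^sup>+x. f (Q *v x) \<partial>lborel) = (\<integral>\<^sup>+y. f y \<partial>lborel)"
    by (metis ennreal_mult_cancel_left infinity_ennreal_def mult.commute)
  moreover have "(\<integral>\<^sup>+x. f (Q *v x) \<partial>lborel) = (\<integral>\<^sup>+y. f y \<partial>distr lborel borel ((*v) Q))"
    by (rule nn_integral_distr[symmetric]) auto
  ultimately show "emeasure (distr lborel borel ((*v) Q)) A = emeasure lborel A"
    by (simp add: f_def)
qed simp

lemma sphere_measure_orthogonal_invariant:
  fixes Q :: "real ^ 'n ^ 'n"
  assumes "orthogonal_matrix Q"
  shows "distr sphere_measure sphere_measure ((*v) Q) = sphere_measure"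
proof (rule measure_eqI)
  let ?R = "restrict_space borel (sphere (0 :: real ^ 'n) 1)" and ?B = "ball (0 :: real ^ 'n) 1"
  have norm: "norm (Q *v x) = norm x" for x
    using assms by (simp add: orthogonal_transformation_matrix orthogonal_transformation_norm)
  have mQ [measurable]: "((*v) Q) \<in> borel_measurable borel"
    by (intro borel_measurable_continuous_onI linear_continuous_on matrix_vector_mul_bounded_linear)
  have mR: "((*v) Q) \<in> measurable sphere_measure (sphere_measure :: (real ^ 'n) measure)"
    unfolding measurable_cong_sets[OF sets_sphere_measure sets_sphere_measure]
    by (intro measurable_restrict_space3) (auto simp: norm)
  fix A assume "A \<in> sets (distr sphere_measure (sphere_measure :: (real ^ 'n) measure) ((*v) Q))"
  then have A: "A \<in> sets ?R" by (simp add: sets_sphere_measure)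
  let ?S = "{x \<in> ?B - {0}. sgn x \<in> A}"
  let ?A' = "(*v) Q -` A \<inter> sphere 0 1"
  have A': "?A' \<in> sets ?R"
    using measurable_sets[OF mR, of A] A by (simp add: sets_sphere_measure)
  have sQ: "sgn (Q *v x) = Q *v sgn x" for x
    by (simp add: sgn_div_norm norm matrix_vector_mult_scaleR)
  have S: "?S \<in> sets borel"
    using A by (rule sets_cone)
  have Q0: "Q *v x = 0 \<longleftrightarrow> x = 0" for x
    using norm[of x] by (metis norm_eq_zero)
  have "{x \<in> ?B - {0}. sgn x \<in> ?A'} = (*v) Q -` ?S"
    by (auto simp: norm sQ norm_sgn Q0)
  moreover have "emeasure lborel ((*v) Q -` ?S) = emeasure (distr lborel borel ((*v) Q)) ?S"
    using emeasure_distr[of "(*v) Q" lborel borel ?S] S by (simp del: Collect_mem_eq)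
  ultimately have "emeasure lborel {x \<in> ?B - {0}. sgn x \<in> ?A'} = emeasure lborel ?S"
    by (metis distr_lborel_orthogonal[OF assms])
  moreover have "emeasure (distr sphere_measure sphere_measure ((*v) Q)) A = emeasure sphere_measure ?A'"
    using A by (subst emeasure_distr[OF mR]) (auto simp: sets_sphere_measure)
  ultimately show "emeasure (distr sphere_measure sphere_measure ((*v) Q)) A = emeasure sphere_measure A"
    by (simp add: emeasure_sphere_measure A A')
qed simp

text \<open>
  Polynomial functions of total degree at most \<open>n\<close> on Euclidean space; \<open>a i\<close> is the exponent
  of the \<open>i\<close>-th coordinate. Spherical polynomials of degree at most \<open>n\<close> are their restrictions to
  the sphere.
\<close>

definition poly_functions :: "nat \<Rightarrow> (real ^ 'n \<Rightarrow> real) set" where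
  "poly_functions n =
     {q. \<exists>c :: ('n \<Rightarrow> nat) \<Rightarrow> real.
           \<forall>x. q x = (\<Sum>a | (\<Sum>i\<in>UNIV. a i) \<le> n. c a * (\<Prod>i\<in>UNIV. (x $ i) ^ a i))}"

text \<open>The index set of the sum above is finite, so the sum is not degenerate.\<close>

lemma finite_exponents: "finite {a :: 'n::finite \<Rightarrow> nat. (\<Sum>i\<in>UNIV. a i) \<le> n}"
proof (rule finite_subset)
  show "{a :: 'n \<Rightarrow> nat. (\<Sum>i\<in>UNIV. a i) \<le> n} \<subseteq> Pi\<^sub>E UNIV (\<lambda>_. {..n})"
  proof
    fix a :: "'n \<Rightarrow> nat" assume a: "a \<in> {a. (\<Sum>i\<in>UNIV. a i) \<le> n}"
    have "a i \<le> n" for i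
      using a member_le_sum[of i UNIV a] by simp
    then show "a \<in> Pi\<^sub>E UNIV (\<lambda>_. {..n})" by (simp add: PiE_UNIV_domain)
  qed
  show "finite (Pi\<^sub>E (UNIV :: 'n set) (\<lambda>_. {..n}))"
    by (rule finite_PiE) auto
qed


section \<open>Random fields\<close>

definition random_field :: "'w measure \<Rightarrow> ('w \<Rightarrow> real ^ 'n \<Rightarrow> real) \<Rightarrow> bool" where
  "random_field M T \<longleftrightarrow>
     case_prod T \<in> borel_measurable (M \<Otimes>\<^sub>M restrict_space borel (sphere 0 1))"

definition weakly_isotropic :: "nat \<Rightarrow> 'w measure \<Rightarrow> ('w \<Rightarrow> real ^ 'n \<Rightarrow> real) \<Rightarrow> bool" where
  "weakly_isotropic n M T \<longleftrightarrow>
     n \<ge> 1 \<and>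
     (\<forall>x\<in>sphere 0 1. integrable M (\<lambda>\<omega>. \<bar>T \<omega> x\<bar> ^ n)) \<and>
     (\<forall>k\<in>{1..n}. \<forall>x :: nat \<Rightarrow> real ^ 'n. \<forall>Q :: real ^ 'n ^ 'n.
        (\<forall>i\<in>{1..k}. x i \<in> sphere 0 1) \<and> rotation_matrix Q \<longrightarrow>
        (\<integral>\<omega>. (\<Prod>i=1..k. T \<omega> (x i)) \<partial>M) = (\<integral>\<omega>. (\<Prod>i=1..k. T \<omega> (Q *v x i)) \<partial>M))"

definition even_ceiling :: "real \<Rightarrow> nat" where
  "even_ceiling p = (LEAST n. even n \<and> p \<le> real n)"


section \<open>Needlets\<close>

text \<open>The dimension of the space of spherical harmonics of degree \<open>l\<close> on the \<open>d\<close>-sphere.\<close>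

definition Z :: "nat \<Rightarrow> nat \<Rightarrow> real" where
  "Z d l = (2 * real l + real d - 1) * Gamma (real l + real d - 1)
             / (Gamma (real d) * Gamma (real l + 1))"

text \<open>The Jacobi polynomial with parameters \<open>\<alpha>\<close>, \<open>\<beta>\<close>, as obtained by applying the Leibniz rule to
  Rodrigues' formula.\<close>

definition jacobi :: "real \<Rightarrow> real \<Rightarrow> nat \<Rightarrow> real \<Rightarrow> real" where
  "jacobi \<alpha> \<beta> n t =
     (\<Sum>s\<le>n. ((real n + \<alpha>) gchoose (n - s)) * ((real n + \<beta>) gchoose s)
              * ((t - 1) / 2) ^ s * ((t + 1) / 2) ^ (n - s))"

text \<open>The polynomial \<open>P_l^(d+1)\<close>, normalised to take the value 1 at 1.\<close>

definition gegenbauer :: "nat \<Rightarrow> nat \<Rightarrow> real \<Rightarrow> real" where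
  "gegenbauer d l t =
     (let \<alpha> = (real d - 2) / 2 in jacobi \<alpha> \<alpha> l t / jacobi \<alpha> \<alpha> l 1)"

lemma gegenbauer_1:
  assumes "d \<ge> 2"
  shows "gegenbauer d l 1 = 1"
proof -
  define \<alpha> where "\<alpha> = (real d - 2) / 2"
  have "\<alpha> \<ge> 0" using assms by (simp add: \<alpha>_def)
  have "jacobi \<alpha> \<alpha> l 1 = (\<Sum>s\<le>l. if s = 0 then (real l + \<alpha>) gchoose l else 0)"
    unfolding jacobi_def by (intro sum.cong) auto
  also have "\<dots> = (real l + \<alpha>) gchoose l" by simp
  also have "\<dots> > 0"
    using \<open>\<alpha> \<ge> 0\<close> by (auto simp: gbinomial_prod_rev intro!: divide_pos_pos prod_pos)
  finally show ?thesis by (simp add: gegenbauer_def \<alpha>_def)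
qed

text \<open>
  \<open>C^k\<close> regularity on the half-line \<open>[0, \<infinity>)\<close>; \<open>D i\<close> is the \<open>i\<close>-th derivative, one-sided at 0.
\<close>

definition Ck_halfline :: "nat \<Rightarrow> (real \<Rightarrow> real) \<Rightarrow> bool" where
  "Ck_halfline k h \<longleftrightarrow>
     (\<exists>D :: nat \<Rightarrow> real \<Rightarrow> real.
        (\<forall>t\<ge>0. D 0 t = h t) \<and>
        (\<forall>i<k. \<forall>t\<ge>0. (D i has_real_derivative D (Suc i) t) (at t within {0..})) \<and>
        (\<forall>i\<le>k. continuous_on {0..} (D i)))"

text \<open>A filter is represented by a function on the reals, of which only the values on
  \<open>[0, \<infinity>)\<close> are relevant.\<close>

definition needlet_filter :: "nat \<Rightarrow> (real \<Rightarrow> real) \<Rightarrow> bool" where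
  "needlet_filter \<kappa> h \<longleftrightarrow>
     \<kappa> \<ge> 1 \<and>
     (\<forall>t\<ge>0. h t \<ge> 0) \<and>
     Ck_halfline \<kappa> h \<and>
     closure {t. t \<ge> 0 \<and> h t \<noteq> 0} = {1/2..2} \<and>
     (\<forall>t\<in>{1/2..1}. (h t)\<^sup>2 + (h (2 * t))\<^sup>2 = 1)"

text \<open>Level \<open>j\<close> has \<open>N j\<close> nodes \<open>y j k\<close> with weights \<open>w j k\<close>, where \<open>k\<close> ranges over
  \<open>1, \<dots>, N j\<close>.\<close>

definition needlet_quadrature ::
  "(nat \<Rightarrow> nat) \<Rightarrow> (nat \<Rightarrow> nat \<Rightarrow> real) \<Rightarrow> (nat \<Rightarrow> nat \<Rightarrow> real ^ 'n) \<Rightarrow> bool" where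
  "needlet_quadrature N w y \<longleftrightarrow>
     (\<forall>j. (\<forall>k\<in>{1..N j}. w j k > 0 \<and> y j k \<in> sphere 0 1) \<and>
          (\<forall>q\<in>poly_functions (2 ^ (j + 1) - 1).
             (\<integral>x. q x \<partial>sphere_measure) = (\<Sum>k=1..N j. w j k * q (y j k))))"

definition needlet ::
  "nat \<Rightarrow> (real \<Rightarrow> real) \<Rightarrow> (nat \<Rightarrow> nat \<Rightarrow> real) \<Rightarrow> (nat \<Rightarrow> nat \<Rightarrow> real ^ 'n) \<Rightarrow>
   nat \<Rightarrow> nat \<Rightarrow> real ^ 'n \<Rightarrow> real" where
  "needlet d h w y j k x =
     (if j = 0 then sqrt (w 0 k)
      else sqrt (w j k) *
             (\<Sum>l. h (real l / 2 ^ (j - 1)) * Z d l * gegenbauer d l (x \<bullet> y j k)))"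

definition sphere_inner :: "(real ^ 'n \<Rightarrow> real) \<Rightarrow> (real ^ 'n \<Rightarrow> real) \<Rightarrow> real" where
  "sphere_inner f g = (\<integral>x. f x * g x \<partial>sphere_measure)"

text \<open>For a realisation \<open>T \<omega>\<close> outside \<open>L_1\<close> of the sphere, the coefficients below take
  junk values; for the fields considered this happens only with probability 0.\<close>

definition needlet_approx ::
  "nat \<Rightarrow> (real \<Rightarrow> real) \<Rightarrow> (nat \<Rightarrow> nat) \<Rightarrow> (nat \<Rightarrow> nat \<Rightarrow> real) \<Rightarrow> (nat \<Rightarrow> nat \<Rightarrow> real ^ 'n) \<Rightarrow>
   nat \<Rightarrow> ('w \<Rightarrow> real ^ 'n \<Rightarrow> real) \<Rightarrow> 'w \<Rightarrow> real ^ 'n \<Rightarrow> real" where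
  "needlet_approx d h N w y J T \<omega> x =
     (\<Sum>j\<le>J. \<Sum>k=1..N j.
        sphere_inner (T \<omega>) (needlet d h w y j k) * needlet d h w y j k x)"

end

theory Submission
  imports Defs
begin

text \<open>
  By the quadrature rule and the convolution property of Gegenbauer polynomials, \<open>V_J\<close> is
  convolution with the zonal kernel \<open>v_L(t) = \<Sum> f_L(l) Z(d,l) P_l(t)\<close>, where \<open>L = 2^(J-1)\<close> and
  \<open>f_L(l)\<close> is \<open>1\<close> for \<open>l \<le> L\<close> and \<open>h(l/L)^2\<close> beyond; it reproduces spherical polynomials of degree
  at most \<open>L\<close>.

  The kernels are bounded in \<open>L_1\<close>: multiplication by \<open>1 - t\<close> acts on the coefficients \<open>f_L\<close> as a second
  order difference operator, so the smoothness of \<open>h\<close> gives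
  \<open>\<integral> v_L^2 (1 - x \<bullet> y)^s dy \<le> C L^(d-2s)\<close> for \<open>s \<le> \<kappa>\<close>, and the choices \<open>s = 0\<close> and
  \<open>s = \<lfloor>d/2\<rfloor> + 1\<close> control the \<open>L_1\<close> norm. Hence the convolutions are uniformly bounded on every
  \<open>L_n\<close> and converge strongly to the identity there.

  Let \<open>n\<close> be the even integer of the hypothesis. The moment \<open>E |T(x) - V_J(T;x)|^n\<close> expands into integrals
  of \<open>n\<close>-point moments of \<open>T\<close>, so by isotropy it does not depend on \<open>x\<close> and therefore equals its average
  \<open>E \<integral> |T(x) - V_J(T;x)|^n dx\<close> over the sphere, which tends to \<open>0\<close> by dominated convergence applied to
  the paths of \<open>T\<close>.
\<close>

section \<open>Gegenbauer polynomials\<close>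

text \<open>The reciprocal of the weight \<open>1 + (L^2 (1 - t))^s\<close> has an integral of order
  \<open>L^(-d)\<close> once \<open>2 s > d\<close>; the least such integer is
  \<open>s = d div 2 + 1\<close>, and the hypothesis on \<kappa> guarantees
  \<open>s \<le> \<kappa>\<close>. To spend only \<open>s\<close> differences on the power
  \<open>s\<close>, factors \<open>1 - t\<close> are shared equally between the two copies of
  \<open>v_L\<close>; for odd \<open>s\<close> the remaining factor is turned into a Dirichlet form,
  which costs one difference per copy instead of the two of the difference operator. The sphere
  measure is a cone measure and offers no density in \<open>t\<close>. Integrals of functions of one
  inner product are pinned down by rotation invariance instead: it determines the moments of linear
  forms, these give a rule of integration by parts, and orthogonality, norms and the three-term
  recurrence are algebra from there on. Isotropy speaks of \<open>T\<close> at finitely many fixed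
  points, whereas \<open>V_J\<close> integrates over a path; joint integrability bridges the two.
  Evenness of \<open>n\<close> makes the \<open>n\<close>-th power of the modulus a polynomial in
  \<open>T\<close> and \<open>V_J\<close>, and an elementary comparison of powers leads back from
  \<open>n\<close> to \<open>p\<close>.\<close>

definition jacobi_poly :: "real \<Rightarrow> real \<Rightarrow> nat \<Rightarrow> real poly" where
  "jacobi_poly \<alpha> \<beta> n =
     (\<Sum>s\<le>n. smult (((real n + \<alpha>) gchoose (n - s)) * ((real n + \<beta>) gchoose s))
              ([:- (1/2), 1/2:] ^ s * [:1/2, 1/2:] ^ (n - s)))"

lemma poly_jacobi_poly: "poly (jacobi_poly \<alpha> \<beta> n) t = jacobi \<alpha> \<beta> n t"
  unfolding jacobi_poly_def jacobi_def
  by (simp add: poly_sum mult.assoc diff_divide_distrib add_divide_distrib add.commute)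

lemma degree_half_powers: "degree ([:- (1/2), 1/2:] ^ a * [:1/2, 1/2:] ^ b :: real poly) = a + b"
  by (simp add: degree_mult_eq degree_power_eq)

lemma coeff_half_powers:
  "coeff ([:- (1/2), 1/2:] ^ a * [:1/2, 1/2:] ^ b :: real poly) (a + b) = (1/2) ^ (a + b)"
proof -
  have "lead_coeff ([:- (1/2), 1/2:] ^ a * [:1/2, 1/2:] ^ b :: real poly) = (1/2) ^ (a + b)"
    by (simp add: lead_coeff_mult lead_coeff_power power_add)
  then show ?thesis unfolding degree_half_powers .
qed

lemma degree_jacobi_poly_le: "degree (jacobi_poly \<alpha> \<beta> n) \<le> n"
  unfolding jacobi_poly_def
  by (intro degree_sum_le) (auto intro!: order.trans[OF degree_smult_le] simp: degree_half_powers simp del: degree_smult_eq)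

text \<open>Every summand is a product of \<open>n\<close> linear factors with leading coefficient
  1/2, so only the binomials differ, and Vandermonde's identity adds them up.\<close>

lemma coeff_jacobi_poly:
  "coeff (jacobi_poly \<alpha> \<beta> n) n = (2 * real n + \<alpha> + \<beta> gchoose n) / 2 ^ n"
proof -
  have "coeff (jacobi_poly \<alpha> \<beta> n) n =
    (\<Sum>s\<le>n. ((real n + \<alpha>) gchoose (n - s)) * ((real n + \<beta>) gchoose s) * (1/2) ^ n)"
    unfolding jacobi_poly_def coeff_sum
    by (intro sum.cong refl) (use coeff_half_powers in \<open>fastforce simp: le_iff_add\<close>)
  also have "\<dots> = (\<Sum>s\<in>{0..n}. ((real n + \<beta>) gchoose s) * ((real n + \<alpha>) gchoose (n - s))) * (1/2) ^ n"
    by (simp add: sum_distrib_left atMost_atLeast0 mult_ac)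
  also have "\<dots> = (2 * real n + \<alpha> + \<beta> gchoose n) / 2 ^ n"
    by (subst gbinomial_Vandermonde) (simp add: power_divide algebra_simps)
  finally show ?thesis .
qed

lemma jacobi_at_1: "jacobi \<alpha> \<beta> n 1 = (real n + \<alpha>) gchoose n"
proof -
  have "jacobi \<alpha> \<beta> n 1 = (\<Sum>s\<le>n. if s = 0 then (real n + \<alpha>) gchoose n else 0)"
    unfolding jacobi_def by (intro sum.cong) auto
  then show ?thesis by simp
qed

lemma gchoose_pos: "a > real n - 1 \<Longrightarrow> (a gchoose n) > 0" for a :: real
  by (auto simp: gbinomial_prod_rev intro!: divide_pos_pos prod_pos)

text \<open>The substitution of \<open>- t\<close> for \<open>t\<close> exchanges the factors
  \<open>(t - 1) / 2\<close> and \<open>(t + 1) / 2\<close> up to sign; as both parameters equal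
  \<alpha>, reversing the order of summation restores the original sum.\<close>

lemma jacobi_minus: "jacobi \<alpha> \<alpha> n (- t) = (- 1) ^ n * jacobi \<alpha> \<alpha> n t"
proof -
  define F where "F t s = ((real n + \<alpha>) gchoose (n - s)) * ((real n + \<alpha>) gchoose s)
              * ((t - 1) / 2) ^ s * ((t + 1) / 2) ^ (n - s)" for t s
  have "F (- t) (n - s) = (- 1) ^ n * F t s" if "s \<le> n" for s
  proof -
    have "((- t - 1) / 2) ^ (n - s) = (- 1) ^ (n - s) * ((t + 1) / 2) ^ (n - s)"
      by (subst power_mult_distrib[symmetric]) (rule arg_cong[of _ _ "\<lambda>z. z ^ (n - s)"], simp add: field_simps)
    moreover have "((- t + 1) / 2) ^ s = (- 1) ^ s * ((t - 1) / 2) ^ s"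
      by (subst power_mult_distrib[symmetric]) (rule arg_cong[of _ _ "\<lambda>z. z ^ s"], simp add: field_simps)
    moreover have "(- 1) ^ s * (- 1) ^ (n - s) = ((- 1) ^ n :: real)"
      using that by (simp flip: power_add)
    ultimately show ?thesis
      using that by (simp add: F_def mult.assoc mult.left_commute)
  qed
  then have "(\<Sum>s\<le>n. F (- t) s) = (- 1) ^ n * (\<Sum>s\<le>n. F t s)"
    by (subst sum.nat_diff_reindex[symmetric, of _ "Suc n", simplified lessThan_Suc_atMost])
       (auto simp: sum_distrib_left intro!: sum.cong)
  then show ?thesis by (simp add: jacobi_def F_def)
qed

text \<open>The left-hand side is the \<open>l\<close>-th forward difference of the rising factorial
  \<open>pochhammer _ k\<close> at \<open>x\<close>, and one difference maps
  \<open>pochhammer z k\<close> to \<open>k * pochhammer (z + 1) (k - 1)\<close>. Pascal's rule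
  drives the induction on \<open>l\<close>.\<close>

lemma sum_binomial_pochhammer:
  fixes x :: real
  shows "(\<Sum>s\<le>l. (- 1) ^ s * real (l choose s) * pochhammer (x + real (l - s)) k) =
    (if k < l then 0 else fact k / fact (k - l) * pochhammer (x + real l) (k - l))"
proof (induction l arbitrary: x k)
  case 0
  then show ?case by simp
next
  case (Suc l)
  define g where "g x = pochhammer x k" for x :: real
  have "(\<Sum>s\<le>Suc l. (- 1) ^ s * real (Suc l choose s) * g (x + real (Suc l - s)))
      = g (x + real (Suc l)) + (\<Sum>s\<le>l. (- 1) ^ Suc s * real (Suc l choose Suc s) * g (x + real (l - s)))"
    by (subst sum.atMost_Suc_shift) simp
  also have "(\<Sum>s\<le>l. (- 1) ^ Suc s * real (Suc l choose Suc s) * g (x + real (l - s)))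
      = (\<Sum>s\<le>l. (- 1) ^ Suc s * real (l choose Suc s) * g (x + real (l - s)))
        - (\<Sum>s\<le>l. (- 1) ^ s * real (l choose s) * g (x + real (l - s)))"
    unfolding sum_subtractf[symmetric] by (intro sum.cong) (auto simp: algebra_simps)
  also have "g (x + real (Suc l)) + ((\<Sum>s\<le>l. (- 1) ^ Suc s * real (l choose Suc s) * g (x + real (l - s))) - (\<Sum>s\<le>l. (- 1) ^ s * real (l choose s) * g (x + real (l - s))))
    = (\<Sum>s\<le>Suc l. (- 1) ^ s * real (l choose s) * g (x + real (Suc l - s)))
      - (\<Sum>s\<le>l. (- 1) ^ s * real (l choose s) * g (x + real (l - s)))"
    by (subst sum.atMost_Suc_shift) simp
  also have "\<dots> = (\<Sum>s\<le>l. (- 1) ^ s * real (l choose s) * g (x + 1 + real (l - s)))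
      - (\<Sum>s\<le>l. (- 1) ^ s * real (l choose s) * g (x + real (l - s)))"
  proof -
    have "(\<Sum>s\<le>Suc l. (- 1) ^ s * real (l choose s) * g (x + real (Suc l - s)))
      = (\<Sum>s\<le>l. (- 1) ^ s * real (l choose s) * g (x + real (Suc l - s)))"
      by (simp add: binomial_eq_0)
    also have "\<dots> = (\<Sum>s\<le>l. (- 1) ^ s * real (l choose s) * g (x + 1 + real (l - s)))"
      by (intro sum.cong) (auto simp: Suc_diff_le add_ac)
    finally show ?thesis by simp
  qed
  also have "\<dots> = (\<Sum>s\<le>l. (- 1) ^ s * real (l choose s) * (g (x + real (l - s) + 1) - g (x + real (l - s))))"
    by (simp add: sum_subtractf algebra_simps)
  finally have eq: "(\<Sum>s\<le>Suc l. (- 1) ^ s * real (Suc l choose s) * g (x + real (Suc l - s))) = \<dots>" .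
  show ?case
  proof (cases k)
    case 0
    then show ?thesis using eq by (simp add: g_def)
  next
    case (Suc j)
    have diff: "g (z + 1) - g z = real k * pochhammer (z + 1) j" for z
      unfolding g_def Suc pochhammer_rec[of z] pochhammer_Suc[of "z + 1"]
      by (simp add: algebra_simps)
    have "(\<Sum>s\<le>Suc l. (- 1) ^ s * real (Suc l choose s) * g (x + real (Suc l - s)))
      = real k * (\<Sum>s\<le>l. (- 1) ^ s * real (l choose s) * pochhammer ((x + 1) + real (l - s)) j)"
      unfolding eq diff sum_distrib_left by (intro sum.cong) (auto simp: algebra_simps)
    also have "\<dots> = (if k < Suc l then 0 else fact k / fact (k - Suc l) * pochhammer (x + real (Suc l)) (k - Suc l))"
      unfolding Suc.IH by (simp add: Suc add_divide_distrib algebra_simps)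
    finally show ?thesis unfolding g_def .
  qed
qed

section \<open>Gegenbauer polynomials as a basis graded by degree\<close>

definition gegenbauer_poly :: "nat \<Rightarrow> nat \<Rightarrow> real poly" where
  "gegenbauer_poly d l =
     (let \<alpha> = (real d - 2) / 2 in smult (1 / jacobi \<alpha> \<alpha> l 1) (jacobi_poly \<alpha> \<alpha> l))"

lemma poly_gegenbauer_poly: "poly (gegenbauer_poly d l) t = gegenbauer d l t"
  by (simp add: gegenbauer_poly_def gegenbauer_def Let_def poly_jacobi_poly)

lemma gegenbauer_minus: "gegenbauer d l (- t) = (- 1) ^ l * gegenbauer d l t"
  by (simp add: gegenbauer_def Let_def jacobi_minus)

lemma degree_gegenbauer_poly_le: "degree (gegenbauer_poly d l) \<le> l"
  unfolding gegenbauer_poly_def Let_def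
  by (intro order.trans[OF degree_smult_le] degree_jacobi_poly_le)

lemma coeff_gegenbauer_poly:
  "coeff (gegenbauer_poly d l) l =
     (2 * real l + real d - 2 gchoose l) / (2 ^ l * (real l + real d / 2 - 1 gchoose l))"
  by (simp add: gegenbauer_poly_def Let_def coeff_jacobi_poly jacobi_at_1 diff_divide_distrib algebra_simps)

lemma coeff_gegenbauer_poly_pos:
  assumes "d \<ge> 2"
  shows "coeff (gegenbauer_poly d l) l > 0"
  using assms unfolding coeff_gegenbauer_poly
  by (intro divide_pos_pos mult_pos_pos gchoose_pos) auto

text \<open>Triangularity: \<open>gegenbauer_poly d m\<close> has exact degree \<open>m\<close>, its
  leading coefficient being positive, so the top coefficient can be removed one degree at a
  time.\<close>

lemma gegenbauer_expansion:
  assumes "d \<ge> 2" "degree p \<le> n"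
  shows "\<exists>b. p = (\<Sum>m\<le>n. smult (b m) (gegenbauer_poly d m))"
  using assms(2)
proof (induction n arbitrary: p)
  case 0
  have "degree (gegenbauer_poly d 0) = 0" using degree_gegenbauer_poly_le[of d 0] by simp
  then obtain c where c: "gegenbauer_poly d 0 = [:c:]" by (metis degree_0_id)
  have "c \<noteq> 0" using coeff_gegenbauer_poly_pos[OF assms(1), of 0] c by auto
  moreover obtain a where "p = [:a:]" using 0 by (metis degree_0_id le_zero_eq)
  ultimately show ?case using c by (intro exI[of _ "\<lambda>_. a / c"]) auto
next
  case (Suc n)
  define a where "a = coeff p (Suc n) / coeff (gegenbauer_poly d (Suc n)) (Suc n)"
  define q where "q = p - smult a (gegenbauer_poly d (Suc n))"
  have "degree q \<le> Suc n" unfolding q_def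
    by (intro degree_diff_le Suc.prems order.trans[OF degree_smult_le] degree_gegenbauer_poly_le)
  moreover have "coeff q (Suc n) = 0"
    using coeff_gegenbauer_poly_pos[OF assms(1), of "Suc n"] by (simp add: q_def a_def)
  ultimately have "degree q \<le> n"
    by (metis degree_0 eq_zero_or_degree_less le_SucE less_Suc_eq_le zero_le leading_coeff_0_iff)
  then obtain b where b: "q = (\<Sum>m\<le>n. smult (b m) (gegenbauer_poly d m))"
    using Suc.IH by blast
  have "p = q + smult a (gegenbauer_poly d (Suc n))" by (simp add: q_def)
  also have "\<dots> = (\<Sum>m\<le>Suc n. smult ((b(Suc n := a)) m) (gegenbauer_poly d m))"
    unfolding b by (auto intro!: sum.cong)
  finally show ?case by blast
qed

text \<open>\<open>\<Lambda>\<close> is the normalised integral against \<open>(1 - t^2)^(d/2 - 1) dt\<close> on \<open>[-1, 1]\<close>, characterised by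
  integration by parts.\<close>

locale ultraspherical_mean =
  fixes d :: nat and \<Lambda> :: "real poly \<Rightarrow> real"
  assumes dim: "d \<ge> 2"
    and mean_add: "\<Lambda> (p + q) = \<Lambda> p + \<Lambda> q"
    and mean_smult: "\<Lambda> (smult c p) = c * \<Lambda> p"
    and mean_1: "\<Lambda> 1 = 1"
    and mean_by_parts: "\<Lambda> ([:1, 0, -1:] * pderiv p) = real d * \<Lambda> ([:0, 1:] * p)"
begin

section \<open>Beta moments, orthogonality and norms\<close>

lemma mean_0: "\<Lambda> 0 = 0"
  using mean_smult[of 0 0] by simp

lemma mean_diff: "\<Lambda> (p - q) = \<Lambda> p - \<Lambda> q"
  using mean_add[of "p - q" q] by simp

lemma mean_sum: "\<Lambda> (\<Sum>i\<in>A. f i) = (\<Sum>i\<in>A. \<Lambda> (f i))"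
  by (induction A rule: infinite_finite_induct) (auto simp: mean_0 mean_add)

text \<open>These are Beta integrals: with \<open>u = (1 - t) / 2\<close> and
  \<open>v = (1 + t) / 2\<close> the weight is a multiple of \<open>(u v)^(d/2 - 1)\<close>. Their
  values follow from two linear relations between neighbouring moments, namely
  \<open>u + v = 1\<close> and integration by parts applied to \<open>u^a v^b\<close>.\<close>

lemma mean_half_powers:
  "\<Lambda> ([:1/2, -(1/2):] ^ a * [:1/2, 1/2:] ^ b) =
    pochhammer (real d / 2) a * pochhammer (real d / 2) b / pochhammer (real d) (a + b)"
proof -
  define u v :: "real poly" where "u = [:1/2, -(1/2):]" and "v = [:1/2, 1/2:]"
  define M where "M a b = \<Lambda> (u ^ a * v ^ b)" for a b
  have split: "M (Suc a) b + M a (Suc b) = M a b" for a b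
  proof -
    have "u + v = 1" by (simp add: u_def v_def)
    have "M (Suc a) b + M a (Suc b) = \<Lambda> (u ^ a * v ^ b * (u + v))"
      by (simp add: M_def mean_add[symmetric] algebra_simps)
    then show ?thesis by (simp add: \<open>u + v = 1\<close> M_def)
  qed
  \<comment> \<open>Rests on \<open>1 - t^2 = 4 u v\<close> and \<open>t = v - u\<close>.\<close>
  have balance: "(2 * real b + d) * M (Suc a) b = (2 * real a + d) * M a (Suc b)" for a b
  proof -
    have "pderiv u = [:- (1/2):]" "pderiv v = [:1/2:]"
      by (simp_all add: u_def v_def pderiv_pCons)
    then have pu: "pderiv (u ^ a) = smult (- real a / 2) (u ^ (a - 1))"
      and pv: "pderiv (v ^ b) = smult (real b / 2) (v ^ (b - 1))"
      by (simp_all add: pderiv_power)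
    have w: "[:1, 0, -1:] = smult 4 (u * v)" and t: "[:0, 1:] = v - u"
      by (simp_all add: u_def v_def)
    have "[:1, 0, -1:] * pderiv (u ^ a * v ^ b)
        = smult (2 * real b) (u ^ Suc a * v ^ b) - smult (2 * real a) (u ^ a * v ^ Suc b)"
      unfolding pderiv_mult pu pv w
      by (cases a; cases b) (simp_all add: poly_eq_poly_eq_iff[symmetric] fun_eq_iff field_simps)
    then have e1: "\<Lambda> ([:1, 0, -1:] * pderiv (u ^ a * v ^ b)) = 2 * real b * M (Suc a) b - 2 * real a * M a (Suc b)"
      by (simp add: mean_diff mean_smult M_def)
    have e2: "\<Lambda> ([:0, 1:] * (u ^ a * v ^ b)) = M a (Suc b) - M (Suc a) b"
      unfolding t by (simp add: M_def mean_diff[symmetric] algebra_simps)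
    show ?thesis
      using mean_by_parts[of "u ^ a * v ^ b"] unfolding e1 e2 by (simp add: algebra_simps)
  qed
  have rec1: "M (Suc a) b = M a b * (real d / 2 + real a) / (real d + real (a + b))" for a b
  proof -
    have "(2 * real b + d) * M (Suc a) b = (2 * real a + d) * (M a b - M (Suc a) b)"
      using balance[of b a] by (simp flip: split[of a b])
    then show ?thesis using dim by (simp add: field_simps)
  qed
  have rec2: "M a (Suc b) = M a b * (real d / 2 + real b) / (real d + real (a + b))" for a b
  proof -
    have "M a (Suc b) = M a b - M (Suc a) b" using split[of a b] by simp
    also have "\<dots> = M a b * (real d / 2 + real b) / (real d + real (a + b))"
      unfolding rec1 using dim by (simp add: field_simps)
    finally show ?thesis .
  qed
  have "M 0 b = pochhammer (real d / 2) b / pochhammer (real d) b"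
  proof (induction b)
    case 0 then show ?case by (simp add: M_def mean_1)
  next
    case (Suc b)
    then show ?case using dim by (simp add: rec2 pochhammer_Suc)
  qed
  then have "M a b = pochhammer (real d / 2) a * pochhammer (real d / 2) b / pochhammer (real d) (a + b)"
  proof (induction a)
    case (Suc a)
    then show ?case using dim by (simp add: rec1 pochhammer_Suc)
  qed simp
  then show ?thesis by (simp add: M_def u_def v_def)
qed

text \<open>Up to a factor the moment is an \<open>l\<close>-th finite difference of the polynomial
  \<open>s \<mapsto> pochhammer (d / 2 + s) k\<close> of degree \<open>k\<close>.\<close>

lemma mean_jacobi_half_power:
  fixes l k :: nat
  defines "\<alpha> \<equiv> (real d - 2) / 2"
  shows "\<Lambda> (jacobi_poly \<alpha> \<alpha> l * [:1/2, 1/2:] ^ k) =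
    (if k < l then 0
     else (pochhammer (real d / 2) l)\<^sup>2 / (fact l * pochhammer (real d) (l + k))
       * (fact k / fact (k - l) * pochhammer (real d / 2 + real l) (k - l)))"
proof -
  let ?u = "[:1/2, -(1/2):] :: real poly" and ?v = "[:1/2, 1/2:] :: real poly"
  let ?P = "pochhammer (real d / 2)"
  have P: "?P n > 0" for n using dim by (intro pochhammer_pos) auto
  have neg: "[:- (1/2), 1/2:] ^ s = smult ((- 1) ^ s) (?u ^ s)" for s
  proof -
    have "[:- (1/2), 1/2:] = smult (- 1) ?u" by simp
    then show ?thesis by (metis smult_power)
  qed
  have gc: "(real l + \<alpha>) gchoose (l - s) = ?P l / (fact (l - s) * ?P s)" if "s \<le> l" for s
  proof -
    have "(real l + \<alpha>) gchoose (l - s) = pochhammer (real d / 2 + real s) (l - s) / fact (l - s)"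
      using that by (subst gbinomial_pochhammer') (simp add: \<alpha>_def of_nat_diff field_simps)
    moreover have "?P l = ?P s * pochhammer (real d / 2 + real s) (l - s)"
      using that by (metis pochhammer_product)
    ultimately show ?thesis using P[of s] by simp
  qed
  have gc': "(real l + \<alpha>) gchoose s = ?P l / (fact s * ?P (l - s))" if "s \<le> l" for s
    using gc[of "l - s"] that by simp
  have "\<Lambda> (jacobi_poly \<alpha> \<alpha> l * ?v ^ k)
      = (\<Sum>s\<le>l. ((real l + \<alpha>) gchoose (l - s)) * ((real l + \<alpha>) gchoose s) * (- 1) ^ s
          * \<Lambda> (?u ^ s * ?v ^ (l - s + k)))"
    unfolding jacobi_poly_def neg sum_distrib_right mean_sum
    by (intro sum.cong refl) (simp only: power_add mult_smult_left mult_smult_right mean_smult mult.assoc)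
  also have "\<dots> = (\<Sum>s\<le>l. (?P l)\<^sup>2 / (fact l * pochhammer (real d) (l + k))
      * ((- 1) ^ s * real (l choose s) * pochhammer (real d / 2 + real (l - s)) k))"
  proof (intro sum.cong refl)
    fix s assume "s \<in> {..l}"
    then have s: "s \<le> l" by simp
    have "?P (l - s + k) = ?P (l - s) * pochhammer (real d / 2 + real (l - s)) k"
      by (rule pochhammer_product')
    then show "((real l + \<alpha>) gchoose (l - s)) * ((real l + \<alpha>) gchoose s) * (- 1) ^ s
          * \<Lambda> (?u ^ s * ?v ^ (l - s + k)) = (?P l)\<^sup>2 / (fact l * pochhammer (real d) (l + k))
      * ((- 1) ^ s * real (l choose s) * pochhammer (real d / 2 + real (l - s)) k)"
      unfolding mean_half_powers gc[OF s] gc'[OF s] binomial_fact[OF s]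
      using P[of s] P[of "l - s"] s by (simp add: field_simps power2_eq_square)
  qed
  also have "\<dots> = (?P l)\<^sup>2 / (fact l * pochhammer (real d) (l + k))
      * (\<Sum>s\<le>l. (- 1) ^ s * real (l choose s) * pochhammer (real d / 2 + real (l - s)) k)"
    by (simp add: sum_distrib_left)
  finally show ?thesis unfolding sum_binomial_pochhammer by simp
qed

text \<open>The lower coefficients stay anonymous because orthogonality will annihilate them; only
  the coefficient of the top power of \<open>(1 + t) / 2\<close> enters the later
  computation.\<close>

lemma half_power_expansion:
  fixes p :: "real poly"
  shows "degree p \<le> n \<Longrightarrow> \<exists>c. p = smult (2 ^ n * coeff p n) ([:1/2, 1/2:] ^ n) + (\<Sum>k<n. smult (c k) ([:1/2, 1/2:] ^ k))"
proof (induction n arbitrary: p)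
  case 0
  then obtain a where "p = [:a:]" by (metis degree_0_id le_zero_eq)
  then show ?case by simp
next
  case (Suc n)
  define q where "q = p - smult (2 ^ Suc n * coeff p (Suc n)) ([:1/2, 1/2:] ^ Suc n)"
  have lead: "coeff ([:1/2, 1/2:] ^ m :: real poly) m = (1/2) ^ m" for m
    using coeff_half_powers[of 0 m] by simp
  have "degree q \<le> Suc n" unfolding q_def
    by (intro degree_diff_le Suc.prems order.trans[OF degree_smult_le])
       (use degree_half_powers[of 0 "Suc n"] in simp)
  moreover have "coeff q (Suc n) = 0"
    unfolding q_def coeff_diff coeff_smult lead by (simp add: power_divide)
  ultimately have "degree q \<le> n"
    by (metis degree_0 le_SucE zero_le leading_coeff_0_iff)
  from Suc.IH[OF this] obtain c where
    c: "q = smult (2 ^ n * coeff q n) ([:1/2, 1/2:] ^ n) + (\<Sum>k<n. smult (c k) ([:1/2, 1/2:] ^ k))" by blast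
  have "q = (\<Sum>k<Suc n. smult ((c(n := 2 ^ n * coeff q n)) k) ([:1/2, 1/2:] ^ k))"
    by (subst c) auto
  moreover have "p = smult (2 ^ Suc n * coeff p (Suc n)) ([:1/2, 1/2:] ^ Suc n) + q"
    by (simp add: q_def)
  ultimately show ?case by metis
qed

text \<open>In the expansion of \<open>p\<close> in powers of \<open>(1 + t) / 2\<close> only the
  power \<open>l\<close> survives, since the lower moments vanish. Orthogonality is the case
  \<open>coeff p l = 0\<close>, the norm the case where \<open>p\<close> is the Gegenbauer
  polynomial itself.\<close>

lemma mean_gegenbauer_mult:
  assumes "degree p \<le> l"
  shows "\<Lambda> (gegenbauer_poly d l * p) =
    2 ^ l * coeff p l * (pochhammer (real d / 2) l * fact l / pochhammer (real d) (2 * l))"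
proof -
  define \<alpha> where "\<alpha> = (real d - 2) / 2"
  let ?v = "[:1/2, 1/2:] :: real poly" and ?P = "pochhammer (real d / 2) l"
  have P: "?P > 0" using dim by (intro pochhammer_pos) auto
  obtain c where c: "p = smult (2 ^ l * coeff p l) (?v ^ l) + (\<Sum>k<l. smult (c k) (?v ^ k))"
    using half_power_expansion[OF assms] by blast
  have J1: "jacobi \<alpha> \<alpha> l 1 = ?P / fact l"
    unfolding jacobi_at_1 by (subst gbinomial_pochhammer') (simp add: \<alpha>_def field_simps)
  have "\<Lambda> (jacobi_poly \<alpha> \<alpha> l * p) = 2 ^ l * coeff p l * \<Lambda> (jacobi_poly \<alpha> \<alpha> l * ?v ^ l)
      + (\<Sum>k<l. c k * \<Lambda> (jacobi_poly \<alpha> \<alpha> l * ?v ^ k))"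
    by (subst c) (simp only: distrib_left mean_add mean_sum sum_distrib_left mult_smult_right mean_smult)
  also have "(\<Sum>k<l. c k * \<Lambda> (jacobi_poly \<alpha> \<alpha> l * ?v ^ k)) = 0"
    by (intro sum.neutral) (simp add: mean_jacobi_half_power \<alpha>_def)
  also have "\<Lambda> (jacobi_poly \<alpha> \<alpha> l * ?v ^ l) = ?P\<^sup>2 / pochhammer (real d) (2 * l)"
    unfolding \<alpha>_def mean_jacobi_half_power by (simp add: mult_2)
  finally have "\<Lambda> (jacobi_poly \<alpha> \<alpha> l * p) = 2 ^ l * coeff p l * (?P\<^sup>2 / pochhammer (real d) (2 * l))"
    by simp
  moreover have "gegenbauer_poly d l = smult (fact l / ?P) (jacobi_poly \<alpha> \<alpha> l)"
    unfolding gegenbauer_poly_def Let_def \<alpha>_def[symmetric] J1 by simp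
  ultimately show ?thesis using P by (simp add: mean_smult power2_eq_square)
qed

lemma Z_eq: "Z d l = (2 * real l + real d - 1) * fact (l + d - 2) / (fact (d - 1) * fact l)"
proof -
  have "real l + real d - 1 = 1 + real (l + d - 2)" "real d = 1 + real (d - 1)" "real l + 1 = 1 + real l"
    using dim by (auto simp: of_nat_diff)
  then have "Gamma (real l + real d - 1) = fact (l + d - 2)" "Gamma (real d) = fact (d - 1)" "Gamma (real l + 1) = fact l"
    by (simp_all only: Gamma_fact)
  then show ?thesis by (simp add: Z_def)
qed

lemma Z_pos: "Z d l > 0"
  unfolding Z_eq using dim by (intro divide_pos_pos mult_pos_pos) auto

lemma mean_gegenbauer_square: "\<Lambda> (gegenbauer_poly d l * gegenbauer_poly d l) = 1 / Z d l"
proof -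
  have P: "pochhammer (real d / 2) l > 0" using dim by (intro pochhammer_pos) auto
  have gc1: "real l + real d / 2 - 1 gchoose l = pochhammer (real d / 2) l / fact l"
    by (subst gbinomial_pochhammer') (simp add: field_simps)
  have "2 * real l + real d - 2 = real (2 * l + d - 2)" using dim by (simp add: of_nat_diff)
  then have gc2: "2 * real l + real d - 2 gchoose l = fact (2 * l + d - 2) / (fact l * fact (l + d - 2))"
    using dim by (simp only: binomial_gbinomial[symmetric]) (subst binomial_fact, auto)
  have d: "real d = real (Suc (d - 1))" using dim by simp
  have poch: "pochhammer (real d) (2 * l) = (2 * real l + real d - 1) * fact (2 * l + d - 2) / fact (d - 1)"
  proof -
    have "fact (d - 1 + 2 * l) = fact (d - 1) * (pochhammer (real d) (2 * l))"
      using pochhammer_product'[of "1::real" "d - 1" "2 * l"] d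
      by (simp only: pochhammer_fact of_nat_Suc)
    moreover have "fact (d - 1 + 2 * l) = (2 * real l + real d - 1) * fact (2 * l + d - 2)"
    proof -
      have "d - 1 + 2 * l = Suc (2 * l + d - 2)" using dim by simp
      then show ?thesis using dim by (simp only: fact_Suc) (simp add: of_nat_diff)
    qed
    ultimately show ?thesis by (simp add: field_simps)
  qed
  define K where "K = 2 * real l + real d - 1"
  have "K > 0" using dim by (simp add: K_def)
  then show ?thesis
    unfolding mean_gegenbauer_mult[OF degree_gegenbauer_poly_le] coeff_gegenbauer_poly gc1 gc2 poch Z_eq K_def[symmetric]
    using P by (simp add: field_simps)
qed

lemma mean_gegenbauer_orthogonal_poly:
  assumes "degree p < l"
  shows "\<Lambda> (gegenbauer_poly d l * p) = 0"
  using assms by (subst mean_gegenbauer_mult) (auto simp: coeff_eq_0)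

lemma mean_gegenbauer_mult_gegenbauer:
  "\<Lambda> (gegenbauer_poly d l * gegenbauer_poly d m) = (if l = m then 1 / Z d l else 0)"
proof (cases l m rule: linorder_cases)
  case less
  then show ?thesis
    using mean_gegenbauer_orthogonal_poly[of "gegenbauer_poly d l" m] degree_gegenbauer_poly_le[of d l]
    by (simp add: mult.commute)
next
  case greater
  then show ?thesis
    using mean_gegenbauer_orthogonal_poly[of "gegenbauer_poly d m" l] degree_gegenbauer_poly_le[of d m] by simp
qed (simp add: mean_gegenbauer_square)

lemma gegenbauer_expansion_coeff:
  assumes "p = (\<Sum>m\<le>n. smult (b m) (gegenbauer_poly d m))" "m \<le> n"
  shows "b m = Z d m * \<Lambda> (p * gegenbauer_poly d m)"
proof -
  have "\<Lambda> (p * gegenbauer_poly d m) = (\<Sum>k\<le>n. b k * (if k = m then 1 / Z d k else 0))"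
    unfolding assms(1) sum_distrib_right mean_sum
    by (simp add: mean_smult mean_gegenbauer_mult_gegenbauer)
  also have "\<dots> = (\<Sum>k\<le>n. if k = m then b k / Z d k else 0)"
    by (intro sum.cong) auto
  also have "\<dots> = b m / Z d m" using assms(2) by simp
  finally show ?thesis using Z_pos[of m] by simp
qed

end

text \<open>\<open>Zup\<close> collects the coefficients of the three-term recurrence
  \<open>t Z_l P_l = Zup l P_(l+1) + Zup (l-1) P_(l-1)\<close>; \<open>gdiff\<close> is multiplication by \<open>1 - t\<close>, seen on the
  coefficients of \<open>zonal_sum\<close>.\<close>

definition Zup :: "nat \<Rightarrow> nat \<Rightarrow> real" where
  "Zup d l = Z d l * (real l + real d - 1) / (2 * real l + real d - 1)"

definition zonal_sum :: "nat \<Rightarrow> nat \<Rightarrow> (nat \<Rightarrow> real) \<Rightarrow> real poly" where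
  "zonal_sum d K f = (\<Sum>l<K. smult (f l * Z d l) (gegenbauer_poly d l))"

definition gdiff :: "nat \<Rightarrow> (nat \<Rightarrow> real) \<Rightarrow> nat \<Rightarrow> real" where
  "gdiff d f l = f l - ((real l + real d - 1) * f (Suc l) + real l * f (l - 1)) / (2 * real l + real d - 1)"

lemma poly_zonal_sum: "poly (zonal_sum d K f) t = (\<Sum>l<K. f l * Z d l * gegenbauer d l t)"
  by (simp add: zonal_sum_def poly_sum poly_gegenbauer_poly)

section \<open>The three-term recurrence\<close>

context ultraspherical_mean
begin

lemma Z_Suc: "Z d (Suc l) * (real l + 1) * (2 * real l + real d - 1) = Z d l * (2 * real l + real d + 1) * (real l + real d - 1)"
proof -
  have f: "fact (Suc l + d - 2) = (real l + real d - 1) * fact (l + d - 2)"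
  proof -
    have "Suc l + d - 2 = Suc (l + d - 2)" using dim by simp
    then show ?thesis using dim by (simp only: fact_Suc) (simp add: of_nat_diff)
  qed
  define F where "F = (fact (l + d - 2) :: real)"
  have "Z d (Suc l) = (2 * real l + real d + 1) * ((real l + real d - 1) * F) / (fact (d - 1) * ((real l + 1) * fact l))"
    unfolding Z_eq[of "Suc l"] f F_def by (simp add: algebra_simps)
  moreover have "Z d l = (2 * real l + real d - 1) * F / (fact (d - 1) * fact l)"
    unfolding Z_eq F_def ..
  moreover have "(p * (q * F) / (G * (s * H))) * s * r = (r * F / (G * H)) * p * q" if "s \<noteq> 0"
    for p q r s G H :: real using that by simp
  ultimately show ?thesis by (simp only:)
qed

lemma gegenbauer_at_1: "gegenbauer d l 1 = 1"
  using dim by (rule gegenbauer_1)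

lemma Zup_le: "Zup d l \<le> Z d l"
  using Z_pos[of l] dim by (simp add: Zup_def field_simps)

text \<open>The coefficient of \<open>P_l\<close> in \<open>t Z_(l+1) P_(l+1)\<close> equals that of
  \<open>P_(l+1)\<close> in \<open>t Z_l P_l\<close>: multiplication by \<open>t\<close> is
  symmetric with respect to \<Lambda>.\<close>

lemma Zup_pred: "Zup d l = Z d (Suc l) * (real l + 1) / (2 * real l + real d + 1)"
  using Z_Suc[of l] dim by (simp add: Zup_def field_simps)

text \<open>This is the three-term recurrence at \<open>t = 1\<close>. It lets the quadratic form of
  \<open>1 - t\<close> be written as a sum of squared differences.\<close>

lemma Zup_Suc_add: "Zup d (Suc l) + Zup d l = Z d (Suc l)"
proof -
  have "Zup d (Suc l) = Z d (Suc l) * (real l + real d) / (2 * real l + real d + 1)"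
    by (simp add: Zup_def algebra_simps)
  moreover have "2 * real l + real d + 1 > 0" using dim by simp
  ultimately show ?thesis unfolding Zup_pred[of l] by (simp add: field_simps)
qed

lemma Zup_0: "Zup d 0 = Z d 0"
  using dim by (simp add: Zup_def)

lemma degree_X_gegenbauer: "degree ([:0, 1:] * gegenbauer_poly d l) \<le> Suc l"
  using degree_gegenbauer_poly_le[of d l] by (auto intro!: order.trans[OF degree_pCons_le])

text \<open>The coefficient of \<open>P_l\<close> in \<open>t P_l\<close> vanishes by comparing the values at \<open>1\<close> and \<open>-1\<close>.\<close>

lemma X_gegenbauer_aux:
  "\<exists>A B. [:0, 1:] * gegenbauer_poly d l =
     smult A (gegenbauer_poly d (Suc l)) + (if l = 0 then 0 else smult B (gegenbauer_poly d (l - 1)))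
     \<and> A = Z d (Suc l) * \<Lambda> ([:0, 1:] * gegenbauer_poly d l * gegenbauer_poly d (Suc l))
     \<and> (l > 0 \<longrightarrow> B = Z d (l - 1) * \<Lambda> ([:0, 1:] * gegenbauer_poly d (l - 1) * gegenbauer_poly d l))"
proof -
  let ?G = "gegenbauer_poly d"
  obtain b where b: "[:0, 1:] * ?G l = (\<Sum>m\<le>Suc l. smult (b m) (?G m))"
    using gegenbauer_expansion[OF dim degree_X_gegenbauer] by blast
  have bm: "b m = Z d m * \<Lambda> ([:0, 1:] * ?G l * ?G m)" if "m \<le> Suc l" for m
    by (rule gegenbauer_expansion_coeff[OF b that])
  have low: "b m = 0" if "Suc m < l" for m
  proof -
    have "degree ([:0, 1:] * ?G m) < l"
      using degree_X_gegenbauer[of m] that by (rule order.strict_trans1)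
    from mean_gegenbauer_orthogonal_poly[OF this] have "\<Lambda> ([:0, 1:] * ?G l * ?G m) = 0"
      by (simp only: mult_ac)
    then show ?thesis using bm[of m] that by simp
  qed
  have ev: "t * gegenbauer d l t = (\<Sum>m\<le>Suc l. b m * gegenbauer d m t)" for t
    using arg_cong[OF b, of "\<lambda>p. poly p t"] by (simp add: poly_sum poly_gegenbauer_poly)
  show ?thesis
  proof (cases l)
    case 0
    have "b 0 = 0" using ev[of 1] ev[of "- 1"] gegenbauer_minus[of d 0 1] gegenbauer_minus[of d 1 1]
      by (simp add: 0 gegenbauer_at_1)
    then show ?thesis using b bm[of 1] by (intro exI[of _ "b 1"] exI[of _ 0]) (simp add: 0)
  next
    case (Suc k)
    have sum: "(\<Sum>m\<le>Suc l. f m) = f k + f (Suc k) + f (Suc (Suc k))" if "\<And>m. Suc m < l \<Longrightarrow> f m = 0"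
      for f :: "nat \<Rightarrow> 'a::comm_monoid_add"
    proof -
      have "(\<Sum>m\<le>Suc l. f m) = (\<Sum>m\<in>{k, Suc k, Suc (Suc k)}. f m)"
        using Suc that by (intro sum.mono_neutral_right) auto
      then show ?thesis by (simp add: add.assoc)
    qed
    have s1: "t * gegenbauer d l t = b k * gegenbauer d k t + b (Suc k) * gegenbauer d (Suc k) t
        + b (Suc (Suc k)) * gegenbauer d (Suc (Suc k)) t" for t
      unfolding ev by (rule sum) (simp add: low)
    have "b (Suc k) = 0"
      using s1[of 1] s1[of "- 1"] gegenbauer_minus[of d k 1] gegenbauer_minus[of d "Suc k" 1] gegenbauer_minus[of d "Suc (Suc k)" 1]
      by (cases "even k") (simp_all add: Suc gegenbauer_at_1)
    moreover have "[:0, 1:] * ?G l = smult (b k) (?G k) + smult (b (Suc k)) (?G (Suc k))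
        + smult (b (Suc (Suc k))) (?G (Suc (Suc k)))"
      unfolding b by (rule sum) (simp add: low)
    ultimately have "[:0, 1:] * ?G l = smult (b (Suc l)) (?G (Suc l)) + smult (b k) (?G k)"
      by (simp only: Suc) simp
    moreover have "b k = Z d (l - 1) * \<Lambda> ([:0, 1:] * ?G (l - 1) * ?G l)"
      using bm[of k] Suc by (simp add: mult_ac del: mult_pCons_left mult_pCons_right)
    ultimately show ?thesis using bm[of "Suc l"]
      by (intro exI[of _ "b (Suc l)"] exI[of _ "b k"]) (simp only: Suc, simp)
  qed
qed

text \<open>Induction through the values at 1: the two coefficients of \<open>t P_(l+1)\<close> add
  up to 1, and the lower one involves the same moment of \<open>t P_l P_(l+1)\<close> that the
  previous step has evaluated.\<close>

lemma mean_X_gegenbauer_Suc: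
  "Z d (Suc l) * \<Lambda> ([:0, 1:] * gegenbauer_poly d l * gegenbauer_poly d (Suc l))
    = (real l + real d - 1) / (2 * real l + real d - 1)"
proof (induction l)
  case 0
  obtain A where A: "[:0, 1:] * gegenbauer_poly d 0 = smult A (gegenbauer_poly d (Suc 0))"
    "A = Z d (Suc 0) * \<Lambda> ([:0, 1:] * gegenbauer_poly d 0 * gegenbauer_poly d (Suc 0))"
    using X_gegenbauer_aux[of 0] by auto
  have "A = 1"
    using arg_cong[OF A(1), of "\<lambda>p. poly p 1"] by (simp add: poly_gegenbauer_poly gegenbauer_at_1)
  then show ?case using A(2) dim by simp
next
  case (Suc l)
  let ?X = "\<lambda>l. \<Lambda> ([:0, 1:] * gegenbauer_poly d l * gegenbauer_poly d (Suc l))"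
  obtain A B where AB: "[:0, 1:] * gegenbauer_poly d (Suc l) =
     smult A (gegenbauer_poly d (Suc (Suc l))) + smult B (gegenbauer_poly d l)"
    "A = Z d (Suc (Suc l)) * ?X (Suc l)" "B = Z d l * ?X l"
    using X_gegenbauer_aux[of "Suc l"] by auto
  have 1: "A + B = 1"
    using arg_cong[OF AB(1), of "\<lambda>p. poly p 1"] by (simp add: poly_gegenbauer_poly gegenbauer_at_1)
  have "Z d (Suc l) * B = Zup d l"
    using arg_cong[OF Suc.IH, of "\<lambda>x. Z d l * x"] by (simp only: AB(3) Zup_def) (simp add: mult_ac del: mult_pCons_left mult_pCons_right)
  then have "Z d (Suc l) * B = Z d (Suc l) * ((real l + 1) / (2 * real l + real d + 1))"
    unfolding Zup_pred by simp
  then have "B = (real l + 1) / (2 * real l + real d + 1)"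
    using Z_pos[of "Suc l"] by (simp only: mult_cancel_left) simp
  then have "A = 1 - (real l + 1) / (2 * real l + real d + 1)" using 1 by simp
  also have "\<dots> = (real (Suc l) + real d - 1) / (2 * real (Suc l) + real d - 1)"
    using dim by (simp add: field_simps)
  finally show ?case using AB(2) by simp
qed

lemma X_gegenbauer_poly:
  "[:0, 1:] * smult (Z d l) (gegenbauer_poly d l) =
     smult (Zup d l) (gegenbauer_poly d (Suc l)) + (if l = 0 then 0 else smult (Zup d (l - 1)) (gegenbauer_poly d (l - 1)))"
proof -
  obtain A B where AB: "[:0, 1:] * gegenbauer_poly d l =
     smult A (gegenbauer_poly d (Suc l)) + (if l = 0 then 0 else smult B (gegenbauer_poly d (l - 1)))"
     "A = Z d (Suc l) * \<Lambda> ([:0, 1:] * gegenbauer_poly d l * gegenbauer_poly d (Suc l))"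
     "l > 0 \<longrightarrow> B = Z d (l - 1) * \<Lambda> ([:0, 1:] * gegenbauer_poly d (l - 1) * gegenbauer_poly d l)"
    using X_gegenbauer_aux[of l] by blast
  have A: "Z d l * A = Zup d l" unfolding AB(2) mean_X_gegenbauer_Suc Zup_def by simp
  have B: "Z d l * B = Zup d (l - 1)" if l: "l > 0"
  proof -
    obtain k where k: "l = Suc k" using l by (cases l) auto
    show ?thesis
      using AB(3) arg_cong[OF mean_X_gegenbauer_Suc[of k], of "\<lambda>x. Z d k * x"]
      by (simp add: k Zup_def mult_ac del: mult_pCons_left mult_pCons_right)
  qed
  have "[:0, 1:] * smult (Z d l) (gegenbauer_poly d l) = smult (Z d l) ([:0, 1:] * gegenbauer_poly d l)"
    by (simp only: mult_smult_right)
  also have "\<dots> = smult (Z d l * A) (gegenbauer_poly d (Suc l))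
      + (if l = 0 then 0 else smult (Z d l * B) (gegenbauer_poly d (l - 1)))"
    unfolding AB(1) by (simp add: smult_add_right)
  finally show ?thesis using A B by (simp only: bot_nat_0.not_eq_extremum split: if_splits) auto
qed

section \<open>Parseval's identity and multiplication by \<open>1 - t\<close>\<close>

lemma mean_zonal_sum_mult: "\<Lambda> (zonal_sum d K f * zonal_sum d K g) = (\<Sum>l<K. f l * g l * Z d l)"
proof -
  have "\<Lambda> (zonal_sum d K f * zonal_sum d K g) = (\<Sum>l<K. \<Sum>m<K. f l * Z d l * (g m * Z d m) * (if l = m then 1 / Z d l else 0))"
    unfolding zonal_sum_def sum_product mean_sum
    by (simp add: mean_smult mean_gegenbauer_mult_gegenbauer mult_ac)
  also have "\<dots> = (\<Sum>l<K. \<Sum>m<K. if l = m then f l * g l * Z d l else 0)"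
    using Z_pos by (intro sum.cong refl) (auto simp: less_le)
  finally show ?thesis by simp
qed

text \<open>After multiplication by \<open>Z\<close> the operator \<open>gdiff\<close> has symmetric
  off-diagonal weights \<open>Zup\<close>; the summations by parts rely on this form.\<close>

lemma gdiff_Z: "gdiff d f l * Z d l = f l * Z d l - Zup d l * f (Suc l) - (if l = 0 then 0 else Zup d (l - 1)) * f (l - 1)"
proof -
  have down: "Z d l * real l / (2 * real l + real d - 1) = (if l = 0 then 0 else Zup d (l - 1))"
    using Zup_pred[of "l - 1"] by (cases l) (auto simp: algebra_simps)
  have up: "Z d l * (real l + real d - 1) / (2 * real l + real d - 1) = Zup d l"
    by (rule Zup_def[symmetric])
  have "(x - (a * y + b * z) / K) * c = x * c - c * a / K * y - c * b / K * z" for x y z a b c K :: real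
    by (simp add: add_divide_distrib algebra_simps)
  then show ?thesis unfolding gdiff_def up[symmetric] down[symmetric] by this
qed

text \<open>The sum runs one index past the support of \<open>f\<close>, because multiplication by
  \<open>1 - t\<close> raises the degree by one.\<close>

lemma zonal_sum_gdiff:
  assumes "\<And>l. l \<ge> K \<Longrightarrow> f l = 0"
  shows "[:1, -1:] * zonal_sum d (Suc K) f = zonal_sum d (Suc K) (gdiff d f)"
proof -
  let ?G = "gegenbauer_poly d"
  have "[:0, 1:] * zonal_sum d (Suc K) f = (\<Sum>l<Suc K. smult (f l) ([:0, 1:] * smult (Z d l) (?G l)))"
    by (simp only: zonal_sum_def sum_distrib_left mult_smult_right smult_smult)
  also have "\<dots> = (\<Sum>l<Suc K. smult (f l * Zup d l) (?G (Suc l)))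
      + (\<Sum>l<Suc K. if l = 0 then 0 else smult (f l * Zup d (l - 1)) (?G (l - 1)))"
    unfolding X_gegenbauer_poly sum.distrib[symmetric]
    by (intro sum.cong refl) (simp add: smult_add_right)
  \<comment> \<open>The boundary term of this shift carries \<open>f K = 0\<close>; that of the
    opposite shift below carries \<open>f (Suc K) = 0\<close>.\<close>
  also have "(\<Sum>l<Suc K. smult (f l * Zup d l) (?G (Suc l)))
      = (\<Sum>l<Suc K. if l = 0 then 0 else smult (f (l - 1) * Zup d (l - 1)) (?G l))"
    using assms[of K] unfolding sum.lessThan_Suc_shift[of "\<lambda>l. if l = 0 then 0 else _ l"] by simp
  also have "(\<Sum>l<Suc K. if l = 0 then 0 else smult (f l * Zup d (l - 1)) (?G (l - 1)))
      = (\<Sum>l<Suc K. smult (f (Suc l) * Zup d l) (?G l))"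
    using assms[of "Suc K"] unfolding sum.lessThan_Suc_shift[of "\<lambda>l. if l = 0 then 0 else _ l"] by simp
  also have "(\<Sum>l<Suc K. if l = 0 then 0 else smult (f (l - 1) * Zup d (l - 1)) (?G l)) + (\<Sum>l<Suc K. smult (f (Suc l) * Zup d l) (?G l))
    = (\<Sum>l<Suc K. smult ((if l = 0 then 0 else f (l - 1) * Zup d (l - 1)) + f (Suc l) * Zup d l) (?G l))"
    unfolding sum.distrib[symmetric] by (intro sum.cong refl) (simp add: smult_add_left)
  finally have X: "[:0, 1:] * zonal_sum d (Suc K) f = \<dots>" .
  have "[:1, -1:] * zonal_sum d (Suc K) f = zonal_sum d (Suc K) f - [:0, 1:] * zonal_sum d (Suc K) f"
    by simp
  also have "\<dots> = zonal_sum d (Suc K) (gdiff d f)"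
    unfolding X unfolding zonal_sum_def sum_subtractf[symmetric]
    by (intro sum.cong refl) (simp only: gdiff_Z smult_diff_left[symmetric], simp add: algebra_simps)
  finally show ?thesis .
qed

text \<open>Summation by parts: each pair of neighbours \<open>l\<close>, \<open>l + 1\<close>
  enters the quadratic form from both sides with the same weight \<open>Zup d l\<close>, which
  completes a square. A factor \<open>1 - t\<close> between two equal sums is thus paid for by one
  difference of \<open>f\<close> in each, not by the second-order operator
  \<open>gdiff\<close>.\<close>

lemma mean_zonal_sum_dirichlet:
  assumes "\<And>l. l \<ge> K \<Longrightarrow> f l = 0"
  shows "\<Lambda> ([:1, -1:] * zonal_sum d (Suc K) f * zonal_sum d (Suc K) f) = (\<Sum>l<Suc K. Zup d l * (f l - f (Suc l))\<^sup>2)"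
proof -
  have "\<Lambda> ([:1, -1:] * zonal_sum d (Suc K) f * zonal_sum d (Suc K) f) = (\<Sum>l<Suc K. gdiff d f l * Z d l * f l)"
    by (subst zonal_sum_gdiff) (simp_all only: assms mean_zonal_sum_mult mult_ac)
  also have "\<dots> = (\<Sum>l<Suc K. Zup d l * (f l * f l - f l * f (Suc l)) +
      (if l = 0 then 0 else Zup d (l - 1) * (f l * f l - f l * f (l - 1))))"
  proof (intro sum.cong refl)
    fix l
    have "Z d l = Zup d l + (if l = 0 then 0 else Zup d (l - 1))"
      using Zup_Suc_add[of "l - 1"] Zup_0 by (cases l) auto
    then show "gdiff d f l * Z d l * f l = Zup d l * (f l * f l - f l * f (Suc l)) +
      (if l = 0 then 0 else Zup d (l - 1) * (f l * f l - f l * f (l - 1)))"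
      unfolding gdiff_Z by (simp add: algebra_simps)
  qed
  also have "\<dots> = (\<Sum>l<Suc K. Zup d l * (f l * f l - f l * f (Suc l)))
      + (\<Sum>l<Suc K. if l = 0 then 0 else Zup d (l - 1) * (f l * f l - f l * f (l - 1)))"
    by (rule sum.distrib)
  also have "(\<Sum>l<Suc K. if l = 0 then 0 else Zup d (l - 1) * (f l * f l - f l * f (l - 1)))
      = (\<Sum>l<Suc K. Zup d l * (f (Suc l) * f (Suc l) - f (Suc l) * f l))"
    using assms[of "Suc K"] unfolding sum.lessThan_Suc_shift[of "\<lambda>l. if l = 0 then 0 else _ l"] by simp
  finally show ?thesis
    unfolding sum.distrib[symmetric] by (simp add: power2_eq_square algebra_simps)
qed

text \<open>\<open>gdiff\<close> reads the neighbours of an index, so each application extends the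
  support by at most one.\<close>

lemma gdiff_power_support:
  assumes "\<And>l. l \<ge> K \<Longrightarrow> f l = 0" "l \<ge> K + m"
  shows "(gdiff d ^^ m) f l = 0"
  using assms(2)
proof (induction m arbitrary: l)
  case (Suc m)
  then show ?case by (simp add: gdiff_def)
qed (use assms in simp)

lemma zonal_sum_gdiff_power:
  assumes "\<And>l. l \<ge> K \<Longrightarrow> f l = 0" "m \<le> k"
  shows "[:1, -1:] ^ m * zonal_sum d (Suc (K + k)) f = zonal_sum d (Suc (K + k)) ((gdiff d ^^ m) f)"
  using assms(2)
proof (induction m)
  case (Suc m)
  have "[:1, -1:] ^ Suc m * zonal_sum d (Suc (K + k)) f = [:1, -1:] * zonal_sum d (Suc (K + k)) ((gdiff d ^^ m) f)"
    using Suc by (simp add: mult.assoc del: mult_pCons_left mult_pCons_right)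
  also have "\<dots> = zonal_sum d (Suc (K + k)) (gdiff d ((gdiff d ^^ m) f))"
    using Suc.prems by (intro zonal_sum_gdiff gdiff_power_support[OF assms(1)]) auto
  finally show ?case by simp
qed simp

end

section \<open>Zonal functions on the sphere\<close>

lemma unit_rotation:
  fixes u v :: "real ^ 'n"
  assumes "2 \<le> CARD('n)" "norm u = 1" "norm v = 1"
  obtains Q where "rotation_matrix Q" "Q *v u = v"
proof -
  obtain A where A: "rotation_matrix A" "A *v axis undefined 1 = u"
    using rotation_matrix_exists_basis[OF assms(1,2), of undefined] by blast
  obtain B where B: "rotation_matrix B" "B *v axis undefined 1 = v"
    using rotation_matrix_exists_basis[OF assms(1,3), of undefined] by blast
  have "transpose A *v u = axis undefined 1"
    using A by (metis matrix_vector_mul_assoc matrix_vector_mul_lid orthogonal_matrix rotation_matrix_def)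
  then have "(B ** transpose A) *v u = v" by (simp add: B flip: matrix_vector_mul_assoc)
  moreover have "rotation_matrix (B ** transpose A)"
    using A(1) B(1) by (auto simp: rotation_matrix_def det_mul intro: orthogonal_matrix_mul)
  ultimately show ?thesis using that by blast
qed

lemma norm_orthogonal: "orthogonal_matrix Q \<Longrightarrow> norm (Q *v x) = norm x" for Q :: "real ^ 'n ^ 'n"
  by (simp add: orthogonal_transformation_matrix orthogonal_transformation_norm)

lemma inner_orthogonal: "orthogonal_matrix Q \<Longrightarrow> (Q *v x) \<bullet> (Q *v y) = x \<bullet> y" for Q :: "real ^ 'n ^ 'n"
  using orthogonal_transformation_matrix[of "(*v) Q"] by (simp add: orthogonal_transformation_def)

lemma measurable_orthogonal_sphere:
  fixes Q :: "real ^ 'n ^ 'n"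
  assumes "orthogonal_matrix Q"
  shows "(*v) Q \<in> measurable sphere_measure sphere_measure"
  unfolding measurable_cong_sets[OF sets_sphere_measure sets_sphere_measure]
  by (intro measurable_restrict_space3 borel_measurable_continuous_onI linear_continuous_on matrix_vector_mul_bounded_linear)
     (auto simp: norm_orthogonal[OF assms])

lemma integral_sphere_orthogonal:
  fixes Q :: "real ^ 'n ^ 'n" and f :: "real ^ 'n \<Rightarrow> real"
  assumes "orthogonal_matrix Q" "f \<in> borel_measurable sphere_measure"
  shows "(\<integral>z. f (Q *v z) \<partial>sphere_measure) = (\<integral>z. f z \<partial>sphere_measure)"
  using integral_distr[OF measurable_orthogonal_sphere[OF assms(1)] assms(2)]
  unfolding sphere_measure_orthogonal_invariant[OF assms(1)] by simp

lemma measurable_sphere_continuous: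
  "continuous_on (sphere 0 1) f \<Longrightarrow> f \<in> borel_measurable sphere_measure"
  for f :: "real ^ 'n \<Rightarrow> 'b::topological_space"
  unfolding measurable_cong_sets[OF sets_sphere_measure refl]
  by (rule borel_measurable_continuous_on_restrict)

lemma integrable_sphere_continuous:
  fixes f :: "real ^ 'n \<Rightarrow> real"
  assumes "continuous_on (sphere 0 1) f"
  shows "integrable sphere_measure f"
proof -
  interpret prob_space "sphere_measure :: (real ^ 'n) measure" by (rule prob_space_sphere_measure)
  have "bounded (f ` sphere 0 1)"
    by (intro compact_imp_bounded compact_continuous_image assms compact_sphere)
  then obtain B where "\<And>z. z \<in> sphere 0 1 \<Longrightarrow> norm (f z) \<le> B"
    unfolding bounded_iff by blast
  then show ?thesis
    by (intro integrable_const_bound[of _ B] measurable_sphere_continuous assms) auto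
qed

lemma integral_sphere_inner_orthogonal:
  fixes x y :: "real ^ 'n" and Q :: "real ^ 'n ^ 'n" and f g :: "real \<Rightarrow> real"
  assumes Q: "orthogonal_matrix Q" and "continuous_on UNIV f" "continuous_on UNIV g"
  shows "(\<integral>z. f ((Q *v x) \<bullet> z) * g ((Q *v y) \<bullet> z) \<partial>sphere_measure) = (\<integral>z. f (x \<bullet> z) * g (y \<bullet> z) \<partial>sphere_measure)"
proof -
  have "(\<lambda>z. f ((Q *v x) \<bullet> z) * g ((Q *v y) \<bullet> z)) \<in> borel_measurable sphere_measure"
    by (intro measurable_sphere_continuous continuous_intros continuous_on_compose2[OF assms(2)] continuous_on_compose2[OF assms(3)]) auto
  from integral_sphere_orthogonal[OF Q this] show ?thesis
    by (simp add: inner_orthogonal[OF Q])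
qed

lemma integral_sphere_inner_unit:
  fixes x y :: "real ^ 'n" and f :: "real \<Rightarrow> real"
  assumes "2 \<le> CARD('n)" "norm x = 1" "norm y = 1" "continuous_on UNIV f"
  shows "(\<integral>z. f (x \<bullet> z) \<partial>sphere_measure) = (\<integral>z. f (y \<bullet> z) \<partial>sphere_measure)"
proof -
  obtain Q where "rotation_matrix Q" "Q *v x = y"
    using unit_rotation[OF assms(1-3)] .
  then show ?thesis
    using integral_sphere_inner_orthogonal[of Q f "\<lambda>_. 1" x x] assms(4) by (auto simp: rotation_matrix_def)
qed

section \<open>Moments of linear forms\<close>

text \<open>Homogeneity reduces to a unit vector, and rotations carry all unit vectors into each
  other. The freedom in the length of \<open>u\<close> is the point: along
  \<open>u = x + s y\<close> the identity will generate mixed moments.\<close>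

lemma integral_sphere_power:
  fixes u e :: "real ^ 'n"
  assumes "2 \<le> CARD('n)" "norm e = 1"
  shows "(\<integral>z. (u \<bullet> z) ^ n \<partial>sphere_measure) = norm u ^ n * (\<integral>z. (e \<bullet> z) ^ n \<partial>sphere_measure)"
proof (cases "u = 0")
  case True
  interpret prob_space "sphere_measure :: (real ^ 'n) measure" by (rule prob_space_sphere_measure)
  show ?thesis using True prob_space by (cases n) auto
next
  case False
  have "(u \<bullet> z) ^ n = norm u ^ n * (sgn u \<bullet> z) ^ n" for z
  proof -
    have "u \<bullet> z = norm u * (sgn u \<bullet> z)" using False by (simp add: sgn_div_norm)
    then show ?thesis by (simp only: power_mult_distrib)
  qed
  then have "(\<integral>z. (u \<bullet> z) ^ n \<partial>sphere_measure) = norm u ^ n * (\<integral>z. (sgn u \<bullet> z) ^ n \<partial>sphere_measure)"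
    by simp
  also have "(\<integral>z. (sgn u \<bullet> z) ^ n \<partial>sphere_measure) = (\<integral>z. (e \<bullet> z) ^ n \<partial>sphere_measure)"
    using False assms by (intro integral_sphere_inner_unit continuous_intros) (auto simp: norm_sgn)
  finally show ?thesis .
qed

text \<open>The vector \<open>- e\<close> has the norm of \<open>e\<close>, hence the same moment,
  but an odd power changes sign.\<close>

lemma integral_sphere_odd_power:
  fixes e :: "real ^ 'n"
  assumes "2 \<le> CARD('n)" "norm e = 1" "odd n"
  shows "(\<integral>z. (e \<bullet> z) ^ n \<partial>sphere_measure) = 0"
proof -
  have "(\<integral>z. (- e \<bullet> z) ^ n \<partial>sphere_measure) = - (\<integral>z. (e \<bullet> z) ^ n \<partial>sphere_measure)"
    using assms(3) by (simp add: power_minus_odd)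
  moreover have "(\<integral>z. (- e \<bullet> z) ^ n \<partial>sphere_measure) = (\<integral>z. (e \<bullet> z) ^ n \<partial>sphere_measure)"
    using integral_sphere_power[OF assms(1,2), of "- e" n] assms(2) by simp
  ultimately show ?thesis by simp
qed

text \<open>Compare the coefficients of \<open>s^b\<close> in \<open>\<integral> ((x + s y) \<bullet> z)^(2m) dz = C \<bar>x + s y\<bar>^(2m)\<close>.\<close>

lemma integral_sphere_mixed_power:
  fixes x y e :: "real ^ 'n"
  assumes n: "2 \<le> CARD('n)" and e: "norm e = 1" and "norm x = 1" "norm y = 1" and ab: "a + b = 2 * m"
  shows "real (2 * m choose b) * (\<integral>z. (x \<bullet> z) ^ a * (y \<bullet> z) ^ b \<partial>sphere_measure) =
    (\<integral>z. (e \<bullet> z) ^ (2 * m) \<partial>sphere_measure) * coeff ([:1, 2 * (x \<bullet> y), 1:] ^ m) b"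
proof -
  define I where "I b = (\<integral>z. (x \<bullet> z) ^ (2 * m - b) * (y \<bullet> z) ^ b \<partial>sphere_measure)" for b
  define C where "C = (\<integral>z. (e \<bullet> z) ^ (2 * m) \<partial>sphere_measure)"
  define p where "p = (\<Sum>b\<le>2 * m. monom (real (2 * m choose b) * I b) b)"
  have "poly p s = poly (smult C ([:1, 2 * (x \<bullet> y), 1:] ^ m)) s" for s
  proof -
    have "((x + s *\<^sub>R y) \<bullet> z) ^ (2 * m) =
      (\<Sum>b\<le>2 * m. real (2 * m choose b) * s ^ b * ((x \<bullet> z) ^ (2 * m - b) * (y \<bullet> z) ^ b))" for z
    proof -
      have "((x + s *\<^sub>R y) \<bullet> z) ^ (2 * m) = (s * (y \<bullet> z) + x \<bullet> z) ^ (2 * m)"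
        by (simp add: inner_add_left add.commute)
      then show ?thesis unfolding binomial_ring by (simp add: power_mult_distrib mult_ac)
    qed
    then have "(\<integral>z. ((x + s *\<^sub>R y) \<bullet> z) ^ (2 * m) \<partial>sphere_measure)
      = (\<Sum>b\<le>2 * m. \<integral>z. real (2 * m choose b) * s ^ b * ((x \<bullet> z) ^ (2 * m - b) * (y \<bullet> z) ^ b) \<partial>sphere_measure)"
      by (simp only:) (intro Bochner_Integration.integral_sum integrable_sphere_continuous continuous_intros)
    also have "\<dots> = poly p s"
      unfolding p_def I_def poly_sum poly_monom by (intro sum.cong refl, subst integral_mult_right_zero) simp
    finally have "poly p s = norm (x + s *\<^sub>R y) ^ (2 * m) * C"
      unfolding C_def integral_sphere_power[OF n e, of "x + s *\<^sub>R y"] by simp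
    also have "norm (x + s *\<^sub>R y) ^ (2 * m) = (1 + 2 * s * (x \<bullet> y) + s\<^sup>2) ^ m"
    proof -
      have "x \<bullet> x = 1" "y \<bullet> y = 1" using assms by (simp_all add: dot_square_norm)
      then show ?thesis unfolding power_mult power2_norm_eq_inner
        by (simp add: inner_add_left inner_add_right inner_commute power2_eq_square algebra_simps)
    qed
    finally show ?thesis by (simp add: power2_eq_square algebra_simps)
  qed
  then have "p = smult C ([:1, 2 * (x \<bullet> y), 1:] ^ m)"
    by (simp add: poly_eq_poly_eq_iff[symmetric] fun_eq_iff)
  then have "coeff p b = C * coeff ([:1, 2 * (x \<bullet> y), 1:] ^ m) b" by simp
  moreover have "coeff p b = real (2 * m choose b) * I b"
    using ab by (simp add: p_def coeff_sum)
  moreover have "2 * m - b = a" using ab by simp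
  ultimately show ?thesis by (simp add: I_def C_def)
qed

text \<open>Multiplication by \<open>1 + 2 t s + s^2\<close> combines the coefficients of
  \<open>s^b\<close>, \<open>s^(b-1)\<close> and \<open>s^(b-2)\<close>, and \<open>t\<close>
  accompanies only the middle one; so the degree in \<open>t\<close> is bounded by \<open>b\<close>
  for every \<open>m\<close>.\<close>

lemma coeff_trinomial_power_poly: "\<exists>r. degree r \<le> b \<and> (\<forall>t. coeff ([:1, 2 * t, 1:] ^ m) b = poly r (t::real))"
proof (induction m arbitrary: b)
  case 0
  show ?case by (intro exI[of _ "[:if b = 0 then 1 else 0:]"]) simp
next
  case (Suc m)
  from Suc.IH obtain r where r: "\<And>b. degree (r b) \<le> b" "\<And>b t. coeff ([:1, 2 * t, 1:] ^ m) b = poly (r b) (t::real)"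
    by metis
  have c: "coeff ([:1, 2 * t, 1:] ^ Suc m) b = coeff ([:1, 2 * t, 1:] ^ m) b
    + (if b \<ge> 1 then 2 * t * coeff ([:1, 2 * t, 1:] ^ m) (b - 1) else 0) + (if b \<ge> 2 then coeff ([:1, 2 * t, 1:] ^ m) (b - 2) else 0)" for t :: real
    by (auto simp: coeff_pCons split: nat.splits)
  consider "b = 0" | "b = 1" | "b \<ge> 2" by linarith
  then show ?case
  proof cases
    case 1
    then show ?thesis using r(1)[of 0] r(2) c by (intro exI[of _ "r 0"]) simp
  next
    case 2
    have "degree (r 1 + [:0, 2:] * r 0) \<le> 1"
      using r(1)[of 0] r(1)[of 1] by (intro degree_add_le order.trans[OF degree_mult_le]) auto
    then show ?thesis using r c 2 by (intro exI[of _ "r 1 + [:0, 2:] * r 0"]) (simp add: algebra_simps)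
  next
    case 3
    have "degree (r b + [:0, 2:] * r (b - 1) + r (b - 2)) \<le> b"
      using r(1)[of b] r(1)[of "b - 1"] r(1)[of "b - 2"] 3
      by (intro degree_add_le order.trans[OF degree_mult_le]) auto
    then show ?thesis using r c 3 by (intro exI[of _ "r b + [:0, 2:] * r (b - 1) + r (b - 2)"]) (simp add: algebra_simps)
  qed
qed

text \<open>For even \<open>a + b\<close> the mixed moment is a multiple of a trinomial coefficient;
  for odd \<open>a + b\<close> the antipodal map makes it vanish. What matters is that the degree is
  bounded by \<open>b\<close> alone, however large \<open>a\<close> is.\<close>

lemma sphere_mixed_power_zonal:
  assumes "2 \<le> CARD('n)"
  shows "\<exists>r. degree r \<le> b \<and> (\<forall>x y :: real ^ 'n. norm x = 1 \<longrightarrow> norm y = 1 \<longrightarrow>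
    (\<integral>z. (x \<bullet> z) ^ a * (y \<bullet> z) ^ b \<partial>sphere_measure) = poly r (x \<bullet> y))"
proof (cases "even (a + b)")
  case True
  then obtain m where m: "a + b = 2 * m" by blast
  obtain r where r: "degree r \<le> b" "\<And>t. coeff ([:1, 2 * t, 1:] ^ m) b = poly r (t::real)"
    using coeff_trinomial_power_poly by blast
  define e :: "real ^ 'n" where "e = axis undefined 1"
  define c where "c = (\<integral>z. (e \<bullet> z) ^ (2 * m) \<partial>sphere_measure) / real (2 * m choose b)"
  have e: "norm e = 1" by (simp add: e_def)
  have "2 * m choose b \<noteq> 0" using m by (simp add: binomial_eq_0_iff)
  then have "(\<integral>z. (x \<bullet> z) ^ a * (y \<bullet> z) ^ b \<partial>sphere_measure) = poly (smult c r) (x \<bullet> y)"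
    if "norm x = 1" "norm y = 1" for x y :: "real ^ 'n"
    using integral_sphere_mixed_power[OF assms e that m] unfolding r(2) c_def by (simp add: field_simps)
  then show ?thesis using r(1) degree_smult_le[of c r] by (meson order.trans)
next
  case False
  have "(\<integral>z. (x \<bullet> z) ^ a * (y \<bullet> z) ^ b \<partial>sphere_measure) = 0" for x y :: "real ^ 'n"
  proof -
    have lin: "linear (uminus :: real ^ 'n \<Rightarrow> real ^ 'n)"
      by (intro linearI) auto
    then have o: "orthogonal_matrix (matrix (uminus :: real ^ 'n \<Rightarrow> _))"
      by (metis orthogonal_transformation_matrix orthogonal_transformation_def inner_minus_left inner_minus_right minus_minus)
    have neg: "matrix uminus *v w = - w" for w :: "real ^ 'n"
      by (simp add: lin matrix_works)
    have "(\<integral>z. (- x \<bullet> z) ^ a * (- y \<bullet> z) ^ b \<partial>sphere_measure) = (\<integral>z. (x \<bullet> z) ^ a * (y \<bullet> z) ^ b \<partial>sphere_measure)"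
      using integral_sphere_inner_orthogonal[OF o, of "\<lambda>t. t ^ a" "\<lambda>t. t ^ b" x y] by (simp add: neg continuous_intros)
    moreover have "(- x \<bullet> z) ^ a * (- y \<bullet> z) ^ b = - ((x \<bullet> z) ^ a * (y \<bullet> z) ^ b)" for z
      using False by (cases "even a") (auto simp: power_minus_odd)
    ultimately show ?thesis by simp
  qed
  then show ?thesis by (intro exI[of _ 0]) simp
qed

text \<open>Bilinear extension from powers. The degree of the result is controlled by the second
  factor alone, which later confines a convolution with \<open>P_m\<close> to degree
  \<open>m\<close>.\<close>

lemma sphere_convolution_zonal:
  assumes "2 \<le> CARD('n)"
  shows "\<exists>r. degree r \<le> degree q \<and> (\<forall>x y :: real ^ 'n. norm x = 1 \<longrightarrow> norm y = 1 \<longrightarrow>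
    (\<integral>z. poly p (x \<bullet> z) * poly q (y \<bullet> z) \<partial>sphere_measure) = poly r (x \<bullet> y))"
proof -
  have "\<exists>r. \<forall>a b. degree (r a b) \<le> b \<and> (\<forall>x y :: real ^ 'n. norm x = 1 \<longrightarrow> norm y = 1 \<longrightarrow>
    (\<integral>z. (x \<bullet> z) ^ a * (y \<bullet> z) ^ b \<partial>sphere_measure) = poly (r a b) (x \<bullet> y))"
    by (intro choice allI sphere_mixed_power_zonal assms)
  then obtain r where r: "\<And>a b. degree (r a b) \<le> b" "\<And>a b (x :: real ^ 'n) y. norm x = 1 \<Longrightarrow> norm y = 1 \<Longrightarrow>
    (\<integral>z. (x \<bullet> z) ^ a * (y \<bullet> z) ^ b \<partial>sphere_measure) = poly (r a b) (x \<bullet> y)"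
    by blast
  define s where "s = (\<Sum>a\<le>degree p. \<Sum>b\<le>degree q. smult (coeff p a * coeff q b) (r a b))"
  have "degree s \<le> degree q" unfolding s_def
    by (intro degree_sum_le finite_atMost order.trans[OF degree_smult_le] order.trans[OF r(1)]) simp
  moreover have "(\<integral>z. poly p (x \<bullet> z) * poly q (y \<bullet> z) \<partial>sphere_measure) = poly s (x \<bullet> y)"
    if "norm x = 1" "norm y = 1" for x y :: "real ^ 'n"
  proof -
    have "(\<integral>z. poly p (x \<bullet> z) * poly q (y \<bullet> z) \<partial>sphere_measure)
      = (\<integral>z. (\<Sum>a\<le>degree p. \<Sum>b\<le>degree q. coeff p a * coeff q b * ((x \<bullet> z) ^ a * (y \<bullet> z) ^ b)) \<partial>sphere_measure)"
    proof -
      have "poly p s * poly q t = (\<Sum>a\<le>degree p. \<Sum>b\<le>degree q. coeff p a * coeff q b * (s ^ a * t ^ b))" for s t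
        unfolding poly_altdef sum_product by (intro sum.cong refl) (simp only: mult_ac)
      then show ?thesis by (simp only:)
    qed
    also have "\<dots> = (\<Sum>a\<le>degree p. \<Sum>b\<le>degree q. \<integral>z. coeff p a * coeff q b * ((x \<bullet> z) ^ a * (y \<bullet> z) ^ b) \<partial>sphere_measure)"
    proof -
      have int: "integrable sphere_measure (\<lambda>z. coeff p a * coeff q b * ((x \<bullet> z) ^ a * (y \<bullet> z) ^ b))" for a b
        by (intro integrable_sphere_continuous continuous_intros)
      show ?thesis
        by (subst Bochner_Integration.integral_sum, intro Bochner_Integration.integrable_sum int,
            intro sum.cong refl Bochner_Integration.integral_sum int)
    qed
    also have "\<dots> = poly s (x \<bullet> y)"
      by (simp add: s_def poly_sum r(2) that)
    finally show ?thesis .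
  qed
  ultimately show ?thesis by blast
qed

lemma coeff_even_binomial_power: "coeff ([:1, 0, 1:] ^ m :: real poly) 2 = real m"
proof (induction m)
  case (Suc m)
  have "coeff ([:1, 0, 1:] ^ m :: real poly) 0 = 1"
    by (induction m) (simp_all add: coeff_mult)
  then show ?case using Suc by (simp add: numeral_2_eq_2 coeff_pCons)
qed simp

text \<open>Integration by parts for the monomial \<open>t^k\<close>, where \<open>t\<close> is
  coordinate \<open>i\<close>. On the sphere the squares of the other \<open>d\<close> coordinates
  add up to \<open>1 - t^2\<close>, and for odd \<open>k\<close> the mixed moments show that each of
  them contributes \<open>M (Suc k) / k\<close> to the integral of
  \<open>t^(k-1) (1 - t^2)\<close>.\<close>

lemma integral_sphere_power_rec:
  fixes i :: "'n :: finite"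
  defines "M \<equiv> (\<lambda>k. \<integral>z. (axis i 1 \<bullet> z :: real) ^ k \<partial>(sphere_measure :: (real ^ 'n) measure))"
  assumes n: "CARD('n) = d + 1" "d \<ge> 1"
  shows "real k * (M (k - 1) - M (Suc k)) = real d * M (Suc k)"
proof (cases "odd k")
  case False
  have "M (Suc k) = 0" unfolding M_def
    using False n by (intro integral_sphere_odd_power) auto
  moreover have "M (k - 1) = 0" if "k > 0" unfolding M_def
    using False n that by (intro integral_sphere_odd_power) auto
  \<comment> \<open>For \<open>k = 0\<close> the truncated \<open>k - 1\<close> is harmless, since
    the factor \<open>real k\<close> vanishes.\<close>
  ultimately show ?thesis by (cases "k = 0") auto
next
  case True
  then obtain m where k: "k = 2 * m + 1" by (elim oddE)
  let ?e = "\<lambda>i. axis i 1 :: real ^ 'n"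
  \<comment> \<open>Orthogonal directions reduce the trinomial to \<open>1 + s^2\<close>, whose
    power \<open>m + 1\<close> has the \<open>s^2\<close>-coefficient \<open>m + 1\<close>; the
    binomial on the left is \<open>(m + 1) * k\<close>.\<close>
  have I: "real k * (\<integral>z. (?e i \<bullet> z) ^ (2 * m) * (?e j \<bullet> z)\<^sup>2 \<partial>sphere_measure) = M (Suc k)" if "j \<noteq> i" for j
  proof -
    have "?e i \<bullet> ?e j = 0" using that by (simp add: inner_axis_axis)
    then have "real (2 * Suc m choose 2) * (\<integral>z. (?e i \<bullet> z) ^ (2 * m) * (?e j \<bullet> z)\<^sup>2 \<partial>sphere_measure) = M (2 * Suc m) * real (Suc m)"
      using integral_sphere_mixed_power[of "?e i" "?e i" "?e j" "2 * m" 2 "Suc m"] n coeff_even_binomial_power[of "Suc m"]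
      unfolding M_def by simp
    moreover have "real (2 * Suc m choose 2) = real (Suc m) * real k"
    proof -
      have "2 * Suc m choose 2 = Suc m * k" by (simp add: choose_two k)
      then show ?thesis by (simp only: of_nat_mult)
    qed
    moreover have "2 * Suc m = Suc k" by (simp add: k)
    ultimately have "real (Suc m) * (real k * (\<integral>z. (?e i \<bullet> z) ^ (2 * m) * (?e j \<bullet> z)\<^sup>2 \<partial>sphere_measure)) = real (Suc m) * M (Suc k)"
      by (simp only: mult_ac)
    then show ?thesis by (simp only: mult_cancel_left) simp
  qed
  have z: "(\<Sum>j\<in>UNIV - {i}. (?e i \<bullet> z) ^ (2 * m) * (?e j \<bullet> z)\<^sup>2) = (?e i \<bullet> z) ^ (k - 1) - (?e i \<bullet> z) ^ Suc k"
    if "z \<in> space sphere_measure" for z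
  proof -
    have "(\<Sum>j\<in>UNIV. (?e j \<bullet> z)\<^sup>2) = z \<bullet> z"
    proof -
      have "?e j \<bullet> z = z $ j" for j by (simp add: inner_axis')
      then show ?thesis by (simp add: inner_vec_def[of z z] power2_eq_square)
    qed
    also have "z \<bullet> z = 1" using that by (simp add: dot_square_norm)
    finally have "(\<Sum>j\<in>UNIV - {i}. (?e j \<bullet> z)\<^sup>2) = 1 - (?e i \<bullet> z)\<^sup>2"
      by (simp add: sum_diff1)
    then have "(?e i \<bullet> z) ^ (2 * m) * (\<Sum>j\<in>UNIV - {i}. (?e j \<bullet> z)\<^sup>2) = (?e i \<bullet> z) ^ (2 * m) * (1 - (?e i \<bullet> z)\<^sup>2)"
      by simp
    then show ?thesis unfolding sum_distrib_left[symmetric] k by (simp add: algebra_simps power2_eq_square)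
  qed
  have "M (k - 1) - M (Suc k) = (\<integral>z. (?e i \<bullet> z) ^ (k - 1) - (?e i \<bullet> z) ^ Suc k \<partial>sphere_measure)"
    unfolding M_def
    by (intro Bochner_Integration.integral_diff[symmetric] integrable_sphere_continuous continuous_intros)
  also have "\<dots> = (\<integral>z. (\<Sum>j\<in>UNIV - {i}. (?e i \<bullet> z) ^ (2 * m) * (?e j \<bullet> z)\<^sup>2) \<partial>sphere_measure)"
    by (intro Bochner_Integration.integral_cong refl) (simp add: z)
  also have "\<dots> = (\<Sum>j\<in>UNIV - {i}. \<integral>z. (?e i \<bullet> z) ^ (2 * m) * (?e j \<bullet> z)\<^sup>2 \<partial>sphere_measure)"
    by (intro Bochner_Integration.integral_sum integrable_sphere_continuous continuous_intros)
  finally have "real k * (M (k - 1) - M (Suc k)) = (\<Sum>j\<in>UNIV - {i}. real k * (\<integral>z. (?e i \<bullet> z) ^ (2 * m) * (?e j \<bullet> z)\<^sup>2 \<partial>sphere_measure))"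
    by (simp add: sum_distrib_left)
  also have "\<dots> = (\<Sum>j\<in>UNIV - {i}. M (Suc k))"
    by (intro sum.cong refl I) auto
  also have "\<dots> = real d * M (Suc k)"
    using n by (simp add: card_Diff_singleton)
  finally show ?thesis .
qed

text \<open>By linearity integration by parts has to be checked on monomials only, where it is the
  recursion for the moments of a coordinate; rotation invariance carries it to an arbitrary unit
  vector \<open>e\<close>.\<close>

lemma ultraspherical_sphere_mean:
  fixes e :: "real ^ 'n"
  assumes n: "CARD('n) = d + 1" "d \<ge> 2" and e: "norm e = 1"
  shows "ultraspherical_mean d (\<lambda>p. \<integral>z. poly p (e \<bullet> z) \<partial>sphere_measure)"
proof
  interpret prob_space "sphere_measure :: (real ^ 'n) measure" by (rule prob_space_sphere_measure)
  let ?L = "\<lambda>p. \<integral>z. poly p (e \<bullet> z) \<partial>sphere_measure"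
  show "d \<ge> 2" by fact
  show add: "?L (p + q) = ?L p + ?L q" for p q
    unfolding poly_add by (intro Bochner_Integration.integral_add integrable_sphere_continuous continuous_intros)
  show smult: "?L (smult c p) = c * ?L p" for c p by simp
  show "?L 1 = 1" using prob_space by simp
  have diff: "?L (p - q) = ?L p - ?L q" for p q
    using add[of "p - q" q] by simp
  define M where "M k = (\<integral>z. (axis undefined 1 \<bullet> z :: real) ^ k \<partial>(sphere_measure :: (real ^ 'n) measure))" for k
  have M: "(\<integral>z. (e \<bullet> z) ^ k \<partial>sphere_measure) = M k" for k
    unfolding M_def using integral_sphere_power[of "axis undefined 1" e k] n e by simp
  show "?L ([:1, 0, -1:] * pderiv p) = real d * ?L ([:0, 1:] * p)" for p
  proof -
    let ?D = "\<lambda>p. ?L ([:1, 0, -1:] * pderiv p) = real d * ?L ([:0, 1:] * p)"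
    have D_add: "?D (p + q)" if "?D p" "?D q" for p q
      using that by (simp only: pderiv_add distrib_left add)
    have D_monom: "?D (monom c k)" for c k
    proof -
      have "poly ([:1, 0, -1:] * pderiv (monom c k)) t = c * real k * (t ^ (k - 1) - t ^ Suc k)" for t
        by (cases k) (simp_all add: pderiv_monom poly_monom algebra_simps)
      then have "?L ([:1, 0, -1:] * pderiv (monom c k)) = c * real k * (\<integral>z. ((e \<bullet> z) ^ (k - 1) - (e \<bullet> z) ^ Suc k) \<partial>sphere_measure)"
        by (simp only:) simp
      also have "(\<integral>z. ((e \<bullet> z) ^ (k - 1) - (e \<bullet> z) ^ Suc k) \<partial>sphere_measure) = M (k - 1) - M (Suc k)"
        unfolding M[symmetric] by (intro Bochner_Integration.integral_diff integrable_sphere_continuous continuous_intros)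
      also have "c * real k * (M (k - 1) - M (Suc k)) = c * (real d * M (Suc k))"
        using integral_sphere_power_rec[of d k "undefined :: 'n"] n unfolding M_def by simp
      also have "\<dots> = real d * ?L ([:0, 1:] * monom c k)"
        unfolding M[symmetric] by (simp add: poly_monom mult_ac)
      finally show ?thesis .
    qed
    have "?D (\<Sum>i\<in>A. monom (coeff p i) i)" if "finite A" for A
      using that
    proof (induction A)
      case (insert i A)
      have "(\<Sum>i\<in>insert i A. monom (coeff p i) i) = monom (coeff p i) i + (\<Sum>i\<in>A. monom (coeff p i) i)"
        using insert.hyps by (rule sum.insert)
      then show ?case by (simp only:) (intro D_add D_monom insert.IH)
    qed simp
    from this[of "{..degree p}"] show ?thesis
      by (simp only: poly_as_sum_of_monoms finite_atMost)
  qed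
qed

section \<open>Double integrals and the convolution property\<close>

lemma measurable_sphere_borel [measurable]: "(\<lambda>z. z) \<in> borel_measurable sphere_measure"
  by (intro measurable_sphere_continuous continuous_intros)

lemma integrable_sphere_pair:
  fixes f :: "real ^ 'n \<Rightarrow> real ^ 'n \<Rightarrow> real"
  assumes "case_prod f \<in> borel_measurable (sphere_measure \<Otimes>\<^sub>M sphere_measure)"
    and "\<And>x y. x \<in> sphere 0 1 \<Longrightarrow> y \<in> sphere 0 1 \<Longrightarrow> \<bar>f x y\<bar> \<le> B"
  shows "integrable (sphere_measure \<Otimes>\<^sub>M sphere_measure) (case_prod f)"
proof -
  interpret S: prob_space "sphere_measure :: (real ^ 'n) measure" by (rule prob_space_sphere_measure)
  interpret SS: pair_prob_space "sphere_measure :: (real ^ 'n) measure" "sphere_measure :: (real ^ 'n) measure" ..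
  show ?thesis
    by (intro SS.integrable_const_bound[of _ B] assms AE_I2) (auto simp: space_pair_measure assms(2))
qed

lemma sphere_fubini:
  fixes f :: "real ^ 'n \<Rightarrow> real ^ 'n \<Rightarrow> real"
  assumes "case_prod f \<in> borel_measurable (sphere_measure \<Otimes>\<^sub>M sphere_measure)"
    and "\<And>x y. x \<in> sphere 0 1 \<Longrightarrow> y \<in> sphere 0 1 \<Longrightarrow> \<bar>f x y\<bar> \<le> B"
  shows "(\<integral>y. (\<integral>x. f x y \<partial>sphere_measure) \<partial>sphere_measure) = (\<integral>x. (\<integral>y. f x y \<partial>sphere_measure) \<partial>sphere_measure)"
proof -
  interpret S: prob_space "sphere_measure :: (real ^ 'n) measure" by (rule prob_space_sphere_measure)
  interpret SS: pair_prob_space "sphere_measure :: (real ^ 'n) measure" "sphere_measure :: (real ^ 'n) measure" ..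
  show ?thesis
    by (intro SS.Fubini_integral integrable_sphere_pair[of f B] assms)
qed

lemma poly_bound_Icc: "\<exists>B. \<forall>t\<in>{-1..1}. \<bar>poly p t\<bar> \<le> (B::real)"
proof -
  have "bounded (poly p ` {-1..1})"
    by (intro compact_imp_bounded compact_continuous_image continuous_intros) auto
  then show ?thesis by (auto simp: bounded_iff)
qed

lemma inner_sphere_Icc: "x \<in> sphere 0 1 \<Longrightarrow> y \<in> sphere 0 1 \<Longrightarrow> x \<bullet> y \<in> {-1..1 :: real}"
  for x y :: "'a :: real_inner"
  using Cauchy_Schwarz_ineq2[of x y] by auto

lemma borel_measurable_poly [measurable]: "poly p \<in> borel_measurable borel" for p :: "real poly"
  by (intro borel_measurable_continuous_onI continuous_intros)

text \<open>As a function of \<open>x \<bullet> y\<close> the convolution is a polynomial of degree at most \<open>m\<close>. By Fubini it is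
  orthogonal to all polynomials of smaller degree, hence a multiple of \<open>P_m\<close>.\<close>

lemma gegenbauer_convolution:
  fixes x y :: "real ^ 'n"
  assumes n: "CARD('n) = d + 1" "d \<ge> 2" and xy: "norm x = 1" "norm y = 1"
  shows "(\<integral>z. gegenbauer d l (x \<bullet> z) * gegenbauer d m (y \<bullet> z) \<partial>sphere_measure) =
    (if l = m then gegenbauer d l (x \<bullet> y) / Z d l else 0)"
proof -
  define L where "L p = (\<integral>z. poly p (y \<bullet> z) \<partial>sphere_measure)" for p
  interpret ultraspherical_mean d L
    unfolding L_def by (rule ultraspherical_sphere_mean[OF n xy(2)])
  let ?G = "gegenbauer_poly d"
  have n2: "2 \<le> CARD('n)" using n by simp
  obtain r where r: "degree r \<le> degree (?G m)" "\<And>x y :: real ^ 'n. norm x = 1 \<Longrightarrow> norm y = 1 \<Longrightarrow>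
      (\<integral>z. poly (?G l) (x \<bullet> z) * poly (?G m) (y \<bullet> z) \<partial>sphere_measure) = poly r (x \<bullet> y)"
    using sphere_convolution_zonal[OF n2] by blast
  have "degree r \<le> m" using r(1) degree_gegenbauer_poly_le[of d m] by simp
  then obtain b where b: "r = (\<Sum>k\<le>m. smult (b k) (?G k))"
    using gegenbauer_expansion[OF n(2)] by blast
  have b0: "b k = 0" if "k < m" for k
  proof -
    obtain s where s: "degree s \<le> degree (?G k)" "\<And>x y :: real ^ 'n. norm x = 1 \<Longrightarrow> norm y = 1 \<Longrightarrow>
        (\<integral>z. poly (?G l) (x \<bullet> z) * poly (?G k) (y \<bullet> z) \<partial>sphere_measure) = poly s (x \<bullet> y)"
      using sphere_convolution_zonal[OF n2] by blast
    obtain A B C where ABC: "\<And>t. t \<in> {-1..1} \<Longrightarrow> \<bar>poly (?G l) t\<bar> \<le> A" "\<And>t. t \<in> {-1..1} \<Longrightarrow> \<bar>poly (?G m) t\<bar> \<le> B"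
      "\<And>t. t \<in> {-1..1} \<Longrightarrow> \<bar>poly (?G k) t\<bar> \<le> C"
      using poly_bound_Icc by metis
    have "0 \<le> A" "0 \<le> B" "0 \<le> C" using ABC[of 0] by auto
    have y: "y \<in> sphere 0 1" using xy by simp
    \<comment> \<open>Fubini transfers the convolution with \<open>P_l\<close> from
      \<open>P_m\<close> to \<open>P_k\<close>, where it produces a polynomial of degree at most
      \<open>k < m\<close>.\<close>
    have "L (r * ?G k) = (\<integral>u. (\<integral>z. poly (?G l) (u \<bullet> z) * poly (?G m) (y \<bullet> z) * poly (?G k) (y \<bullet> u) \<partial>sphere_measure) \<partial>sphere_measure)"
      unfolding L_def poly_mult
      by (intro Bochner_Integration.integral_cong refl) (simp add: r(2)[symmetric] xy inner_commute)
    also have "\<dots> = (\<integral>z. (\<integral>u. poly (?G l) (u \<bullet> z) * poly (?G m) (y \<bullet> z) * poly (?G k) (y \<bullet> u) \<partial>sphere_measure) \<partial>sphere_measure)"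
    proof (rule sphere_fubini[of "\<lambda>z u. poly (?G l) (u \<bullet> z) * poly (?G m) (y \<bullet> z) * poly (?G k) (y \<bullet> u)" "A * B * C"])
      fix z u :: "real ^ 'n" assume zu: "z \<in> sphere 0 1" "u \<in> sphere 0 1"
      show "\<bar>poly (?G l) (u \<bullet> z) * poly (?G m) (y \<bullet> z) * poly (?G k) (y \<bullet> u)\<bar> \<le> A * B * C"
        unfolding abs_mult using \<open>0 \<le> A\<close> \<open>0 \<le> B\<close> \<open>0 \<le> C\<close>
        by (intro mult_mono ABC inner_sphere_Icc zu y mult_nonneg_nonneg) auto
    qed measurable
    also have "\<dots> = L (?G m * s)"
      unfolding L_def poly_mult
    proof (intro Bochner_Integration.integral_cong refl)
      fix z :: "real ^ 'n" assume "z \<in> space sphere_measure"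
      then have "norm z = 1" by simp
      have "(\<integral>u. poly (?G l) (u \<bullet> z) * poly (?G m) (y \<bullet> z) * poly (?G k) (y \<bullet> u) \<partial>sphere_measure)
        = (\<integral>u. poly (?G m) (y \<bullet> z) * (poly (?G l) (z \<bullet> u) * poly (?G k) (y \<bullet> u)) \<partial>sphere_measure)"
        by (intro Bochner_Integration.integral_cong refl) (simp add: mult_ac inner_commute)
      also have "\<dots> = poly (?G m) (y \<bullet> z) * poly s (y \<bullet> z)"
        by (simp only: integral_mult_right_zero s(2)[OF \<open>norm z = 1\<close> xy(2)] inner_commute[of z y])
      finally show "(\<integral>u. poly (?G l) (u \<bullet> z) * poly (?G m) (y \<bullet> z) * poly (?G k) (y \<bullet> u) \<partial>sphere_measure)
        = poly (?G m) (y \<bullet> z) * poly s (y \<bullet> z)" .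
    qed
    also have "\<dots> = 0"
      using s(1) degree_gegenbauer_poly_le[of d k] that by (intro mean_gegenbauer_orthogonal_poly) simp
    finally show ?thesis
      using gegenbauer_expansion_coeff[OF b, of k] that by simp
  qed
  have "r = (\<Sum>k\<le>m. if k = m then smult (b m) (?G m) else 0)"
    unfolding b by (intro sum.cong refl) (auto simp: b0)
  then have rb: "r = smult (b m) (?G m)" by simp
  \<comment> \<open>At coinciding points \<open>P_m\<close> has the value 1 and the convolution
    becomes the mean of \<open>P_l P_m\<close>.\<close>
  have "b m = poly r (y \<bullet> y)"
    using xy(2) gegenbauer_at_1[of m] by (simp add: rb poly_gegenbauer_poly dot_square_norm)
  also have "\<dots> = L (?G l * ?G m)"
    by (simp add: L_def r(2)[symmetric] xy)
  also have "\<dots> = (if l = m then 1 / Z d l else 0)"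
    by (rule mean_gegenbauer_mult_gegenbauer)
  finally show ?thesis
    using r(2)[OF xy] by (simp add: poly_gegenbauer_poly rb)
qed

section \<open>The measure of spherical caps\<close>

definition cap :: "real ^ 'n \<Rightarrow> real \<Rightarrow> (real ^ 'n) set" where
  "cap x r = {z \<in> sphere 0 1. norm (z - x) \<le> r}"

lemma sets_cap [measurable]: "cap x r \<in> sets sphere_measure"
proof -
  have "cap x r = sphere 0 1 \<inter> cball x r"
    by (auto simp: cap_def dist_norm norm_minus_commute)
  then show ?thesis by (auto simp: sets_sphere_measure sets_restrict_space)
qed

text \<open>The cone over the cap lies in a box of half-length 1 along the axis and \<open>r\<close>
  in the \<open>d\<close> remaining directions; the volume of the box is divided by that of the
  ball.\<close>

lemma measure_axis_cap_le:
  fixes i :: "'n :: finite"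
  assumes n: "CARD('n) = d + 1" and "r \<ge> 0"
  shows "measure sphere_measure (cap (axis i 1 :: real ^ 'n) r) \<le> 2 ^ (d + 1) / measure lborel (ball (0 :: real ^ 'n) 1) * r ^ d"
proof -
  let ?B = "ball (0 :: real ^ 'n) 1"
  define v :: "real ^ 'n" where "v = (\<chi> j. if j = i then 1 else r)"
  let ?S = "{z \<in> ?B - {0}. sgn z \<in> cap (axis i 1) r}"
  have sub: "?S \<subseteq> cbox (- v) v"
  proof
    fix z assume z: "z \<in> ?S"
    have "\<bar>z $ j\<bar> \<le> v $ j" for j
    proof (cases "j = i")
      case True
      then show ?thesis using z component_le_norm_cart[of z i] by (simp add: v_def)
    next
      case False
      have "\<bar>sgn z $ j\<bar> \<le> norm (sgn z - axis i 1)"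
        using component_le_norm_cart[of "sgn z - axis i 1" j] False by (simp add: axis_def)
      also have "\<dots> \<le> r" using z by (simp add: cap_def)
      finally have "\<bar>sgn z $ j\<bar> \<le> r" .
      moreover have "z $ j = norm z * sgn z $ j" using z by (simp add: sgn_div_norm)
      ultimately have "\<bar>z $ j\<bar> \<le> norm z * r" by (simp add: abs_mult mult_left_mono)
      also have "\<dots> \<le> 1 * r" using z \<open>r \<ge> 0\<close> by (intro mult_right_mono) auto
      finally show ?thesis using False by (simp add: v_def)
    qed
    then show "z \<in> cbox (- v) v" by (simp add: mem_box_cart abs_le_iff) (metis neg_le_iff_le minus_minus)
  qed
  have vol: "measure lborel (cbox (- v) v) = 2 ^ (d + 1) * r ^ d"
  proof -
    have "- v $ j \<le> v $ j" for j using \<open>r \<ge> 0\<close> by (simp add: v_def)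
    then have "cbox (- v) v \<noteq> {}" by (simp add: interval_ne_empty_cart)
    then have "measure lborel (cbox (- v) v) = (\<Prod>j\<in>UNIV. 2 * (if j = i then 1 else r))"
      by (simp add: content_cbox_cart v_def)
    also have "\<dots> = 2 ^ (d + 1) * (\<Prod>j\<in>UNIV. if j = i then 1 else r)"
      by (simp add: prod.distrib n)
    also have "(\<Prod>j\<in>UNIV. if j = i then 1 else r) = (\<Prod>j\<in>UNIV - {i}. r)"
      by (subst prod.remove[of _ i]) auto
    also have "\<dots> = r ^ d" by (simp add: n card_Diff_singleton)
    finally show ?thesis .
  qed
  have "cap (axis i 1) r \<in> sets (restrict_space borel (sphere (0 :: real ^ 'n) 1))"
    using sets_cap[of "axis i 1" r] by (simp add: sets_sphere_measure)
  then have "emeasure sphere_measure (cap (axis i 1 :: real ^ 'n) r) = emeasure lborel ?S / emeasure lborel ?B"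
    by (rule emeasure_sphere_measure)
  also have "\<dots> \<le> emeasure lborel (cbox (- v) v) / emeasure lborel ?B"
    using sub by (intro divide_right_mono_ennreal emeasure_mono) auto
  also have "\<dots> = ennreal (2 ^ (d + 1) * r ^ d) / ennreal (measure lborel ?B)"
    using emeasure_lborel_ball_finite[of "0 :: real ^ 'n" 1] emeasure_lborel_cbox_finite[of "- v" v]
    unfolding vol[symmetric] by (simp add: emeasure_eq_ennreal_measure less_top)
  also have "\<dots> = ennreal (2 ^ (d + 1) / measure lborel ?B * r ^ d)"
    using content_ball_pos[of 1 "0 :: real ^ 'n"] \<open>r \<ge> 0\<close> by (subst divide_ennreal) auto
  finally show ?thesis
    unfolding measure_def[of sphere_measure] using \<open>r \<ge> 0\<close> by (intro enn2real_leI) auto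
qed

lemma measure_cap_le:
  fixes x :: "real ^ 'n"
  assumes n: "CARD('n) = d + 1" "d \<ge> 1" and "r \<ge> 0" "norm x = 1"
  shows "measure sphere_measure (cap x r) \<le> 2 ^ (d + 1) / measure lborel (ball (0 :: real ^ 'n) 1) * r ^ d"
proof -
  obtain Q where Q: "rotation_matrix Q" "Q *v axis undefined 1 = x"
    using unit_rotation[of "axis undefined 1" x] n assms(4) by auto
  then have o: "orthogonal_matrix Q" by (simp add: rotation_matrix_def)
  have "measure sphere_measure (cap x r) = measure (distr sphere_measure sphere_measure ((*v) Q)) (cap x r)"
    by (simp add: sphere_measure_orthogonal_invariant[OF o])
  also have "\<dots> = measure sphere_measure ((*v) Q -` cap x r \<inter> space sphere_measure)"
    by (intro measure_distr measurable_orthogonal_sphere o sets_cap)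
  also have "(*v) Q -` cap x r \<inter> space sphere_measure = cap (axis undefined 1) r"
  proof -
    have "norm (Q *v z - x) = norm (z - axis undefined 1)" for z
      using norm_orthogonal[OF o, of "z - axis undefined 1"] Q(2) by (simp add: matrix_vector_mult_diff_distrib)
    then show ?thesis by (auto simp: cap_def norm_orthogonal[OF o])
  qed
  also have "measure sphere_measure \<dots> \<le> 2 ^ (d + 1) / measure lborel (ball (0 :: real ^ 'n) 1) * r ^ d"
    using assms by (intro measure_axis_cap_le) auto
  finally show ?thesis .
qed

section \<open>Difference calculus\<close>

definition fdiff :: "(nat \<Rightarrow> real) \<Rightarrow> nat \<Rightarrow> real" where
  "fdiff f l = f (Suc l) - f l"

lemma fdiff_power_Suc: "(fdiff ^^ Suc i) f = (fdiff ^^ i) (fdiff f)"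
  by (simp add: funpow_swap1)

lemma fdiff_power_add: "(fdiff ^^ i) (\<lambda>l. f l + g l) l = (fdiff ^^ i) f l + (fdiff ^^ i) g l"
  by (induction i arbitrary: l) (simp_all add: fdiff_def)

lemma fdiff_power_cmult: "(fdiff ^^ i) (\<lambda>l. c * f l) l = c * (fdiff ^^ i) f l"
  by (induction i arbitrary: l) (simp_all add: fdiff_def algebra_simps)

lemma fdiff_power_shift_up: "(fdiff ^^ i) (\<lambda>l. f (Suc l)) l = (fdiff ^^ i) f (Suc l)"
  by (induction i arbitrary: l) (simp_all add: fdiff_def)

lemma fdiff_power_shift_down: "l \<ge> 1 \<Longrightarrow> (fdiff ^^ i) (\<lambda>l. f (l - 1)) l = (fdiff ^^ i) f (l - 1)"
  by (induction i arbitrary: l) (simp_all add: fdiff_def)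

lemma fdiff_power_cong: "(\<And>k. k \<ge> l \<Longrightarrow> f k = g k) \<Longrightarrow> (fdiff ^^ i) f l = (fdiff ^^ i) g l"
  by (induction i arbitrary: l) (simp_all add: fdiff_def)

text \<open>\<open>symbols s r q\<close> consists of the families indexed by a scale \<open>L\<close> that behave, along with their
  first \<open>s\<close> differences, like \<open>L^(-r) g (l / L)\<close> with a smooth function \<open>g\<close> on \<open>l \<ge> L / 2 + q\<close>.\<close>

definition symbols :: "nat \<Rightarrow> nat \<Rightarrow> nat \<Rightarrow> (nat \<Rightarrow> nat \<Rightarrow> real) set" where
  "symbols s r q = {a. \<exists>C. \<forall>L\<ge>1. \<forall>l. 2 * l \<ge> L + 2 * q \<longrightarrow>
     (\<forall>i\<le>s. \<bar>(fdiff ^^ i) (a L) l\<bar> \<le> C / real L ^ (r + i))}"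

lemma symbolsI:
  "(\<And>L l i. L \<ge> 1 \<Longrightarrow> 2 * l \<ge> L + 2 * q \<Longrightarrow> i \<le> s \<Longrightarrow> \<bar>(fdiff ^^ i) (a L) l\<bar> \<le> C / real L ^ (r + i))
    \<Longrightarrow> a \<in> symbols s r q"
  unfolding symbols_def by blast

lemma symbolsE:
  assumes "a \<in> symbols s r q"
  obtains C where "C \<ge> 0" "\<And>L l i. L \<ge> 1 \<Longrightarrow> 2 * l \<ge> L + 2 * q \<Longrightarrow> i \<le> s \<Longrightarrow> \<bar>(fdiff ^^ i) (a L) l\<bar> \<le> C / real L ^ (r + i)"
proof -
  obtain C where C: "\<And>L l i. L \<ge> 1 \<Longrightarrow> 2 * l \<ge> L + 2 * q \<Longrightarrow> i \<le> s \<Longrightarrow> \<bar>(fdiff ^^ i) (a L) l\<bar> \<le> C / real L ^ (r + i)"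
    using assms unfolding symbols_def by blast
  have "C \<ge> 0" using C[of 1 "1 + q" 0] by force
  then show ?thesis using C that by blast
qed

lemma symbols_mono:
  assumes "a \<in> symbols s r q" "s' \<le> s" "r' \<le> r" "q \<le> q'"
  shows "a \<in> symbols s' r' q'"
proof -
  obtain C where C: "C \<ge> 0" "\<And>L l i. L \<ge> 1 \<Longrightarrow> 2 * l \<ge> L + 2 * q \<Longrightarrow> i \<le> s \<Longrightarrow> \<bar>(fdiff ^^ i) (a L) l\<bar> \<le> C / real L ^ (r + i)"
    using symbolsE[OF assms(1)] by blast
  show ?thesis
  proof (rule symbolsI)
    fix L l i :: nat assume "L \<ge> 1" "2 * l \<ge> L + 2 * q'" "i \<le> s'"
    then have "\<bar>(fdiff ^^ i) (a L) l\<bar> \<le> C / real L ^ (r + i)"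
      using assms by (intro C) auto
    also have "\<dots> \<le> C / real L ^ (r' + i)"
      using \<open>L \<ge> 1\<close> C(1) assms(3) by (intro divide_left_mono power_increasing) auto
    finally show "\<bar>(fdiff ^^ i) (a L) l\<bar> \<le> C / real L ^ (r' + i)" .
  qed
qed

lemma symbols_fdiff: "a \<in> symbols (Suc s) r q \<Longrightarrow> (\<lambda>L. fdiff (a L)) \<in> symbols s (Suc r) q"
  unfolding symbols_def by (auto simp: fdiff_power_Suc[symmetric] simp del: funpow.simps) (metis Suc_le_mono add_Suc_right power_Suc)

text \<open>Converse of \<open>symbols_fdiff\<close>: a size bound together with control of
  \<open>s\<close> differences of the difference sequence. Inductions on \<open>s\<close> run
  through this pair.\<close>

lemma symbols_SucI:
  assumes "a \<in> symbols 0 r q" "(\<lambda>L. fdiff (a L)) \<in> symbols s (Suc r) q"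
  shows "a \<in> symbols (Suc s) r q"
proof -
  obtain C where C: "C \<ge> 0" "\<And>L l i. L \<ge> 1 \<Longrightarrow> 2 * l \<ge> L + 2 * q \<Longrightarrow> i \<le> 0 \<Longrightarrow> \<bar>(fdiff ^^ i) (a L) l\<bar> \<le> C / real L ^ (r + i)"
    using symbolsE[OF assms(1)] by blast
  obtain D where D: "D \<ge> 0" "\<And>L l i. L \<ge> 1 \<Longrightarrow> 2 * l \<ge> L + 2 * q \<Longrightarrow> i \<le> s \<Longrightarrow> \<bar>(fdiff ^^ i) (fdiff (a L)) l\<bar> \<le> D / real L ^ (Suc r + i)"
    using symbolsE[OF assms(2)] by blast
  show ?thesis
  proof (rule symbolsI)
    fix L l i :: nat assume L: "L \<ge> 1" "2 * l \<ge> L + 2 * q" "i \<le> Suc s"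
    have "\<bar>(fdiff ^^ i) (a L) l\<bar> \<le> C / real L ^ (r + i) \<or> \<bar>(fdiff ^^ i) (a L) l\<bar> \<le> D / real L ^ (r + i)"
    proof (cases i)
      case 0
      then show ?thesis using C(2)[OF L(1,2), of 0] by simp
    next
      case (Suc j)
      then have "j \<le> s" using L by simp
      from D(2)[OF L(1,2) this] show ?thesis
        unfolding Suc fdiff_power_Suc by simp
    qed
    moreover have "C / real L ^ (r + i) \<le> (C + D) / real L ^ (r + i)" "D / real L ^ (r + i) \<le> (C + D) / real L ^ (r + i)"
      using C(1) D(1) by (auto intro!: divide_right_mono)
    ultimately show "\<bar>(fdiff ^^ i) (a L) l\<bar> \<le> (C + D) / real L ^ (r + i)"
      by linarith
  qed
qed

lemma symbols_add:
  assumes "a \<in> symbols s r q" "b \<in> symbols s r q"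
  shows "(\<lambda>L l. a L l + b L l) \<in> symbols s r q"
proof -
  obtain C where C: "C \<ge> 0" "\<And>L l i. L \<ge> 1 \<Longrightarrow> 2 * l \<ge> L + 2 * q \<Longrightarrow> i \<le> s \<Longrightarrow> \<bar>(fdiff ^^ i) (a L) l\<bar> \<le> C / real L ^ (r + i)"
    using symbolsE[OF assms(1)] by blast
  obtain D where D: "D \<ge> 0" "\<And>L l i. L \<ge> 1 \<Longrightarrow> 2 * l \<ge> L + 2 * q \<Longrightarrow> i \<le> s \<Longrightarrow> \<bar>(fdiff ^^ i) (b L) l\<bar> \<le> D / real L ^ (r + i)"
    using symbolsE[OF assms(2)] by blast
  show ?thesis
  proof (rule symbolsI)
    fix L l i :: nat assume L: "L \<ge> 1" "2 * l \<ge> L + 2 * q" "i \<le> s"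
    show "\<bar>(fdiff ^^ i) (\<lambda>l. a L l + b L l) l\<bar> \<le> (C + D) / real L ^ (r + i)"
      unfolding fdiff_power_add add_divide_distrib
      using C(2)[OF L] D(2)[OF L] by linarith
  qed
qed

lemma symbols_cmult:
  assumes "a \<in> symbols s r q"
  shows "(\<lambda>L l. c * a L l) \<in> symbols s r q"
proof -
  obtain C where C: "C \<ge> 0" "\<And>L l i. L \<ge> 1 \<Longrightarrow> 2 * l \<ge> L + 2 * q \<Longrightarrow> i \<le> s \<Longrightarrow> \<bar>(fdiff ^^ i) (a L) l\<bar> \<le> C / real L ^ (r + i)"
    using symbolsE[OF assms(1)] by blast
  show ?thesis
  proof (rule symbolsI)
    fix L l i :: nat assume L: "L \<ge> 1" "2 * l \<ge> L + 2 * q" "i \<le> s"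
    show "\<bar>(fdiff ^^ i) (\<lambda>l. c * a L l) l\<bar> \<le> (\<bar>c\<bar> * C) / real L ^ (r + i)"
      unfolding fdiff_power_cmult abs_mult times_divide_eq_right[symmetric]
      by (intro mult_left_mono C L) auto
  qed
qed

lemma symbols_shift_up:
  assumes "a \<in> symbols s r q"
  shows "(\<lambda>L l. a L (Suc l)) \<in> symbols s r q"
proof -
  obtain C where C: "C \<ge> 0" "\<And>L l i. L \<ge> 1 \<Longrightarrow> 2 * l \<ge> L + 2 * q \<Longrightarrow> i \<le> s \<Longrightarrow> \<bar>(fdiff ^^ i) (a L) l\<bar> \<le> C / real L ^ (r + i)"
    using symbolsE[OF assms(1)] by blast
  show ?thesis
    by (rule symbolsI[where C = C]) (simp add: fdiff_power_shift_up C)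
qed

text \<open>Looking one index back requires a larger \<open>l\<close>; the parameter
  \<open>q\<close> records how far the region of validity has receded.\<close>

lemma symbols_shift_down:
  assumes "a \<in> symbols s r q"
  shows "(\<lambda>L l. a L (l - 1)) \<in> symbols s r (Suc q)"
proof -
  obtain C where C: "C \<ge> 0" "\<And>L l i. L \<ge> 1 \<Longrightarrow> 2 * l \<ge> L + 2 * q \<Longrightarrow> i \<le> s \<Longrightarrow> \<bar>(fdiff ^^ i) (a L) l\<bar> \<le> C / real L ^ (r + i)"
    using symbolsE[OF assms(1)] by blast
  show ?thesis
    by (rule symbolsI[where C = C], subst fdiff_power_shift_down) (auto intro!: C)
qed

text \<open>The region of indices is closed upwards and forward differences look only upwards, so
  values outside the region have no influence.\<close>

lemma symbols_cong:
  assumes "a \<in> symbols s r q" "\<And>L l. L \<ge> 1 \<Longrightarrow> 2 * l \<ge> L + 2 * q \<Longrightarrow> b L l = a L l"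
  shows "b \<in> symbols s r q"
proof -
  obtain C where C: "C \<ge> 0" "\<And>L l i. L \<ge> 1 \<Longrightarrow> 2 * l \<ge> L + 2 * q \<Longrightarrow> i \<le> s \<Longrightarrow> \<bar>(fdiff ^^ i) (a L) l\<bar> \<le> C / real L ^ (r + i)"
    using symbolsE[OF assms(1)] by blast
  show ?thesis
  proof (rule symbolsI[where C = C])
    fix L l i :: nat assume L: "L \<ge> 1" "2 * l \<ge> L + 2 * q" "i \<le> s"
    have "(fdiff ^^ i) (b L) l = (fdiff ^^ i) (a L) l"
      using L by (intro fdiff_power_cong assms(2)) auto
    then show "\<bar>(fdiff ^^ i) (b L) l\<bar> \<le> C / real L ^ (r + i)" using C(2)[OF L] by simp
  qed
qed

text \<open>Discrete Leibniz rule: the difference of the product is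
  \<open>fdiff a l * b (l + 1) + a l * fdiff b l\<close>, and each of the two terms gains one power
  of \<open>1 / L\<close>.\<close>

lemma symbols_mult:
  assumes "a \<in> symbols s r q" "b \<in> symbols s r' q"
  shows "(\<lambda>L l. a L l * b L l) \<in> symbols s (r + r') q"
  using assms
proof (induction s arbitrary: r r' a b)
  case 0
  obtain C where C: "C \<ge> 0" "\<And>L l i. L \<ge> 1 \<Longrightarrow> 2 * l \<ge> L + 2 * q \<Longrightarrow> i \<le> 0 \<Longrightarrow> \<bar>(fdiff ^^ i) (a L) l\<bar> \<le> C / real L ^ (r + i)"
    using symbolsE[OF 0(1)] by blast
  obtain D where D: "D \<ge> 0" "\<And>L l i. L \<ge> 1 \<Longrightarrow> 2 * l \<ge> L + 2 * q \<Longrightarrow> i \<le> 0 \<Longrightarrow> \<bar>(fdiff ^^ i) (b L) l\<bar> \<le> D / real L ^ (r' + i)"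
    using symbolsE[OF 0(2)] by blast
  show ?case
  proof (rule symbolsI[where C = "C * D"])
    fix L l i :: nat assume L: "L \<ge> 1" "2 * l \<ge> L + 2 * q" "i \<le> 0"
    have "\<bar>a L l * b L l\<bar> \<le> (C / real L ^ r) * (D / real L ^ r')"
      unfolding abs_mult using C(2)[OF L] D(2)[OF L] L(3) C(1) by (intro mult_mono) auto
    then show "\<bar>(fdiff ^^ i) (\<lambda>l. a L l * b L l) l\<bar> \<le> C * D / real L ^ (r + r' + i)"
      using L(3) by (simp add: power_add)
  qed
next
  case (Suc s)
  have a: "a \<in> symbols s r q" and b: "b \<in> symbols s r' q"
    using Suc.prems by (auto intro: symbols_mono)
  have "(\<lambda>L l. fdiff (a L) l * b L (Suc l)) \<in> symbols s (Suc r + r') q"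
    by (intro Suc.IH symbols_fdiff symbols_shift_up b Suc.prems)
  moreover have "(\<lambda>L l. a L l * fdiff (b L) l) \<in> symbols s (r + Suc r') q"
    by (intro Suc.IH symbols_fdiff a Suc.prems)
  ultimately have "(\<lambda>L l. fdiff (a L) l * b L (Suc l) + a L l * fdiff (b L) l) \<in> symbols s (Suc (r + r')) q"
    by (intro symbols_add) simp_all
  also have "(\<lambda>L l. fdiff (a L) l * b L (Suc l) + a L l * fdiff (b L) l) = (\<lambda>L. fdiff (\<lambda>l. a L l * b L l))"
    by (intro ext) (simp add: fdiff_def algebra_simps)
  finally have 1: "(\<lambda>L. fdiff (\<lambda>l. a L l * b L l)) \<in> symbols s (Suc (r + r')) q" .
  have "(\<lambda>L l. a L l * b L l) \<in> symbols s (r + r') q"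
    by (intro Suc.IH a b)
  then have "(\<lambda>L l. a L l * b L l) \<in> symbols 0 (r + r') q"
    by (rule symbols_mono) auto
  then show ?case using 1 by (rule symbols_SucI)
qed

text \<open>By induction on \<open>s\<close>, since \<open>\<beta> l = 1 / (2 l + c)\<close> satisfies \<open>fdiff \<beta> l = - 2 \<beta> l \<beta> (l + 1)\<close>.\<close>

lemma symbols_inverse_linear:
  assumes "c \<ge> 0"
  shows "(\<lambda>L l. 1 / (2 * real l + c)) \<in> symbols s 1 q"
proof (induction s)
  case 0
  show ?case
  proof (rule symbolsI[where C = 1])
    fix L l i :: nat assume L: "L \<ge> 1" "2 * l \<ge> L + 2 * q" "i \<le> 0"
    then have "real L \<le> 2 * real l" by linarith
    then show "\<bar>(fdiff ^^ i) (\<lambda>l. 1 / (2 * real l + c)) l\<bar> \<le> 1 / real L ^ (1 + i)"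
      using L assms by (simp add: frac_le)
  qed
next
  case (Suc s)
  let ?b = "\<lambda>l. 1 / (2 * real l + c)"
  have "(\<lambda>L l. -2 * (?b l * ?b (Suc l))) \<in> symbols s (1 + 1) q"
    by (intro symbols_cmult symbols_mult Suc symbols_shift_up[of "\<lambda>L. ?b"])
  then have "(\<lambda>L. fdiff ?b) \<in> symbols s (1 + 1) q"
  proof (rule symbols_cong)
    fix L l :: nat assume "L \<ge> 1" "2 * l \<ge> L + 2 * q"
    then have "l > 0" by simp
    then have "2 * real l + c > 0" "2 * real (Suc l) + c > 0" using assms by auto
    then show "fdiff ?b l = -2 * (?b l * ?b (Suc l))"
      by (simp add: fdiff_def divide_simps)
  qed
  moreover have "(\<lambda>L l. ?b l) \<in> symbols 0 1 q" using Suc by (rule symbols_mono) auto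
  ultimately show ?case by (intro symbols_SucI) simp_all
qed

text \<open>With \<open>K = 2 l + d - 1\<close> the two weights are
  \<open>1/2 + (d - 1) / (2 K)\<close> and \<open>1/2 - (d - 1) / (2 K)\<close>. Hence
  \<open>gdiff\<close> is minus half a second difference plus first and second differences divided
  by \<open>K\<close>; as \<open>1 / K\<close> is itself of order \<open>1 / L\<close>, every term
  gains two powers.\<close>

lemma symbols_gdiff:
  assumes a: "a \<in> symbols (Suc (Suc s)) r q" and "d \<ge> 1"
  shows "(\<lambda>L. gdiff d (a L)) \<in> symbols s (r + 2) (Suc q)"
proof -
  let ?b = "\<lambda>l. 1 / (2 * real l + (real d - 1))"
  let ?g = "\<lambda>L l. fdiff (a L) l" and ?G = "\<lambda>L l. fdiff (fdiff (a L)) (l - 1)"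
  have g: "?g \<in> symbols (Suc s) (Suc r) q" by (rule symbols_fdiff[OF a])
  have G: "?G \<in> symbols s (r + 2) (Suc q)"
    using symbols_shift_down[OF symbols_fdiff[OF g]] by simp
  have b: "(\<lambda>L. ?b) \<in> symbols s 1 (Suc q)"
    using assms(2) by (intro symbols_inverse_linear) auto
  have bG: "(\<lambda>L l. ?b l * ?G L l) \<in> symbols s (r + 2) (Suc q)"
    using symbols_mult[OF b G] by (rule symbols_mono) auto
  have "?g \<in> symbols s (Suc r) (Suc q)" using g by (rule symbols_mono) auto
  from symbols_mult[OF b this] have bg: "(\<lambda>L l. ?b l * ?g L l) \<in> symbols s (r + 2) (Suc q)"
    by simp
  have "(\<lambda>L l. (- 1/2) * ?G L l + ((real d - 1) / 2 * (?b l * ?G L l) + (- (real d - 1)) * (?b l * ?g L l)))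
      \<in> symbols s (r + 2) (Suc q)"
    by (intro symbols_add symbols_cmult G bG bg)
  then show ?thesis
  proof (rule symbols_cong)
    fix L l :: nat assume "L \<ge> 1" "2 * l \<ge> L + 2 * Suc q"
    then have l: "l \<ge> 1" by simp
    define K where "K = 2 * real l + (real d - 1)"
    have "K > 0" using l assms(2) by (simp add: K_def)
    \<comment> \<open>Here \<open>A\<close>, \<open>u\<close>, \<open>w\<close> stand for the values
      at \<open>l\<close>, \<open>l + 1\<close>, \<open>l - 1\<close>, and \<open>D\<close> for
      \<open>d - 1\<close>.\<close>
    have "A - ((K + D) / 2 * u + (K - D) / 2 * w) / K
        = (- 1/2) * ((u - A) - (A - w)) + (D / 2 * (1 / K * ((u - A) - (A - w))) + (- D) * (1 / K * (u - A)))"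
      for A u w D using \<open>K > 0\<close> by (simp add: field_simps)
    moreover have "real l = (K - (real d - 1)) / 2" "2 * real l + real d - 1 = K" "real l + real d - 1 = (K + (real d - 1)) / 2"
      by (simp_all add: K_def)
    moreover have "Suc (l - 1) = l" using l by simp
    ultimately show "gdiff d (a L) l = (- 1/2) * ?G L l + ((real d - 1) / 2 * (?b l * ?G L l) + (- (real d - 1)) * (?b l * ?g L l))"
      unfolding gdiff_def K_def[symmetric] fdiff_def by (simp only:)
  qed
qed

lemma symbols_gdiff_power:
  assumes "a \<in> symbols (2 * m + s) r q" and "d \<ge> 1"
  shows "(\<lambda>L. (gdiff d ^^ m) (a L)) \<in> symbols s (r + 2 * m) (q + m)"
  using assms(1)
proof (induction m arbitrary: s)
  case (Suc m)
  have "(\<lambda>L. (gdiff d ^^ m) (a L)) \<in> symbols (Suc (Suc s)) (r + 2 * m) (q + m)"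
    using Suc.prems by (intro Suc.IH) simp
  from symbols_gdiff[OF this assms(2)] show ?case by simp
qed simp

section \<open>From derivatives to differences\<close>

text \<open>The mean value theorem, iterated: the increment of \<open>E 0\<close> over a step \<eta>
  has as its derivatives the increments of the functions \<open>E j\<close>, and the last of these
  increments is at most \<open>B * \<eta>\<close>.\<close>

lemma fdiff_power_smooth_bound:
  assumes "\<And>j t. j < i \<Longrightarrow> t \<ge> 0 \<Longrightarrow> (E j has_real_derivative E (Suc j) t) (at t within {0..})"
    and "\<And>t. t \<ge> 0 \<Longrightarrow> \<bar>E i t\<bar> \<le> B" and "\<eta> \<ge> 0"
  shows "\<bar>(fdiff ^^ i) (\<lambda>l. E 0 (\<eta> * real l)) l\<bar> \<le> B * \<eta> ^ i"
  using assms(1,2)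
proof (induction i arbitrary: E B)
  case 0
  then show ?case using \<open>\<eta> \<ge> 0\<close> by simp
next
  case (Suc i)
  define E' where "E' j t = E j (t + \<eta>) - E j t" for j t
  have "(E' j has_real_derivative E' (Suc j) t) (at t within {0..})" if "j < i" "t \<ge> 0" for j t
  proof -
    have "(E j has_real_derivative E (Suc j) (t + \<eta>)) (at (t + \<eta>) within (\<lambda>t. t + \<eta>) ` {0..})"
      using Suc.prems(1)[of j "t + \<eta>"] that \<open>\<eta> \<ge> 0\<close> by (auto intro: DERIV_subset)
    then have "(E j \<circ> (\<lambda>t. t + \<eta>) has_real_derivative E (Suc j) (t + \<eta>) * 1) (at t within {0..})"
      by (rule DERIV_image_chain) (auto intro!: derivative_eq_intros)
    then have "((\<lambda>t. E j (t + \<eta>) - E j t) has_real_derivative E (Suc j) (t + \<eta>) - E (Suc j) t) (at t within {0..})"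
      using Suc.prems(1)[of j t] that by (intro DERIV_diff) (auto simp: o_def)
    then show ?thesis by (simp add: E'_def[abs_def])
  qed
  moreover have "\<bar>E' i t\<bar> \<le> B * \<eta>" if "t \<ge> 0" for t
  proof -
    have "norm (E i (t + \<eta>) - E i t) \<le> B * norm (t + \<eta> - t)"
      using Suc.prems that \<open>\<eta> \<ge> 0\<close>
      by (intro field_differentiable_bound[where S = "{0..}" and f' = "E (Suc i)"]) auto
    then show ?thesis using \<open>\<eta> \<ge> 0\<close> by (simp add: E'_def)
  qed
  ultimately have "\<bar>(fdiff ^^ i) (\<lambda>l. E' 0 (\<eta> * real l)) l\<bar> \<le> B * \<eta> * \<eta> ^ i"
    by (rule Suc.IH)
  also have "(\<lambda>l. E' 0 (\<eta> * real l)) = fdiff (\<lambda>l. E 0 (\<eta> * real l))"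
    by (intro ext) (simp add: E'_def fdiff_def algebra_simps)
  finally show ?case unfolding fdiff_power_Suc by simp
qed

text \<open>Beyond \<open>R\<close> the derivatives vanish together with \<open>h\<close>, so
  continuity on \<open>{0..R}\<close> bounds them on the whole half-line; each difference in
  \<open>l\<close> then produces a factor \<open>c / L\<close>.\<close>

lemma symbols_dilation:
  assumes "Ck_halfline \<kappa> h" "\<And>t. t > R \<Longrightarrow> h t = 0" "c \<ge> 0" "R \<ge> 0"
  shows "(\<lambda>L l. h (c * real l / real L)) \<in> symbols \<kappa> 0 q"
proof -
  obtain D where D: "\<And>t. t \<ge> 0 \<Longrightarrow> D 0 t = h t"
    "\<And>i t. i < \<kappa> \<Longrightarrow> t \<ge> 0 \<Longrightarrow> (D i has_real_derivative D (Suc i) t) (at t within {0..})"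
    "\<And>i. i \<le> \<kappa> \<Longrightarrow> continuous_on {0..} (D i)"
    using assms(1) unfolding Ck_halfline_def by blast
  have D0: "D i t = 0" if "i \<le> \<kappa>" "t > R" for i t
    using that
  proof (induction i arbitrary: t)
    case 0
    then show ?case using D(1)[of t] assms(2)[of t] \<open>R \<ge> 0\<close> by simp
  next
    case (Suc i)
    have "(D i has_real_derivative D (Suc i) t) (at t within {R<..})"
      using D(2)[of i t] Suc.prems \<open>R \<ge> 0\<close> by (auto intro: DERIV_subset)
    then have "(D i has_real_derivative D (Suc i) t) (at t)"
      using Suc.prems at_within_open[of t "{R<..}"] by simp
    moreover have "(D i has_real_derivative 0) (at t)"
    proof (rule has_field_derivative_transform_within_open[where S = "{R<..}" and f = "\<lambda>_. 0"])
      show "0 = D i x" if "x \<in> {R<..}" for x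
        using Suc.IH[of x] Suc.prems that by simp
    qed (use Suc.prems in auto)
    ultimately show ?case by (rule DERIV_unique)
  qed
  have "\<exists>B. \<forall>t\<ge>0. \<bar>D i t\<bar> \<le> B" if "i \<le> \<kappa>" for i
  proof -
    have "bounded (D i ` {0..R})"
      using D(3)[OF that] by (intro compact_imp_bounded compact_continuous_image) (auto intro: continuous_on_subset)
    then obtain B where B: "\<And>t. t \<in> {0..R} \<Longrightarrow> \<bar>D i t\<bar> \<le> B" unfolding bounded_iff real_norm_def by blast
    have "\<bar>D i t\<bar> \<le> B" if "t \<ge> 0" for t
    proof (cases "t \<le> R")
      case False
      then have "D i t = 0" using D0[OF \<open>i \<le> \<kappa>\<close>] by simp
      then show ?thesis using B[of 0] \<open>R \<ge> 0\<close> by simp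
    qed (use that B in simp)
    then show ?thesis by blast
  qed
  then obtain B where B: "\<And>i t. i \<le> \<kappa> \<Longrightarrow> t \<ge> 0 \<Longrightarrow> \<bar>D i t\<bar> \<le> B i" by metis
  have B0: "B i \<ge> 0" if "i \<le> \<kappa>" for i using B[OF that, of 0] by simp
  show ?thesis
  proof (rule symbolsI[where C = "\<Sum>i\<le>\<kappa>. B i * c ^ i"])
    fix L l i :: nat assume L: "L \<ge> 1" "2 * l \<ge> L + 2 * q" "i \<le> \<kappa>"
    have "(fdiff ^^ i) (\<lambda>l. h (c * real l / real L)) l = (fdiff ^^ i) (\<lambda>l. D 0 (c / real L * real l)) l"
      using \<open>c \<ge> 0\<close> by (intro fdiff_power_cong) (simp add: D(1))
    then have "\<bar>(fdiff ^^ i) (\<lambda>l. h (c * real l / real L)) l\<bar> \<le> B i * (c / real L) ^ i"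
      using fdiff_power_smooth_bound[of i D "B i" "c / real L" l] D(2) B L(3) \<open>c \<ge> 0\<close> by simp
    also have "\<dots> = B i * c ^ i / real L ^ i" by (simp add: power_divide)
    also have "\<dots> \<le> (\<Sum>i\<le>\<kappa>. B i * c ^ i) / real L ^ i"
      using L B0 \<open>c \<ge> 0\<close> by (intro divide_right_mono member_le_sum) auto
    finally show "\<bar>(fdiff ^^ i) (\<lambda>l. h (c * real l / real L)) l\<bar> \<le> (\<Sum>i\<le>\<kappa>. B i * c ^ i) / real L ^ (0 + i)"
      by simp
  qed
qed

section \<open>The needlet kernels in \<open>L\<^sub>1\<close>\<close>

lemma needlet_filter_continuous: "needlet_filter \<kappa> h \<Longrightarrow> continuous_on {0..} h"
proof -
  assume "needlet_filter \<kappa> h"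
  then obtain D where "\<forall>t\<ge>0. D 0 t = h t" "\<forall>i\<le>\<kappa>. continuous_on {0..} (D i)"
    unfolding needlet_filter_def Ck_halfline_def by blast
  then show ?thesis by (metis atLeast_iff continuous_on_cong le0)
qed

text \<open>Outside \<open>{1/2..2}\<close> this is the support condition; at the end points it is
  continuity, the zero set being closed. The end points matter, because degree bounds and case
  distinctions hit \<open>t = 1/2\<close> and \<open>t = 2\<close> exactly.\<close>

lemma needlet_filter_zero:
  assumes "needlet_filter \<kappa> h" "t \<ge> 0" "t \<le> 1/2 \<or> t \<ge> 2"
  shows "h t = 0"
proof -
  let ?N = "{t \<in> {0..}. h t = 0}"
  have "closed ?N"
    using needlet_filter_continuous[OF assms(1)] by (intro continuous_closed_preimage_constant) auto
  have sup: "s \<in> {1/2..2}" if "s \<ge> 0" "h s \<noteq> 0" for s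
    using assms(1) that closure_subset[of "{t. t \<ge> 0 \<and> h t \<noteq> 0}"] by (auto simp: needlet_filter_def)
  then have "s \<in> ?N" if "s \<in> {0..<1/2} \<or> s \<in> {2<..}" for s
  proof -
    have "s \<ge> 0" using that by auto
    then have "h s = 0" by (rule_tac ccontr) (use sup[of s] that in auto)
    then show ?thesis using \<open>s \<ge> 0\<close> by simp
  qed
  then have "{0..<1/2} \<subseteq> ?N" "{2<..} \<subseteq> ?N" by blast+
  then have "closure {0..<1/2} \<subseteq> ?N" "closure {2<..} \<subseteq> ?N"
    using \<open>closed ?N\<close> by (simp_all only: closure_minimal)
  moreover have "t \<in> closure {0..<1/2} \<or> t \<in> closure {2::real<..}"
    using assms by auto
  ultimately show ?thesis by blast
qed

definition profile :: "(real \<Rightarrow> real) \<Rightarrow> nat \<Rightarrow> nat \<Rightarrow> real" where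
  "profile h L l = (if l \<le> L then 1 else (h (real l / real L))\<^sup>2)"

lemma profile_support:
  assumes "needlet_filter \<kappa> h" "L \<ge> 1" "l \<ge> 2 * L"
  shows "profile h L l = 0"
proof -
  have "real l / real L \<ge> 2" using assms by (simp add: field_simps)
  then show ?thesis
    using assms needlet_filter_zero[OF assms(1), of "real l / real L"] by (simp add: profile_def)
qed

text \<open>For \<open>l \<ge> L / 2\<close> the partition of unity turns the profile into the
  single formula \<open>h (l / L)^2 + h (2 l / L)^2\<close>: up to \<open>L\<close> it equals 1, and
  past \<open>L\<close> the second term vanishes. So no smoothness is lost at the seam
  \<open>l = L\<close>.\<close>

lemma profile_symbols:
  assumes "needlet_filter \<kappa> h"
  shows "profile h \<in> symbols \<kappa> 0 0"
proof -
  have Ck: "Ck_halfline \<kappa> h" using assms by (simp add: needlet_filter_def)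
  let ?a = "\<lambda>c L l. h (c * real l / real L)"
  have a: "?a c \<in> symbols \<kappa> 0 0" if "c \<ge> 0" for c
    using needlet_filter_zero[OF assms] that by (intro symbols_dilation[OF Ck, of 2]) auto
  have "(\<lambda>L l. ?a 1 L l * ?a 1 L l + ?a 2 L l * ?a 2 L l) \<in> symbols \<kappa> 0 0"
    using symbols_add[OF symbols_mult[OF a a] symbols_mult[OF a a], of 1 1 2 2] by simp
  then show ?thesis
  proof (rule symbols_cong)
    fix L l :: nat assume L: "L \<ge> 1" "2 * l \<ge> L + 2 * 0"
    let ?t = "real l / real L"
    show "profile h L l = ?a 1 L l * ?a 1 L l + ?a 2 L l * ?a 2 L l"
    proof (cases "l \<le> L")
      case True
      have "?t \<in> {1/2..1}" using L True by (auto simp: field_simps)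
      then have "(h ?t)\<^sup>2 + (h (2 * ?t))\<^sup>2 = 1" using assms unfolding needlet_filter_def by blast
      then have "(h (1 * real l / real L))\<^sup>2 + (h (2 * real l / real L))\<^sup>2 = 1" by simp
      then show ?thesis using True unfolding power2_eq_square by (simp add: profile_def)
    next
      case False
      then have "2 * real l / real L \<ge> 2" using L by (simp add: field_simps)
      then have "h (2 * real l / real L) = 0" using needlet_filter_zero[OF assms] by simp
      then show ?thesis using False by (simp add: profile_def power2_eq_square)
    qed
  qed
qed

lemma gdiff_const: "d \<ge> 2 \<Longrightarrow> f (Suc l) = c \<Longrightarrow> f l = c \<Longrightarrow> f (l - 1) = c \<Longrightarrow> gdiff d f l = 0"
  by (simp add: gdiff_def field_simps)

text \<open>The profile is constant up to \<open>L\<close>, \<open>gdiff\<close> annihilates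
  constants, and each application reaches one index further up.\<close>

lemma gdiff_power_profile_low:
  assumes "d \<ge> 2" "l + m \<le> L"
  shows "(gdiff d ^^ m) (profile h L) l = (if m = 0 then 1 else 0)"
  using assms(2)
proof (induction m arbitrary: l)
  case (Suc m)
  then show ?case
    by (simp, intro gdiff_const[OF assms(1), where c = "if m = 0 then 1 else 0"]) (simp_all add: Suc.IH)
qed (simp add: profile_def)

text \<open>For \<open>2 l \<ge> L + 2 m\<close> the symbol estimate applies; below, the profile is
  locally constant. The threshold on \<open>L\<close> closes the gap: \<open>2 l < L + 2 m\<close>
  forces \<open>l + 1 + m \<le> L\<close>, which leaves room for one more difference.\<close>

lemma gdiff_power_profile_bound:
  assumes "d \<ge> 2" "needlet_filter \<kappa> h" "2 * m \<le> \<kappa>"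
  shows "\<exists>C\<ge>0. \<forall>L\<ge>4 * m + 2. \<forall>l. \<bar>(gdiff d ^^ m) (profile h L) l\<bar> \<le> C / real L ^ (2 * m)"
proof -
  have "(\<lambda>L. (gdiff d ^^ m) (profile h L)) \<in> symbols 0 (0 + 2 * m) (0 + m)"
    using assms by (intro symbols_gdiff_power symbols_mono[OF profile_symbols[OF assms(2)]]) auto
  from symbolsE[OF this] obtain C where C0: "C \<ge> 0"
    "\<And>L l i. L \<ge> 1 \<Longrightarrow> 2 * l \<ge> L + 2 * (0 + m) \<Longrightarrow> i \<le> 0 \<Longrightarrow>
      \<bar>(fdiff ^^ i) ((gdiff d ^^ m) (profile h L)) l\<bar> \<le> C / real L ^ (0 + 2 * m + i)"
    by blast
  have C: "C \<ge> 0" "\<And>L l. L \<ge> 1 \<Longrightarrow> 2 * l \<ge> L + 2 * m \<Longrightarrow> \<bar>(gdiff d ^^ m) (profile h L) l\<bar> \<le> C / real L ^ (2 * m)"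
    using C0(1) C0(2)[where i = 0] by simp_all
  \<comment> \<open>The summand 1 covers \<open>m = 0\<close>, where the low values are 1 and not
    0.\<close>
  have "\<bar>(gdiff d ^^ m) (profile h L) l\<bar> \<le> (C + 1) / real L ^ (2 * m)" if L: "L \<ge> 4 * m + 2" for L l
  proof (cases "2 * l \<ge> L + 2 * m")
    case True
    have "\<bar>(gdiff d ^^ m) (profile h L) l\<bar> \<le> C / real L ^ (2 * m)"
      using L True by (intro C) auto
    also have "\<dots> \<le> (C + 1) / real L ^ (2 * m)" by (intro divide_right_mono) auto
    finally show ?thesis .
  next
    case False
    then show ?thesis using L C(1) gdiff_power_profile_low[OF assms(1), of l m L h] by auto
  qed
  then show ?thesis using C(1) by (intro exI[of _ "C + 1"]) auto
qed

lemma fdiff_gdiff_power_profile_bound: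
  assumes "d \<ge> 2" "needlet_filter \<kappa> h" "2 * m + 1 \<le> \<kappa>"
  shows "\<exists>C\<ge>0. \<forall>L\<ge>4 * m + 2. \<forall>l. \<bar>fdiff ((gdiff d ^^ m) (profile h L)) l\<bar> \<le> C / real L ^ (2 * m + 1)"
proof -
  have "(\<lambda>L. (gdiff d ^^ m) (profile h L)) \<in> symbols (Suc 0) (0 + 2 * m) (0 + m)"
    using assms by (intro symbols_gdiff_power symbols_mono[OF profile_symbols[OF assms(2)]]) auto
  from symbolsE[OF symbols_fdiff[OF this]] obtain C where C0: "C \<ge> 0"
    "\<And>L l i. L \<ge> 1 \<Longrightarrow> 2 * l \<ge> L + 2 * (0 + m) \<Longrightarrow> i \<le> 0 \<Longrightarrow>
      \<bar>(fdiff ^^ i) (fdiff ((gdiff d ^^ m) (profile h L))) l\<bar> \<le> C / real L ^ (Suc (0 + 2 * m) + i)"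
    by blast
  have C: "C \<ge> 0" "\<And>L l. L \<ge> 1 \<Longrightarrow> 2 * l \<ge> L + 2 * m \<Longrightarrow> \<bar>fdiff ((gdiff d ^^ m) (profile h L)) l\<bar> \<le> C / real L ^ (2 * m + 1)"
    using C0(1) C0(2)[where i = 0] by simp_all
  have "\<bar>fdiff ((gdiff d ^^ m) (profile h L)) l\<bar> \<le> C / real L ^ (2 * m + 1)" if L: "L \<ge> 4 * m + 2" for L l
  proof (cases "2 * l \<ge> L + 2 * m")
    case True
    then show ?thesis using L by (intro C) auto
  next
    case False
    then show ?thesis
      using L C(1) gdiff_power_profile_low[OF assms(1), of l m L h] gdiff_power_profile_low[OF assms(1), of "Suc l" m L h]
      by (auto simp: fdiff_def)
  qed
  then show ?thesis using C(1) by blast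
qed

section \<open>The kernel and its weighted energy\<close>

text \<open>The profile vanishes from \<open>2 * L\<close> on; the \<kappa> further indices leave
  room for up to \<kappa> multiplications by \<open>1 - t\<close>, each of which raises the degree
  by one.\<close>

definition needlet_kernel :: "nat \<Rightarrow> nat \<Rightarrow> (real \<Rightarrow> real) \<Rightarrow> nat \<Rightarrow> real poly" where
  "needlet_kernel d \<kappa> h L = zonal_sum d (Suc (2 * L + \<kappa>)) (profile h L)"

context ultraspherical_mean
begin

text \<open>Apart from the linear factor, \<open>Z\<close> contains a quotient of factorials that is
  a product of \<open>d - 2\<close> factors, each at most \<open>l + d\<close>.\<close>

lemma Z_le: "Z d l \<le> 2 * real (l + d) ^ (d - 1)"
proof -
  have "fact (l + d - 2) = fact l * pochhammer (real l + 1) (d - 2)"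
    using dim pochhammer_product'[of "1::real" l "d - 2"] by (simp add: pochhammer_fact add.commute)
  moreover have "pochhammer (real l + 1) (d - 2) \<le> real (l + d) ^ (d - 2)"
  proof -
    have "pochhammer (real l + 1) (d - 2) = (\<Prod>i<d - 2. real l + 1 + real i)"
      by (simp add: pochhammer_prod lessThan_atLeast0)
    also have "\<dots> \<le> (\<Prod>i<d - 2. real (l + d))" by (intro prod_mono) auto
    finally show ?thesis by simp
  qed
  ultimately have le: "fact (l + d - 2) / fact l \<le> real (l + d) ^ (d - 2)" by simp
  define X where "X = (2 * real l + real d - 1) * (fact (l + d - 2) / fact l)"
  have "X \<ge> 0" using dim by (simp add: X_def)
  have "Z d l = X / fact (d - 1)"
    unfolding Z_eq X_def by simp
  also have "\<dots> \<le> X"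
    using \<open>X \<ge> 0\<close> fact_ge_1[of "d - 1", where 'a = real] by (simp add: divide_le_eq mult_le_cancel_left1)
  also have "\<dots> \<le> (2 * real (l + d)) * real (l + d) ^ (d - 2)"
    using dim le unfolding X_def by (intro mult_mono) auto
  finally have "Z d l \<le> 2 * (real (l + d) * real (l + d) ^ (d - 2))" by (simp only: mult.assoc)
  also have "real (l + d) * real (l + d) ^ (d - 2) = real (l + d) ^ (d - 1)"
  proof -
    have "d - 1 = Suc (d - 2)" using dim by simp
    then show ?thesis by simp
  qed
  finally show ?thesis .
qed

text \<open>A number of terms of order \<open>L\<close>, each of order \<open>L^(d - 1)\<close>; for
  \<open>L \<ge> 1\<close> the constants absorb the offsets \<open>k\<close> and
  \<open>d\<close>.\<close>

lemma sum_Z_le: "\<exists>C\<ge>0. \<forall>L\<ge>1. (\<Sum>l<Suc (2 * L + k). Z d l) \<le> C * real L ^ d"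
proof (intro exI[of _ "real (3 + k) * (2 * real (2 + k + d) ^ (d - 1))"] conjI allI impI)
  fix L :: nat assume L: "1 \<le> L"
  have "Z d l \<le> 2 * (real (2 + k + d) * real L) ^ (d - 1)" if "l < Suc (2 * L + k)" for l
  proof -
    have "l + d \<le> (2 + k + d) * L"
      using that mult_le_mono2[OF L, of k] mult_le_mono2[OF L, of d] by (simp only: add_mult_distrib)
    then have "real (l + d) \<le> real (2 + k + d) * real L" by (metis of_nat_mult of_nat_mono)
    then have "real (l + d) ^ (d - 1) \<le> (real (2 + k + d) * real L) ^ (d - 1)"
      by (rule power_mono) simp
    then show ?thesis using Z_le[of l] by linarith
  qed
  then have "(\<Sum>l<Suc (2 * L + k). Z d l) \<le> real (card {..<Suc (2 * L + k)}) * (2 * (real (2 + k + d) * real L) ^ (d - 1))"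
    by (intro sum_bounded_above) simp
  also have "\<dots> \<le> (real (3 + k) * real L) * (2 * (real (2 + k + d) * real L) ^ (d - 1))"
  proof (intro mult_right_mono)
    have "k \<le> k * L" using L by simp
    then have "Suc (2 * L + k) \<le> 3 * L + k * L" using L by linarith
    then have "Suc (2 * L + k) \<le> (3 + k) * L" by (simp only: add_mult_distrib)
    then show "real (card {..<Suc (2 * L + k)}) \<le> real (3 + k) * real L"
      by (metis card_lessThan of_nat_mult of_nat_mono)
  qed simp
  also have "\<dots> = real (3 + k) * (2 * real (2 + k + d) ^ (d - 1)) * (real L * real L ^ (d - 1))"
    by (simp add: power_mult_distrib)
  also have "real L * real L ^ (d - 1) = real L ^ d"
    using dim by (metis power_eq_if not_numeral_le_zero)
  finally show "(\<Sum>l<Suc (2 * L + k). Z d l) \<le> real (3 + k) * (2 * real (2 + k + d) ^ (d - 1)) * real L ^ d" .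
qed simp

text \<open>For \<open>s = 2 m\<close> each copy of the kernel absorbs \<open>m\<close> factors
  \<open>1 - t\<close>, and Parseval leaves the squares of the coefficients after \<open>m\<close>
  applications of \<open>gdiff\<close>. For \<open>s = 2 m + 1\<close> the remaining factor is
  handled by the Dirichlet form. Either way the coefficients are of order \<open>L^(-s)\<close> and
  use \<open>s\<close> differences of the profile.\<close>

lemma kernel_energy:
  assumes h: "needlet_filter \<kappa> h" and s: "s \<le> \<kappa>"
  shows "\<exists>C\<ge>0. \<forall>L\<ge>2 * s + 2. \<Lambda> ([:1, -1:] ^ s * (needlet_kernel d \<kappa> h L)\<^sup>2) \<le> C * real L ^ d / real L ^ (2 * s)"
proof -
  obtain D where D: "D \<ge> 0" "\<And>L. L \<ge> 1 \<Longrightarrow> (\<Sum>l<Suc (2 * L + \<kappa>). Z d l) \<le> D * real L ^ d"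
    using sum_Z_le by blast
  obtain m where m: "s = 2 * m \<or> s = 2 * m + 1" by (metis oddE evenE)
  then have m\<kappa>: "m \<le> \<kappa>" using s by auto
  let ?g = "\<lambda>L. (gdiff d ^^ m) (profile h L)" and ?K = "\<lambda>L. Suc (2 * L + \<kappa>)"
  have v: "[:1, -1:] ^ m * needlet_kernel d \<kappa> h L = zonal_sum d (?K L) (?g L)" if "L \<ge> 1" for L
    unfolding needlet_kernel_def by (intro zonal_sum_gdiff_power profile_support[OF h that] m\<kappa>)
  have g0: "?g L l = 0" if "L \<ge> 1" "l \<ge> 2 * L + \<kappa>" for L l
    using that m\<kappa> by (intro gdiff_power_support[OF profile_support[OF h \<open>L \<ge> 1\<close>]]) auto
  \<comment> \<open>Common to both parities: \<open>q\<close> stands for \<open>Z\<close> or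
    \<open>Zup\<close>, and \<open>b\<close> for the coefficients after \<open>gdiff\<close> or
    their differences.\<close>
  have bound: "(\<Sum>l<?K L. q l * (b l)\<^sup>2) \<le> C\<^sup>2 * D * real L ^ d / real L ^ (2 * s)"
    if "L \<ge> 1" "\<And>l. q l \<le> Z d l" "\<And>l. \<bar>b l\<bar> \<le> C / real L ^ s" for q b C L
  proof -
    have "(\<Sum>l<?K L. q l * (b l)\<^sup>2) \<le> (\<Sum>l<?K L. Z d l * (C / real L ^ s)\<^sup>2)"
    proof (intro sum_mono mult_mono that)
      fix l
      show "(b l)\<^sup>2 \<le> (C / real L ^ s)\<^sup>2"
        using that(3)[of l] by (metis abs_ge_zero power2_abs power_mono)
    qed (use Z_pos in \<open>auto simp: less_imp_le\<close>)
    also have "\<dots> = (C / real L ^ s)\<^sup>2 * (\<Sum>l<?K L. Z d l)"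
      unfolding sum_distrib_left by (simp only: mult.commute)
    also have "\<dots> \<le> (C / real L ^ s)\<^sup>2 * (D * real L ^ d)"
      by (intro mult_left_mono D that) simp
    also have "\<dots> = C\<^sup>2 * D * real L ^ d / real L ^ (2 * s)"
      by (simp add: power_divide power_mult[symmetric] mult.commute)
    finally show ?thesis .
  qed
  show ?thesis
  proof (cases "s = 2 * m")
    case True
    obtain C where C: "C \<ge> 0" "\<And>L l. L \<ge> 4 * m + 2 \<Longrightarrow> \<bar>?g L l\<bar> \<le> C / real L ^ (2 * m)"
      using gdiff_power_profile_bound[OF dim h, of m] s True by auto
    have "\<Lambda> ([:1, -1:] ^ s * (needlet_kernel d \<kappa> h L)\<^sup>2) \<le> C\<^sup>2 * D * real L ^ d / real L ^ (2 * s)"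
      if "L \<ge> 2 * s + 2" for L
    proof -
      have L: "L \<ge> 1" using that by simp
      have "[:1, -1:] ^ s * (needlet_kernel d \<kappa> h L)\<^sup>2 = ([:1, -1:] ^ m * needlet_kernel d \<kappa> h L) * ([:1, -1:] ^ m * needlet_kernel d \<kappa> h L)"
        unfolding True mult_2 power_add power2_eq_square by (simp only: mult_ac)
      also have "\<Lambda> \<dots> = (\<Sum>l<?K L. Z d l * (?g L l)\<^sup>2)"
        unfolding v[OF L] mean_zonal_sum_mult by (simp only: power2_eq_square mult_ac)
      also have "\<dots> \<le> C\<^sup>2 * D * real L ^ d / real L ^ (2 * s)"
        using that True by (intro bound L C(2)[folded True] order.refl) auto
      finally show ?thesis .
    qed
    then show ?thesis using D(1) by (intro exI[of _ "C\<^sup>2 * D"]) auto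
  next
    case False
    then have s': "s = 2 * m + 1" using m by simp
    obtain C where C: "C \<ge> 0" "\<And>L l. L \<ge> 4 * m + 2 \<Longrightarrow> \<bar>fdiff (?g L) l\<bar> \<le> C / real L ^ (2 * m + 1)"
      using fdiff_gdiff_power_profile_bound[OF dim h, of m] s s' by auto
    have "\<Lambda> ([:1, -1:] ^ s * (needlet_kernel d \<kappa> h L)\<^sup>2) \<le> C\<^sup>2 * D * real L ^ d / real L ^ (2 * s)"
      if "L \<ge> 2 * s + 2" for L
    proof -
      have L: "L \<ge> 1" using that by simp
      have "[:1, -1:] ^ s * (needlet_kernel d \<kappa> h L)\<^sup>2 = [:1, -1:] * ([:1, -1:] ^ m * needlet_kernel d \<kappa> h L) * ([:1, -1:] ^ m * needlet_kernel d \<kappa> h L)"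
        unfolding s' mult_2 power_add power2_eq_square power_one_right by (simp only: mult_ac)
      also have "\<Lambda> \<dots> = (\<Sum>l<?K L. Zup d l * (?g L l - ?g L (Suc l))\<^sup>2)"
        unfolding v[OF L] by (rule mean_zonal_sum_dirichlet) (rule g0[OF L])
      also have "\<dots> = (\<Sum>l<?K L. Zup d l * (fdiff (?g L) l)\<^sup>2)"
        by (simp only: fdiff_def power2_commute)
      also have "\<dots> \<le> C\<^sup>2 * D * real L ^ d / real L ^ (2 * s)"
        using that s' by (intro bound L C(2)[folded s'] Zup_le) auto
      finally show ?thesis .
    qed
    then show ?thesis using D(1) by (intro exI[of _ "C\<^sup>2 * D"]) auto
  qed
qed

end

section \<open>The \<open>L_1\<close> bound\<close>

text \<open>Dyadic decomposition: with \<open>u = L * norm (z - x)\<close> one has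
  \<open>L^2 (1 - x \<bullet> z) = u^2 / 2\<close>, so where \<open>u\<close> is about
  \<open>2^k\<close> the integrand is of order \<open>4^(-k s)\<close>, and this happens on a cap of
  measure of order \<open>(2^k / L)^d\<close>. Since \<open>2 s > d\<close>, the sum over
  \<open>k\<close> is dominated by a geometric series.\<close>

lemma integral_cap_weight_le:
  fixes x :: "real ^ 'n"
  assumes n: "CARD('n) = d + 1" "d \<ge> 1" and s: "2 * s > d" and x: "norm x = 1" and L: "L \<ge> 1"
  shows "(\<integral>z. 1 / (1 + ((real L)\<^sup>2 * (1 - x \<bullet> z)) ^ s) \<partial>sphere_measure)
    \<le> 8 ^ s * (2 * (2 ^ (d + 1) / measure lborel (ball (0 :: real ^ 'n) 1))) / real L ^ d"
proof -
  interpret prob_space "sphere_measure :: (real ^ 'n) measure" by (rule prob_space_sphere_measure)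
  define A where "A = 2 ^ (d + 1) / measure lborel (ball (0 :: real ^ 'n) 1)"
  have "A \<ge> 0" by (simp add: A_def)
  \<comment> \<open>Enough shells for the whole sphere, as
    \<open>u \<le> 2 L \<le> 2^(L + 1)\<close>.\<close>
  let ?K = "Suc L"
  \<comment> \<open>If \<open>k > 0\<close> is minimal with \<open>u \<le> 2^k\<close>, then
    \<open>u > 2^(k - 1)\<close>, hence \<open>u^2 / 2\<close> exceeds
    \<open>4^k / 8\<close>.\<close>
  define c where "c k = ((8::real) / 4 ^ k) ^ s" for k :: nat
  have c0: "c k \<ge> 0" for k by (simp add: c_def)
  have pos: "1 + ((real L)\<^sup>2 * (1 - x \<bullet> z)) ^ s \<ge> 1" if "norm z = 1" for z
    using inner_sphere_Icc[of x z] x that by simp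
  have pw: "1 / (1 + ((real L)\<^sup>2 * (1 - x \<bullet> z)) ^ s) \<le> (\<Sum>k\<le>?K. c k * indicat_real (cap x (2 ^ k / real L)) z)"
    if "z \<in> space sphere_measure" for z
  proof -
    have z: "norm z = 1" using that by simp
    define u where "u = real L * norm (z - x)"
    have u: "(real L)\<^sup>2 * (1 - x \<bullet> z) = u\<^sup>2 / 2"
    proof -
      have "(norm (z - x))\<^sup>2 = 2 * (1 - x \<bullet> z)"
      proof -
        have "x \<bullet> x = 1" "z \<bullet> z = 1" using x z by (simp_all add: dot_square_norm)
        then show ?thesis
          by (simp add: power2_norm_eq_inner inner_diff_left inner_diff_right inner_commute)
      qed
      then show ?thesis by (simp add: u_def power_mult_distrib)
    qed
    have "u \<le> 2 * real L"
      using norm_triangle_ineq4[of z x] x z by (simp add: u_def mult.commute mult_left_mono)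
    also have "\<dots> \<le> 2 ^ ?K"
      using of_nat_less_two_power[of L, where 'a = real] by simp
    finally have uK: "u \<le> 2 ^ ?K" .
    then have "\<exists>k. u \<le> 2 ^ k" by (rule exI)
    define k where "k = (LEAST k. u \<le> 2 ^ k)"
    have k: "u \<le> 2 ^ k" unfolding k_def by (rule LeastI_ex) fact
    have "k \<le> ?K" unfolding k_def by (rule Least_le) fact
    have "norm (z - x) \<le> 2 ^ k / real L"
      using k L by (simp add: u_def field_simps)
    then have ind: "indicat_real (cap x (2 ^ k / real L)) z = 1"
      using z by (simp add: cap_def indicator_def)
    have "1 / (1 + (u\<^sup>2 / 2) ^ s) \<le> c k"
    proof (cases k)
      case 0
      have "(u\<^sup>2 / 2) ^ s \<ge> 0" by simp
      then have "1 / (1 + (u\<^sup>2 / 2) ^ s) \<le> 1" by (intro divide_le_eq_1_pos[THEN iffD2]) linarith+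
      moreover have "c k = 8 ^ s" by (simp add: c_def 0)
      moreover have "(1::real) \<le> 8 ^ s" by simp
      ultimately show ?thesis by linarith
    next
      case (Suc j)
      then have "\<not> u \<le> 2 ^ j" unfolding k_def by (intro not_less_Least) (simp add: k_def[symmetric])
      then have "(2 ^ j)\<^sup>2 \<le> u\<^sup>2" by (intro power_mono) auto
      then have "4 ^ k / 8 \<le> u\<^sup>2 / 2" by (simp add: Suc power2_eq_square power_mult_distrib[symmetric])
      then have "(4 ^ k / 8) ^ s \<le> 1 + (u\<^sup>2 / 2) ^ s"
        using power_mono[of "4 ^ k / 8" "u\<^sup>2 / 2" s] by simp
      then have "1 / (1 + (u\<^sup>2 / 2) ^ s) \<le> 1 / (4 ^ k / 8) ^ s"
        by (intro divide_left_mono) (auto intro!: mult_pos_pos add_pos_nonneg)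
      then show ?thesis by (simp add: c_def power_divide)
    qed
    also have "c k = c k * indicat_real (cap x (2 ^ k / real L)) z" by (simp add: ind)
    also have "\<dots> \<le> (\<Sum>k\<le>?K. c k * indicat_real (cap x (2 ^ k / real L)) z)"
      using \<open>k \<le> ?K\<close> c0 by (intro member_le_sum[of k "{..?K}" "\<lambda>k. c k * indicat_real (cap x (2 ^ k / real L)) z"]) auto
    finally show ?thesis by (simp only: u)
  qed
  have int: "integrable sphere_measure (\<lambda>z. c k * indicat_real (cap x (2 ^ k / real L)) z)" for k
    by (intro integrable_mult_right integrable_real_indicator sets_cap) (simp add: less_top[symmetric])
  have "(\<integral>z. 1 / (1 + ((real L)\<^sup>2 * (1 - x \<bullet> z)) ^ s) \<partial>sphere_measure)
    \<le> (\<integral>z. (\<Sum>k\<le>?K. c k * indicat_real (cap x (2 ^ k / real L)) z) \<partial>sphere_measure)"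
  proof (intro integral_mono pw Bochner_Integration.integrable_sum int)
    show "integrable sphere_measure (\<lambda>z. 1 / (1 + ((real L)\<^sup>2 * (1 - x \<bullet> z)) ^ s))"
    proof (intro integrable_sphere_continuous continuous_intros ballI)
      fix z :: "real ^ 'n" assume "z \<in> sphere 0 1"
      then show "1 + ((real L)\<^sup>2 * (1 - x \<bullet> z)) ^ s \<noteq> 0" using pos[of z] by simp
    qed
  qed
  also have "\<dots> = (\<Sum>k\<le>?K. c k * measure sphere_measure (cap x (2 ^ k / real L)))"
    by (subst Bochner_Integration.integral_sum[OF int]) (simp add: sets_cap Int_absorb2 cap_def subset_iff)
  also have "\<dots> \<le> (\<Sum>k\<le>?K. c k * (A * (2 ^ k / real L) ^ d))"
    unfolding A_def using n x by (intro sum_mono mult_left_mono measure_cap_le c0) auto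
  also have "\<dots> \<le> (\<Sum>k\<le>?K. 8 ^ s * A / real L ^ d * (1/2) ^ k)"
  proof (intro sum_mono)
    fix k
    have "(2::real) ^ (k * d) * 2 ^ k \<le> 4 ^ (k * s)"
    proof -
      \<comment> \<open>Integrality sharpens \<open>d < 2 s\<close> to
        \<open>d + 1 \<le> 2 s\<close>, which gives the ratio 1/2.\<close>
      have "k * d + k \<le> 2 * (k * s)" using mult_le_mono2[of "d + 1" "2 * s" k] s by (simp add: algebra_simps)
      then have "(2::real) ^ (k * d + k) \<le> 2 ^ (2 * (k * s))" by (intro power_increasing) auto
      then show ?thesis by (simp add: power_add power_mult)
    qed
    then have "(2 ^ k) ^ d / (4 ^ k) ^ s \<le> (1/2::real) ^ k"
      by (simp add: power_mult[symmetric] field_simps)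
    then have "(8 ^ s * A / real L ^ d) * ((2 ^ k) ^ d / (4 ^ k) ^ s) \<le> (8 ^ s * A / real L ^ d) * (1/2) ^ k"
      using \<open>A \<ge> 0\<close> by (intro mult_left_mono) auto
    then show "c k * (A * (2 ^ k / real L) ^ d) \<le> 8 ^ s * A / real L ^ d * (1/2) ^ k"
      by (simp add: c_def power_divide mult_ac)
  qed
  also have "\<dots> = 8 ^ s * A / real L ^ d * (\<Sum>k\<le>?K. (1/2) ^ k)"
    by (simp only: sum_distrib_left)
  also have "\<dots> \<le> 8 ^ s * A / real L ^ d * 2"
  proof (intro mult_left_mono)
    have eq: "(\<Sum>k\<le>?K. (1/2::real) ^ k) = (1 - (1/2) ^ Suc ?K) / (1 - 1/2)"
      by (subst sum_gp0) auto
    show "(\<Sum>k\<le>?K. (1/2::real) ^ k) \<le> 2" unfolding eq by simp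
  qed (use \<open>A \<ge> 0\<close> in auto)
  finally show ?thesis unfolding A_def by (simp add: mult_ac)
qed

text \<open>Weighted energy bounds for the kernel give an \<open>L\<^sub>1\<close> bound, by AM-GM in place of the
  Cauchy-Schwarz inequality.\<close>

lemma needlet_kernel_L1:
  assumes n: "CARD('n) = d + 1" "d \<ge> 2" and h: "needlet_filter \<kappa> h" and \<kappa>: "\<kappa> \<ge> d div 2 + 1"
  shows "\<exists>C>0. \<exists>L0. \<forall>L\<ge>L0. \<forall>x\<in>sphere (0 :: real ^ 'n) 1.
    (\<integral>z. \<bar>poly (needlet_kernel d \<kappa> h L) (x \<bullet> z)\<bar> \<partial>sphere_measure) \<le> C"
proof -
  define s where "s = d div 2 + 1"
  define e :: "real ^ 'n" where "e = axis undefined 1"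
  have e: "norm e = 1" by (simp add: e_def)
  define \<Lambda> where "\<Lambda> p = (\<integral>z. poly p (e \<bullet> z) \<partial>sphere_measure)" for p
  interpret ultraspherical_mean d \<Lambda>
    unfolding \<Lambda>_def by (rule ultraspherical_sphere_mean[OF n e])
  let ?k = "needlet_kernel d \<kappa> h"
  obtain C0 where C0: "C0 \<ge> 0" "\<And>L. L \<ge> 2 \<Longrightarrow> \<Lambda> ((?k L)\<^sup>2) \<le> C0 * real L ^ d"
    using kernel_energy[OF h, of 0] by auto
  obtain C1 where C1: "C1 \<ge> 0" "\<And>L. L \<ge> 2 * s + 2 \<Longrightarrow> \<Lambda> ([:1, -1:] ^ s * (?k L)\<^sup>2) \<le> C1 * real L ^ d / real L ^ (2 * s)"
    using kernel_energy[OF h, of s] \<kappa> unfolding s_def by auto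
  define B where "B = 8 ^ s * (2 * (2 ^ (d + 1) / measure lborel (ball (0 :: real ^ 'n) 1)))"
  have "B \<ge> 0" by (simp add: B_def)
  have bound: "(\<integral>z. \<bar>poly (?k L) (e \<bullet> z)\<bar> \<partial>sphere_measure) \<le> C0 + C1 + B" if L: "L \<ge> 2 * s + 2" for L
  proof -
    have Lpos: "real L > 0" using L by simp
    define W where "W t = 1 + ((real L)\<^sup>2 * (1 - t)) ^ s" for t
    define v where "v = poly (?k L)"
    have W1: "W (e \<bullet> z) \<ge> 1" if "z \<in> sphere 0 1" for z
      using inner_sphere_Icc[of e z] e that by (simp add: W_def)
    \<comment> \<open>The factor \<open>L^d\<close> balances the two terms: \<open>v^2 W\<close> has
      an integral of order \<open>L^d\<close>, and \<open>1 / W\<close> one of order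
      \<open>L^(-d)\<close>.\<close>
    have pw: "\<bar>v (e \<bullet> z)\<bar> \<le> (v (e \<bullet> z))\<^sup>2 * W (e \<bullet> z) / real L ^ d + real L ^ d * (1 / W (e \<bullet> z))"
      if "z \<in> sphere 0 1" for z
    proof -
      have "W (e \<bullet> z) > 0" using W1[OF that] by simp
      define a where "a = W (e \<bullet> z) / real L ^ d"
      have "a > 0" using \<open>W (e \<bullet> z) > 0\<close> Lpos by (simp add: a_def)
      have "0 \<le> (\<bar>v (e \<bullet> z)\<bar> * a - 1)\<^sup>2" by simp
      then have "2 * (\<bar>v (e \<bullet> z)\<bar> * a) \<le> (v (e \<bullet> z))\<^sup>2 * a\<^sup>2 + 1"
        by (simp add: power2_diff power_mult_distrib)
      moreover have "0 \<le> \<bar>v (e \<bullet> z)\<bar> * a" using \<open>a > 0\<close> by simp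
      ultimately have "\<bar>v (e \<bullet> z)\<bar> * a \<le> (v (e \<bullet> z))\<^sup>2 * a\<^sup>2 + 1" by linarith
      then have "\<bar>v (e \<bullet> z)\<bar> \<le> (v (e \<bullet> z))\<^sup>2 * a + 1 / a"
        using \<open>a > 0\<close> by (simp add: field_simps power2_eq_square)
      then show ?thesis by (simp add: a_def)
    qed
    have cont: "continuous_on (sphere 0 1) (\<lambda>z. v (e \<bullet> z))" "continuous_on (sphere 0 1) (\<lambda>z. W (e \<bullet> z))"
      unfolding v_def W_def by (intro continuous_intros)+
    have contW: "continuous_on (sphere 0 1) (\<lambda>z. 1 / W (e \<bullet> z))"
      using W1 by (intro continuous_intros cont) force
    have i1: "integrable sphere_measure (\<lambda>z. (v (e \<bullet> z))\<^sup>2 * W (e \<bullet> z) / real L ^ d)"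
      and i2: "integrable sphere_measure (\<lambda>z. real L ^ d * (1 / W (e \<bullet> z)))"
      and i3: "integrable sphere_measure (\<lambda>z. \<bar>v (e \<bullet> z)\<bar>)"
      using Lpos by (intro integrable_sphere_continuous continuous_intros cont contW; simp)+
    have "(v t)\<^sup>2 * W t = poly ((?k L)\<^sup>2 + smult ((real L) ^ (2 * s)) ([:1, -1:] ^ s * (?k L)\<^sup>2)) t" for t
    proof -
      have "((real L)\<^sup>2 * (1 - t)) ^ s = real L ^ (2 * s) * (1 - t) ^ s"
        by (simp only: power_mult_distrib power_mult)
      then show ?thesis by (simp add: v_def W_def distrib_left mult_ac)
    qed
    then have "(\<integral>z. (v (e \<bullet> z))\<^sup>2 * W (e \<bullet> z) \<partial>sphere_measure)
        = \<Lambda> ((?k L)\<^sup>2 + smult ((real L) ^ (2 * s)) ([:1, -1:] ^ s * (?k L)\<^sup>2))"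
      unfolding \<Lambda>_def by simp
    also have "\<dots> = \<Lambda> ((?k L)\<^sup>2) + (real L) ^ (2 * s) * \<Lambda> ([:1, -1:] ^ s * (?k L)\<^sup>2)"
      by (simp only: mean_add mean_smult)
    also have "\<dots> \<le> C0 * real L ^ d + (real L) ^ (2 * s) * (C1 * real L ^ d / real L ^ (2 * s))"
      using L by (intro add_mono mult_left_mono C0 C1) auto
    also have "\<dots> = (C0 + C1) * real L ^ d" using Lpos by (simp add: algebra_simps)
    finally have E: "(\<integral>z. (v (e \<bullet> z))\<^sup>2 * W (e \<bullet> z) \<partial>sphere_measure) \<le> (C0 + C1) * real L ^ d" .
    have Winv: "(\<integral>z. 1 / W (e \<bullet> z) \<partial>sphere_measure) \<le> B / real L ^ d"
      unfolding W_def B_def using n e L by (intro integral_cap_weight_le) (auto simp: s_def)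
    have "(\<integral>z. \<bar>v (e \<bullet> z)\<bar> \<partial>sphere_measure)
      \<le> (\<integral>z. ((v (e \<bullet> z))\<^sup>2 * W (e \<bullet> z) / real L ^ d + real L ^ d * (1 / W (e \<bullet> z))) \<partial>sphere_measure)"
      by (intro integral_mono i3 Bochner_Integration.integrable_add i1 i2 pw) simp
    also have "\<dots> = (\<integral>z. (v (e \<bullet> z))\<^sup>2 * W (e \<bullet> z) / real L ^ d \<partial>sphere_measure) + (\<integral>z. real L ^ d * (1 / W (e \<bullet> z)) \<partial>sphere_measure)"
      by (rule Bochner_Integration.integral_add[OF i1 i2])
    also have "\<dots> = (\<integral>z. (v (e \<bullet> z))\<^sup>2 * W (e \<bullet> z) \<partial>sphere_measure) / real L ^ d + real L ^ d * (\<integral>z. 1 / W (e \<bullet> z) \<partial>sphere_measure)"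
      by (simp only: integral_divide_zero integral_mult_right_zero)
    also have "\<dots> \<le> ((C0 + C1) * real L ^ d) / real L ^ d + real L ^ d * (B / real L ^ d)"
      using Lpos by (intro add_mono divide_right_mono mult_left_mono E Winv) auto
    also have "\<dots> = C0 + C1 + B" using Lpos by simp
    finally show ?thesis unfolding v_def .
  qed
  \<comment> \<open>By rotation invariance the norm is the same for every \<open>x\<close>; the
    summand 1 makes the constant positive.\<close>
  have "(\<integral>z. \<bar>poly (?k L) (x \<bullet> z)\<bar> \<partial>sphere_measure) \<le> C0 + C1 + B + 1"
    if "L \<ge> 2 * s + 2" "x \<in> sphere (0 :: real ^ 'n) 1" for L x
  proof -
    have "(\<integral>z. \<bar>poly (?k L) (x \<bullet> z)\<bar> \<partial>sphere_measure) = (\<integral>z. \<bar>poly (?k L) (e \<bullet> z)\<bar> \<partial>sphere_measure)"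
      using n e that by (intro integral_sphere_inner_unit[of x e "\<lambda>t. \<bar>poly (?k L) t\<bar>"] continuous_intros) auto
    then show ?thesis using bound[OF that(1)] by simp
  qed
  moreover have "C0 + C1 + B + 1 > 0" using C0(1) C1(1) \<open>B \<ge> 0\<close> by simp
  ultimately show ?thesis by blast
qed

section \<open>Convergence in \<open>L\<^sub>n\<close> of the sphere\<close>

definition zonal_conv :: "real poly \<Rightarrow> (real ^ 'n \<Rightarrow> real) \<Rightarrow> real ^ 'n \<Rightarrow> real" where
  "zonal_conv q f x = (\<integral>y. f y * poly q (x \<bullet> y) \<partial>sphere_measure)"

section \<open>Boundedness of zonal convolutions\<close>

lemma integrable_mult_zonal:
  fixes f :: "real ^ 'n \<Rightarrow> real"
  assumes "integrable sphere_measure f" "x \<in> sphere 0 1"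
  shows "integrable sphere_measure (\<lambda>y. f y * poly q (x \<bullet> y))"
proof -
  obtain B where B: "\<And>t. t \<in> {-1..1} \<Longrightarrow> \<bar>poly q t\<bar> \<le> B" using poly_bound_Icc by blast
  have "B \<ge> 0" by (rule order_trans[OF abs_ge_zero[of "poly q 0"] B]) simp
  have [measurable]: "f \<in> borel_measurable sphere_measure" using assms(1) by simp
  show ?thesis
  proof (rule Bochner_Integration.integrable_bound)
    show "integrable sphere_measure (\<lambda>y. B * f y)" using assms(1) by simp
    show "AE y in sphere_measure. norm (f y * poly q (x \<bullet> y)) \<le> norm (B * f y)"
    proof (rule AE_I2)
      fix y :: "real ^ 'n" assume "y \<in> space sphere_measure"
      then have "\<bar>poly q (x \<bullet> y)\<bar> \<le> B" using assms(2) by (intro B inner_sphere_Icc) auto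
      then show "norm (f y * poly q (x \<bullet> y)) \<le> norm (B * f y)"
        using \<open>B \<ge> 0\<close> by (simp add: abs_mult mult.commute[of B] mult_left_mono)
    qed
  qed measurable
qed

lemma power_sum_le: "(a + b) ^ n \<le> 2 ^ n * (a ^ n + b ^ n)" if "a \<ge> 0" "b \<ge> 0" for a b :: real
proof -
  have "(a + b) ^ n \<le> (2 * max a b) ^ n" using that by (intro power_mono) auto
  also have "\<dots> = 2 ^ n * max a b ^ n" by (simp add: power_mult_distrib)
  also have "max a b ^ n \<le> a ^ n + b ^ n" using that by (simp add: max_def)
  finally show ?thesis by simp
qed

lemma integrable_power_imp_integrable:
  fixes f :: "'a \<Rightarrow> real"
  assumes "finite_measure M" "f \<in> borel_measurable M" "integrable M (\<lambda>x. \<bar>f x\<bar> ^ n)" "m \<le> n"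
  shows "integrable M (\<lambda>x. \<bar>f x\<bar> ^ m)"
proof -
  interpret finite_measure M by fact
  have "a ^ m \<le> 1 + a ^ n" if "a \<ge> 0" for a :: real
  proof (cases "a \<le> 1")
    case True
    then have "a ^ m \<le> 1" using that by (simp add: power_le_one)
    then show ?thesis using that zero_le_power[OF that, of n] by linarith
  next
    case False
    then have "a ^ m \<le> a ^ n" using \<open>m \<le> n\<close> by (intro power_increasing) auto
    then show ?thesis by simp
  qed
  then show ?thesis
    using assms by (rule_tac Bochner_Integration.integrable_bound[of M "\<lambda>x. 1 + \<bar>f x\<bar> ^ n"]) auto
qed

text \<open>The tangent to the convex function \<open>a^n\<close> at \<open>c\<close>, obtained from
  Bernoulli's inequality for \<open>a / c\<close>.\<close>

lemma power_ge_tangent: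
  fixes a c :: real
  assumes "a \<ge> 0" "c \<ge> 0" "n \<ge> 1"
  shows "real n * c ^ (n - 1) * a - (real n - 1) * c ^ n \<le> a ^ n"
proof (cases "c = 0")
  case True
  then show ?thesis using assms by (cases n; cases "n - 1") auto
next
  case False
  then have c: "c > 0" using assms by simp
  have "1 + real n * (a / c - 1) \<le> (1 + (a / c - 1)) ^ n"
    using assms c by (intro Bernoulli_inequality) simp
  then have "c ^ n * (1 + real n * (a / c - 1)) \<le> c ^ n * (a / c) ^ n"
    using c by (intro mult_left_mono) auto
  also have "c ^ n * (a / c) ^ n = a ^ n" using c by (simp add: power_divide)
  also have "c ^ n * (1 + real n * (a / c - 1)) = real n * c ^ (n - 1) * a - (real n - 1) * c ^ n"
    using c assms(3) by (cases n) (simp_all add: field_simps)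
  finally show ?thesis .
qed

text \<open>Jensen's inequality for the measure with density \<open>|q|\<close>, whose mass is
  bounded by \<open>C\<close> but not normalised: the tangent inequality for the power is integrated
  against it.\<close>

lemma zonal_conv_jensen:
  fixes f :: "real ^ 'n \<Rightarrow> real"
  assumes f: "f \<in> borel_measurable sphere_measure" "integrable sphere_measure (\<lambda>y. \<bar>f y\<bar> ^ n)" and "n \<ge> 1"
    and x: "x \<in> sphere 0 1" and C: "C > 0" "(\<integral>y. \<bar>poly q (x \<bullet> y)\<bar> \<partial>sphere_measure) \<le> C"
  shows "\<bar>zonal_conv q f x\<bar> ^ n \<le> C ^ (n - 1) * (\<integral>y. \<bar>f y\<bar> ^ n * \<bar>poly q (x \<bullet> y)\<bar> \<partial>sphere_measure)"
proof -
  interpret prob_space "sphere_measure :: (real ^ 'n) measure" by (rule prob_space_sphere_measure)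
  let ?Q = "\<lambda>y. \<bar>poly q (x \<bullet> y)\<bar>"
  have iQ: "integrable sphere_measure ?Q"
    by (intro integrable_sphere_continuous continuous_intros)
  have "integrable sphere_measure (\<lambda>y. \<bar>f y\<bar> ^ 1)"
    using integrable_power_imp_integrable[OF finite_measure_axioms f \<open>n \<ge> 1\<close>] .
  then have fi: "integrable sphere_measure f" using f(1) by (simp add: integrable_abs_iff)
  have i1: "integrable sphere_measure (\<lambda>y. \<bar>f y\<bar> * ?Q y)"
    using integrable_abs[OF integrable_mult_zonal[OF fi x]] by (simp add: abs_mult)
  have in': "integrable sphere_measure (\<lambda>y. \<bar>f y\<bar> ^ n * ?Q y)"
    using integrable_abs[OF integrable_mult_zonal[OF f(2) x]] by (simp add: abs_mult)
  define F where "F = (\<integral>y. \<bar>f y\<bar> * ?Q y \<partial>sphere_measure)"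
  \<comment> \<open>The mean of \<open>|f|\<close> when the mass is replaced by its bound
    \<open>C\<close>. With this point of tangency \<open>c^n C = c^(n - 1) F\<close>, so the lower
    bound collapses to \<open>c^(n - 1) F\<close>.\<close>
  define c where "c = F / C"
  have "F \<ge> 0" unfolding F_def by (intro integral_nonneg_AE) auto
  then have "c \<ge> 0" using C by (simp add: c_def)
  have "real n * c ^ (n - 1) * F - (real n - 1) * c ^ n * C \<le> real n * c ^ (n - 1) * F - (real n - 1) * c ^ n * (\<integral>y. ?Q y \<partial>sphere_measure)"
    using C(2) \<open>c \<ge> 0\<close> \<open>n \<ge> 1\<close> by (intro diff_left_mono mult_left_mono) auto
  also have "\<dots> = (\<integral>y. real n * c ^ (n - 1) * (\<bar>f y\<bar> * ?Q y) - (real n - 1) * c ^ n * ?Q y \<partial>sphere_measure)"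
    unfolding F_def using i1 iQ by (subst Bochner_Integration.integral_diff) auto
  also have "\<dots> \<le> (\<integral>y. \<bar>f y\<bar> ^ n * ?Q y \<partial>sphere_measure)"
  proof (intro integral_mono Bochner_Integration.integrable_diff integrable_mult_right i1 iQ in')
    fix y
    have "(real n * c ^ (n - 1) * \<bar>f y\<bar> - (real n - 1) * c ^ n) * ?Q y \<le> \<bar>f y\<bar> ^ n * ?Q y"
      using \<open>c \<ge> 0\<close> \<open>n \<ge> 1\<close> by (intro mult_right_mono power_ge_tangent) auto
    then show "real n * c ^ (n - 1) * (\<bar>f y\<bar> * ?Q y) - (real n - 1) * c ^ n * ?Q y \<le> \<bar>f y\<bar> ^ n * ?Q y"
      by (simp add: algebra_simps)
  qed
  finally have *: "real n * c ^ (n - 1) * F - (real n - 1) * c ^ n * C \<le> (\<integral>y. \<bar>f y\<bar> ^ n * ?Q y \<partial>sphere_measure)" .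
  obtain k where k: "n = Suc k" using \<open>n \<ge> 1\<close> by (cases n) auto
  have cC: "c * C = F" using C by (simp add: c_def)
  have "real n * c ^ (n - 1) * F - (real n - 1) * c ^ n * C = c ^ k * F"
    unfolding k cC[symmetric] by (simp add: algebra_simps)
  with * have "c ^ k * F \<le> (\<integral>y. \<bar>f y\<bar> ^ n * ?Q y \<partial>sphere_measure)" by simp
  then have "C ^ k * (c ^ k * F) \<le> C ^ k * (\<integral>y. \<bar>f y\<bar> ^ n * ?Q y \<partial>sphere_measure)"
    using C by (intro mult_left_mono) auto
  moreover have "C ^ k * (c ^ k * F) = F ^ n"
    using C by (simp add: c_def k power_divide)
  moreover have "\<bar>zonal_conv q f x\<bar> ^ n \<le> F ^ n"
  proof (rule power_mono)
    have "\<bar>zonal_conv q f x\<bar> \<le> (\<integral>y. \<bar>f y * poly q (x \<bullet> y)\<bar> \<partial>sphere_measure)"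
      unfolding zonal_conv_def using integral_norm_bound[of sphere_measure "\<lambda>y. f y * poly q (x \<bullet> y)"] by simp
    then show "\<bar>zonal_conv q f x\<bar> \<le> F" by (simp add: F_def abs_mult)
  qed simp
  ultimately show ?thesis by (simp add: k)
qed

lemma measurable_zonal_conv [measurable]:
  fixes f :: "real ^ 'n \<Rightarrow> real"
  assumes [measurable]: "f \<in> borel_measurable sphere_measure"
  shows "zonal_conv q f \<in> borel_measurable sphere_measure"
proof -
  interpret prob_space "sphere_measure :: (real ^ 'n) measure" by (rule prob_space_sphere_measure)
  show ?thesis unfolding zonal_conv_def[abs_def] by measurable
qed

text \<open>A form of Young's inequality: after Jensen the integrals are exchanged, and by symmetry
  in \<open>x\<close> and \<open>y\<close> the kernel has mass at most \<open>C\<close> in the other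
  variable as well.\<close>

lemma zonal_conv_power_bound:
  fixes f :: "real ^ 'n \<Rightarrow> real"
  assumes f: "f \<in> borel_measurable sphere_measure" "integrable sphere_measure (\<lambda>y. \<bar>f y\<bar> ^ n)" and "n \<ge> 1"
    and C: "C > 0" "\<And>x. x \<in> sphere (0 :: real ^ 'n) 1 \<Longrightarrow> (\<integral>y. \<bar>poly q (x \<bullet> y)\<bar> \<partial>sphere_measure) \<le> C"
  shows "(\<integral>\<^sup>+x. ennreal (\<bar>zonal_conv q f x\<bar> ^ n) \<partial>sphere_measure) \<le> ennreal (C ^ n) * (\<integral>\<^sup>+y. ennreal (\<bar>f y\<bar> ^ n) \<partial>sphere_measure)"
proof -
  interpret S: prob_space "sphere_measure :: (real ^ 'n) measure" by (rule prob_space_sphere_measure)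
  interpret SS: pair_prob_space "sphere_measure :: (real ^ 'n) measure" "sphere_measure :: (real ^ 'n) measure" ..
  have [measurable]: "f \<in> borel_measurable sphere_measure" by fact
  let ?Q = "\<lambda>x y. \<bar>poly q (x \<bullet> y)\<bar>"
  have "(\<integral>\<^sup>+x. ennreal (\<bar>zonal_conv q f x\<bar> ^ n) \<partial>sphere_measure)
    \<le> (\<integral>\<^sup>+x. ennreal (C ^ (n - 1)) * (\<integral>\<^sup>+y. ennreal (\<bar>f y\<bar> ^ n * ?Q x y) \<partial>sphere_measure) \<partial>sphere_measure)"
  proof (rule nn_integral_mono)
    fix x :: "real ^ 'n" assume "x \<in> space sphere_measure"
    then have x: "x \<in> sphere 0 1" by simp
    have "integrable sphere_measure (\<lambda>y. \<bar>f y\<bar> ^ n * ?Q x y)"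
      using integrable_abs[OF integrable_mult_zonal[OF f(2) x]] by (simp add: abs_mult)
    then have "(\<integral>\<^sup>+y. ennreal (\<bar>f y\<bar> ^ n * ?Q x y) \<partial>sphere_measure) = ennreal (\<integral>y. \<bar>f y\<bar> ^ n * ?Q x y \<partial>sphere_measure)"
      by (intro nn_integral_eq_integral) auto
    then show "ennreal (\<bar>zonal_conv q f x\<bar> ^ n) \<le> ennreal (C ^ (n - 1)) * (\<integral>\<^sup>+y. ennreal (\<bar>f y\<bar> ^ n * ?Q x y) \<partial>sphere_measure)"
      using zonal_conv_jensen[OF f \<open>n \<ge> 1\<close> x C(1) C(2)[OF x]] C(1)
      by (simp add: ennreal_mult'[symmetric] ennreal_leI)
  qed
  also have "\<dots> = ennreal (C ^ (n - 1)) * (\<integral>\<^sup>+x. (\<integral>\<^sup>+y. ennreal (\<bar>f y\<bar> ^ n * ?Q x y) \<partial>sphere_measure) \<partial>sphere_measure)"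
    by (rule nn_integral_cmult) measurable
  also have "(\<integral>\<^sup>+x. (\<integral>\<^sup>+y. ennreal (\<bar>f y\<bar> ^ n * ?Q x y) \<partial>sphere_measure) \<partial>sphere_measure)
      = (\<integral>\<^sup>+y. (\<integral>\<^sup>+x. ennreal (\<bar>f y\<bar> ^ n * ?Q x y) \<partial>sphere_measure) \<partial>sphere_measure)"
    by (rule SS.Fubini') measurable
  also have "\<dots> \<le> (\<integral>\<^sup>+y. ennreal (\<bar>f y\<bar> ^ n) * ennreal C \<partial>sphere_measure)"
  proof (rule nn_integral_mono)
    fix y :: "real ^ 'n" assume "y \<in> space sphere_measure"
    then have y: "y \<in> sphere 0 1" by simp
    have "integrable sphere_measure (\<lambda>x. ?Q y x)"
      by (intro integrable_sphere_continuous continuous_intros)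
    then have "(\<integral>\<^sup>+x. ennreal (?Q y x) \<partial>sphere_measure) = ennreal (\<integral>x. ?Q y x \<partial>sphere_measure)"
      by (intro nn_integral_eq_integral) auto
    also have "\<dots> \<le> ennreal C" by (intro ennreal_leI C y)
    finally have "ennreal (\<bar>f y\<bar> ^ n) * (\<integral>\<^sup>+x. ennreal (?Q y x) \<partial>sphere_measure) \<le> ennreal (\<bar>f y\<bar> ^ n) * ennreal C"
      by (rule mult_left_mono) simp
    moreover have "(\<integral>\<^sup>+x. ennreal (\<bar>f y\<bar> ^ n * ?Q x y) \<partial>sphere_measure) = ennreal (\<bar>f y\<bar> ^ n) * (\<integral>\<^sup>+x. ennreal (?Q y x) \<partial>sphere_measure)"
      by (subst nn_integral_cmult[symmetric]) (auto simp: ennreal_mult' inner_commute)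
    ultimately show "(\<integral>\<^sup>+x. ennreal (\<bar>f y\<bar> ^ n * ?Q x y) \<partial>sphere_measure) \<le> ennreal (\<bar>f y\<bar> ^ n) * ennreal C"
      by simp
  qed
  also have "(\<integral>\<^sup>+y. ennreal (\<bar>f y\<bar> ^ n) * ennreal C \<partial>sphere_measure) = (\<integral>\<^sup>+y. ennreal (\<bar>f y\<bar> ^ n) \<partial>sphere_measure) * ennreal C"
    by (rule nn_integral_multc) measurable
  finally have "(\<integral>\<^sup>+x. ennreal (\<bar>zonal_conv q f x\<bar> ^ n) \<partial>sphere_measure) \<le>
    ennreal (C ^ (n - 1)) * ((\<integral>\<^sup>+y. ennreal (\<bar>f y\<bar> ^ n) \<partial>sphere_measure) * ennreal C)"
    by (simp add: mult_left_mono)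
  also have "\<dots> = ennreal (C ^ n) * (\<integral>\<^sup>+y. ennreal (\<bar>f y\<bar> ^ n) \<partial>sphere_measure)"
  proof -
    have "ennreal (C ^ n) = ennreal (C ^ (n - 1)) * ennreal C"
      using C(1) \<open>n \<ge> 1\<close> by (cases n) (simp_all add: ennreal_mult' mult.commute)
    then show ?thesis by (simp add: mult_ac)
  qed
  finally show ?thesis .
qed

text \<open>Funk-Hecke: \<open>P_m\<close> centred at \<open>z\<close> is an eigenfunction of the
  convolution with eigenvalue \<open>f m\<close>; the factor \<open>Z\<close> cancels against the
  convolution property.\<close>

lemma zonal_conv_zonal_sum_gegenbauer:
  fixes x z :: "real ^ 'n"
  assumes n: "CARD('n) = d + 1" "d \<ge> 2" and "x \<in> sphere 0 1" "z \<in> sphere 0 1" "m < K"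
  shows "zonal_conv (zonal_sum d K f) (\<lambda>y. gegenbauer d m (z \<bullet> y)) x = f m * gegenbauer d m (x \<bullet> z)"
proof -
  have e: "norm (axis undefined 1 :: real ^ 'n) = 1" by simp
  interpret ultraspherical_mean d "\<lambda>p. \<integral>z. poly p ((axis undefined 1 :: real ^ 'n) \<bullet> z) \<partial>sphere_measure"
    by (rule ultraspherical_sphere_mean[OF n e])
  have "zonal_conv (zonal_sum d K f) (\<lambda>y. gegenbauer d m (z \<bullet> y)) x
    = (\<integral>y. (\<Sum>l<K. f l * Z d l * (gegenbauer d l (x \<bullet> y) * gegenbauer d m (z \<bullet> y))) \<partial>sphere_measure)"
    unfolding zonal_conv_def poly_zonal_sum sum_distrib_left
    by (intro Bochner_Integration.integral_cong sum.cong refl) (simp only: mult_ac)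
  also have "\<dots> = (\<Sum>l<K. \<integral>y. f l * Z d l * (gegenbauer d l (x \<bullet> y) * gegenbauer d m (z \<bullet> y)) \<partial>sphere_measure)"
    unfolding poly_gegenbauer_poly[symmetric]
    by (intro Bochner_Integration.integral_sum integrable_sphere_continuous continuous_intros)
  also have "\<dots> = (\<Sum>l<K. f l * Z d l * (if l = m then gegenbauer d l (x \<bullet> z) / Z d l else 0))"
    using assms by (intro sum.cong refl) (simp add: gegenbauer_convolution[OF n])
  also have "\<dots> = (\<Sum>l<K. if l = m then f l * gegenbauer d l (x \<bullet> z) else 0)"
    using Z_pos by (intro sum.cong refl) (auto simp: less_le)
  also have "\<dots> = f m * gegenbauer d m (x \<bullet> z)" using \<open>m < K\<close> by simp
  finally show ?thesis .
qed

lemma zonal_conv_diff: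
  assumes "integrable sphere_measure f" "integrable sphere_measure g" "x \<in> sphere 0 1"
  shows "zonal_conv q (\<lambda>y. f y - g y) x = zonal_conv q f x - zonal_conv q g x"
  unfolding zonal_conv_def left_diff_distrib
  by (intro Bochner_Integration.integral_diff integrable_mult_zonal assms)

text \<open>The polynomial has a Gegenbauer expansion up to degree \<open>L\<close>, and on these
  degrees every eigenvalue of the kernel is 1.\<close>

lemma needlet_kernel_reproduces:
  fixes x z :: "real ^ 'n"
  assumes n: "CARD('n) = d + 1" "d \<ge> 2" and x: "x \<in> sphere 0 1" "z \<in> sphere 0 1" and p: "degree p \<le> L"
  shows "zonal_conv (needlet_kernel d \<kappa> h L) (\<lambda>y. poly p (z \<bullet> y)) x = poly p (x \<bullet> z)"
proof -
  obtain b where b: "p = (\<Sum>m\<le>L. smult (b m) (gegenbauer_poly d m))"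
    using gegenbauer_expansion[OF n(2) p] by blast
  have pb: "poly p t = (\<Sum>m\<le>L. b m * gegenbauer d m t)" for t
    unfolding b by (simp add: poly_sum poly_gegenbauer_poly)
  let ?k = "needlet_kernel d \<kappa> h L"
  have "zonal_conv ?k (\<lambda>y. poly p (z \<bullet> y)) x
    = (\<integral>y. (\<Sum>m\<le>L. b m * (gegenbauer d m (z \<bullet> y) * poly ?k (x \<bullet> y))) \<partial>sphere_measure)"
    unfolding zonal_conv_def pb sum_distrib_right by (simp only: mult.assoc)
  also have "\<dots> = (\<Sum>m\<le>L. \<integral>y. b m * (gegenbauer d m (z \<bullet> y) * poly ?k (x \<bullet> y)) \<partial>sphere_measure)"
    unfolding poly_gegenbauer_poly[symmetric]
    by (intro Bochner_Integration.integral_sum integrable_sphere_continuous continuous_intros)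
  also have "\<dots> = (\<Sum>m\<le>L. b m * zonal_conv ?k (\<lambda>y. gegenbauer d m (z \<bullet> y)) x)"
    by (simp add: zonal_conv_def)
  also have "\<dots> = (\<Sum>m\<le>L. b m * gegenbauer d m (x \<bullet> z))"
    unfolding needlet_kernel_def
    by (intro sum.cong refl) (simp add: zonal_conv_zonal_sum_gegenbauer[OF n x] profile_def)
  finally show ?thesis unfolding pb .
qed

section \<open>Density of continuous functions\<close>

lemma sets_sphere_borel: "A \<in> sets (sphere_measure :: (real ^ 'n) measure) \<Longrightarrow> A \<in> sets borel"
  by (auto simp: sets_sphere_measure sets_restrict_space)

lemma sets_sphere_closed: "closed K \<Longrightarrow> K \<subseteq> sphere 0 1 \<Longrightarrow> K \<in> sets sphere_measure" for K :: "(real ^ 'n) set"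
  by (auto simp: sets_sphere_measure sets_restrict_space image_iff intro!: bexI[of _ K])

text \<open>Inner regularity replaces \<open>A\<close> by a compact subset \<open>K\<close>, whose
  indicator is the pointwise limit of the continuous functions
  \<open>max 0 (1 - m * infdist z K)\<close>.\<close>

lemma sphere_indicator_approx:
  fixes A :: "(real ^ 'n) set"
  assumes A: "A \<in> sets sphere_measure" and "\<epsilon> > 0"
  shows "\<exists>g. continuous_on (sphere 0 1) g \<and> (\<integral>z. \<bar>indicat_real A z - g z\<bar> \<partial>sphere_measure) < \<epsilon>"
proof -
  interpret prob_space "sphere_measure :: (real ^ 'n) measure" by (rule prob_space_sphere_measure)
  let ?D = "distr sphere_measure borel (\<lambda>z :: real ^ 'n. z)"
  have A': "A \<in> sets borel" using A by (rule sets_sphere_borel)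
  have AS: "A \<subseteq> sphere 0 1" using sets.sets_into_space[OF A] by simp
  have D: "emeasure ?D B = emeasure sphere_measure (B \<inter> sphere 0 1)" if "B \<in> sets borel" for B
    using that by (subst emeasure_distr) (auto simp: vimage_def Int_def)
  have "emeasure ?D (space ?D) \<noteq> \<infinity>" by (simp add: D)
  then have SUP: "emeasure ?D A = (SUP K \<in> {K. K \<subseteq> A \<and> compact K}. emeasure ?D K)"
    by (intro inner_regular A') auto
  have "{} \<in> {K. K \<subseteq> A \<and> compact K}" by simp
  then have "\<exists>K\<in>{K. K \<subseteq> A \<and> compact K}. emeasure ?D A < emeasure ?D K + ennreal (\<epsilon> / 2)"
    using \<open>\<epsilon> > 0\<close> by (intro SUP_approx_ennreal[OF _ _ SUP]) (auto simp: D[OF A'])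
  then obtain K where K: "K \<subseteq> A" "compact K" "emeasure ?D A < emeasure ?D K + ennreal (\<epsilon> / 2)"
    by blast
  have KS: "K \<subseteq> sphere 0 1" using K AS by blast
  have Ks: "K \<in> sets sphere_measure" using K KS by (intro sets_sphere_closed compact_imp_closed)
  have "emeasure sphere_measure A < emeasure sphere_measure K + ennreal (\<epsilon> / 2)"
    using K(3) KS AS compact_imp_closed[OF K(2)] A' by (simp add: D Int_absorb2)
  then have AK: "measure sphere_measure A < measure sphere_measure K + \<epsilon> / 2"
    using \<open>\<epsilon> > 0\<close> by (simp add: emeasure_eq_measure ennreal_plus[symmetric] ennreal_less_iff del: ennreal_plus)
  \<comment> \<open>The empty set is treated apart because \<open>infdist\<close> to it is 0, which
    would make \<open>g\<close> equal to 1.\<close>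
  define g where "g m z = (if K = {} then 0 else max 0 (1 - real m * infdist z K))" for m z
  have gc: "continuous_on (sphere 0 1) (g m)" for m
    unfolding g_def by (cases "K = {}") (auto intro!: continuous_intros)
  have [measurable]: "g m \<in> borel_measurable sphere_measure" "indicat_real K \<in> borel_measurable sphere_measure" for m
    using gc Ks by (auto intro: measurable_sphere_continuous)
  have lim: "(\<lambda>m. g m z) \<longlonglongrightarrow> indicat_real K z" for z
  proof (cases "z \<in> K")
    case True
    then have "g m z = 1" for m by (auto simp: g_def)
    then show ?thesis using True by simp
  next
    case False
    show ?thesis
    proof (cases "K = {}")
      case True
      then show ?thesis by (simp add: g_def[abs_def])
    next
      case nonempty: False
      then have pos: "infdist z K > 0"
        using False K(2) by (metis compact_imp_closed in_closed_iff_infdist_zero infdist_nonneg less_le)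
      obtain N where N: "real N > 1 / infdist z K" using reals_Archimedean2 by blast
      have "g m z = 0" if "m \<ge> N" for m
      proof -
        have "1 / infdist z K < real m" using N that by linarith
        then have "1 < real m * infdist z K" using pos by (simp add: field_simps)
        then show ?thesis by (simp add: g_def)
      qed
      then have "\<forall>\<^sub>F m in sequentially. g m z = 0" by (auto simp: eventually_sequentially)
      then show ?thesis using False by (simp add: tendsto_eventually)
    qed
  qed
  have "(\<lambda>m. \<integral>z. \<bar>indicat_real K z - g m z\<bar> \<partial>sphere_measure) \<longlonglongrightarrow> (\<integral>z. 0 \<partial>(sphere_measure :: (real ^ 'n) measure))"
  proof (rule integral_dominated_convergence[where w = "\<lambda>_. 1"])
    show "AE z in sphere_measure. (\<lambda>m. \<bar>indicat_real K z - g m z\<bar>) \<longlonglongrightarrow> 0"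
    proof (rule AE_I2)
      fix z
      have "(\<lambda>m. indicat_real K z - g m z) \<longlonglongrightarrow> indicat_real K z - indicat_real K z"
        by (intro tendsto_diff tendsto_const lim)
      then show "(\<lambda>m. \<bar>indicat_real K z - g m z\<bar>) \<longlonglongrightarrow> 0" by (simp add: tendsto_rabs_zero)
    qed
    show "AE z in sphere_measure. norm \<bar>indicat_real K z - g m z\<bar> \<le> 1" for m
      by (intro AE_I2) (auto simp: g_def indicator_def max_def infdist_nonneg)
  qed auto
  then have "\<forall>\<^sub>F m in sequentially. (\<integral>z. \<bar>indicat_real K z - g m z\<bar> \<partial>sphere_measure) < \<epsilon> / 2"
    using \<open>\<epsilon> > 0\<close> by (intro order_tendstoD(2)[where y = 0]) auto
  then obtain m where m: "(\<integral>z. \<bar>indicat_real K z - g m z\<bar> \<partial>sphere_measure) < \<epsilon> / 2"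
    by (auto simp: eventually_sequentially)
  have iK: "integrable sphere_measure (indicat_real K)" and iA: "integrable sphere_measure (indicat_real A)"
    using Ks A by (auto intro!: integrable_real_indicator simp: less_top[symmetric])
  have ig: "integrable sphere_measure (g m)" by (intro integrable_sphere_continuous gc)
  have "(\<integral>z. \<bar>indicat_real A z - g m z\<bar> \<partial>sphere_measure)
      \<le> (\<integral>z. (indicat_real A z - indicat_real K z) + \<bar>indicat_real K z - g m z\<bar> \<partial>sphere_measure)"
    using K(1) by (intro integral_mono integrable_abs Bochner_Integration.integrable_add Bochner_Integration.integrable_diff iA iK ig)
      (auto simp: indicator_def)
  also have "\<dots> = (measure sphere_measure A - measure sphere_measure K) + (\<integral>z. \<bar>indicat_real K z - g m z\<bar> \<partial>sphere_measure)"
    using iA iK ig AS KS by (simp add: Int_absorb2)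
  also have "\<dots> < \<epsilon>" using AK m by linarith
  finally show ?thesis using gc by blast
qed

text \<open>Induction over integrable functions: multiples of indicators, sums, and pointwise limits
  dominated by \<open>2 |f|\<close>.\<close>

lemma sphere_integrable_approx:
  fixes f :: "real ^ 'n \<Rightarrow> real"
  assumes "integrable sphere_measure f"
  shows "\<forall>\<epsilon>>0. \<exists>g. continuous_on (sphere 0 1) g \<and> (\<integral>z. \<bar>f z - g z\<bar> \<partial>sphere_measure) < \<epsilon>"
  using assms
proof (induction rule: integrable_induct)
  case (base A c)
  show ?case
  proof (intro allI impI)
    fix \<epsilon> :: real assume "\<epsilon> > 0"
    \<comment> \<open>The summand 1 covers \<open>c = 0\<close> and makes the final inequality
      strict.\<close>
    define \<delta> where "\<delta> = \<epsilon> / (\<bar>c\<bar> + 1)"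
    have "\<delta> > 0" using \<open>\<epsilon> > 0\<close> by (simp add: \<delta>_def add_nonneg_pos)
    then obtain g where g: "continuous_on (sphere 0 1) g" "(\<integral>z. \<bar>indicat_real A z - g z\<bar> \<partial>sphere_measure) < \<delta>"
      using sphere_indicator_approx[OF base(1)] by blast
    have "(\<integral>z. \<bar>indicat_real A z *\<^sub>R c - g z * c\<bar> \<partial>sphere_measure) = (\<integral>z. \<bar>indicat_real A z - g z\<bar> * \<bar>c\<bar> \<partial>sphere_measure)"
      by (intro Bochner_Integration.integral_cong refl) (simp add: abs_mult[symmetric] left_diff_distrib)
    also have "\<dots> = (\<integral>z. \<bar>indicat_real A z - g z\<bar> \<partial>sphere_measure) * \<bar>c\<bar>" by simp
    also have "\<dots> \<le> \<delta> * \<bar>c\<bar>" using g(2) by (intro mult_right_mono) auto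
    also have "\<dots> < \<epsilon>" using \<open>\<epsilon> > 0\<close> by (simp add: \<delta>_def divide_less_eq add_nonneg_pos)
    finally show "\<exists>g. continuous_on (sphere 0 1) g \<and> (\<integral>z. \<bar>indicat_real A z *\<^sub>R c - g z\<bar> \<partial>sphere_measure) < \<epsilon>"
      using g(1) by (intro exI[of _ "\<lambda>z. g z * c"]) (auto intro!: continuous_intros)
  qed
next
  case (add f g)
  show ?case
  proof (intro allI impI)
    fix \<epsilon> :: real assume "\<epsilon> > 0"
    then have half: "\<epsilon> / 2 > 0" by simp
    obtain u where u: "continuous_on (sphere 0 1) u" "(\<integral>z. \<bar>f z - u z\<bar> \<partial>sphere_measure) < \<epsilon> / 2"
      using add.IH(1) half by blast
    obtain v where v: "continuous_on (sphere 0 1) v" "(\<integral>z. \<bar>g z - v z\<bar> \<partial>sphere_measure) < \<epsilon> / 2"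
      using add.IH(2) half by blast
    note int = add.hyps integrable_sphere_continuous[OF u(1)] integrable_sphere_continuous[OF v(1)]
    have "(\<integral>z. \<bar>(f z + g z) - (u z + v z)\<bar> \<partial>sphere_measure) \<le> (\<integral>z. \<bar>f z - u z\<bar> + \<bar>g z - v z\<bar> \<partial>sphere_measure)"
      using int by (intro integral_mono) auto
    also have "\<dots> = (\<integral>z. \<bar>f z - u z\<bar> \<partial>sphere_measure) + (\<integral>z. \<bar>g z - v z\<bar> \<partial>sphere_measure)"
      using int by (intro Bochner_Integration.integral_add) auto
    finally show "\<exists>h. continuous_on (sphere 0 1) h \<and> (\<integral>z. \<bar>(f z + g z) - h z\<bar> \<partial>sphere_measure) < \<epsilon>"
      using u v by (intro exI[of _ "\<lambda>z. u z + v z"]) (auto intro!: continuous_intros)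
  qed
next
  case (lim f s)
  show ?case
  proof (intro allI impI)
    fix \<epsilon> :: real assume "\<epsilon> > 0"
    have meas [measurable]: "f \<in> borel_measurable sphere_measure" "s i \<in> borel_measurable sphere_measure" for i
      using lim.hyps by auto
    have "(\<lambda>i. \<integral>z. \<bar>f z - s i z\<bar> \<partial>sphere_measure) \<longlonglongrightarrow> (\<integral>z. 0 \<partial>(sphere_measure :: (real ^ 'n) measure))"
    proof (rule integral_dominated_convergence[where w = "\<lambda>z. 3 * \<bar>f z\<bar>"])
      show "AE z in sphere_measure. (\<lambda>i. \<bar>f z - s i z\<bar>) \<longlonglongrightarrow> 0"
      proof (rule AE_I2)
        fix z :: "real ^ 'n" assume "z \<in> space sphere_measure"
        then have "(\<lambda>i. f z - s i z) \<longlonglongrightarrow> f z - f z" by (intro tendsto_diff tendsto_const lim.hyps)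
        then show "(\<lambda>i. \<bar>f z - s i z\<bar>) \<longlonglongrightarrow> 0" by (simp add: tendsto_rabs_zero)
      qed
      show "AE z in sphere_measure. norm \<bar>f z - s i z\<bar> \<le> 3 * \<bar>f z\<bar>" for i
      proof (rule AE_I2)
        fix z :: "real ^ 'n" assume "z \<in> space sphere_measure"
        then have "\<bar>s i z\<bar> \<le> 2 * \<bar>f z\<bar>" using lim.hyps(3)[of z i] by simp
        then show "norm \<bar>f z - s i z\<bar> \<le> 3 * \<bar>f z\<bar>" by simp
      qed
    qed (use lim.hyps in auto)
    then have "\<forall>\<^sub>F i in sequentially. (\<integral>z. \<bar>f z - s i z\<bar> \<partial>sphere_measure) < \<epsilon> / 2"
      using \<open>\<epsilon> > 0\<close> by (intro order_tendstoD(2)[where y = 0]) auto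
    then obtain i where i: "(\<integral>z. \<bar>f z - s i z\<bar> \<partial>sphere_measure) < \<epsilon> / 2"
      by (auto simp: eventually_sequentially)
    obtain g where g: "continuous_on (sphere 0 1) g" "(\<integral>z. \<bar>s i z - g z\<bar> \<partial>sphere_measure) < \<epsilon> / 2"
      using lim.IH[of i] half_gt_zero[OF \<open>\<epsilon> > 0\<close>] by blast
    note int = lim.hyps(1)[of i] lim.hyps(4) integrable_sphere_continuous[OF g(1)]
    have "(\<integral>z. \<bar>f z - g z\<bar> \<partial>sphere_measure) \<le> (\<integral>z. \<bar>f z - s i z\<bar> + \<bar>s i z - g z\<bar> \<partial>sphere_measure)"
      using int by (intro integral_mono) auto
    also have "\<dots> = (\<integral>z. \<bar>f z - s i z\<bar> \<partial>sphere_measure) + (\<integral>z. \<bar>s i z - g z\<bar> \<partial>sphere_measure)"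
      using int by (intro Bochner_Integration.integral_add) auto
    finally show "\<exists>g. continuous_on (sphere 0 1) g \<and> (\<integral>z. \<bar>f z - g z\<bar> \<partial>sphere_measure) < \<epsilon>"
      using g i by (intro exI[of _ g]) auto
  qed
qed

text \<open>Truncation at height \<open>m\<close> reduces to bounded functions, for which
  approximation in \<open>L_1\<close> is enough: values bounded by \<open>m\<close> satisfy
  \<open>|a - b|^n \<le> (2 m)^(n - 1) |a - b|\<close>.\<close>

lemma sphere_power_approx:
  fixes f :: "real ^ 'n \<Rightarrow> real"
  assumes f [measurable]: "f \<in> borel_measurable sphere_measure" and fn: "integrable sphere_measure (\<lambda>y. \<bar>f y\<bar> ^ n)"
    and "n \<ge> 1" "\<epsilon> > 0"
  shows "\<exists>g. continuous_on (sphere 0 1) g \<and> integrable sphere_measure (\<lambda>z. \<bar>f z - g z\<bar> ^ n)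
    \<and> (\<integral>z. \<bar>f z - g z\<bar> ^ n \<partial>sphere_measure) < \<epsilon>"
proof -
  interpret prob_space "sphere_measure :: (real ^ 'n) measure" by (rule prob_space_sphere_measure)
  define clip where "clip m t = max (- real m) (min (real m) t)" for m :: nat and t
  have clip_m [measurable]: "clip m \<in> borel_measurable borel" for m
    unfolding clip_def[abs_def] by measurable
  have clip_abs: "\<bar>clip m t\<bar> \<le> real m" for m t by (auto simp: clip_def)
  have clip_lip: "\<bar>clip m a - clip m b\<bar> \<le> \<bar>a - b\<bar>" for m a b by (auto simp: clip_def)
  have clip_id: "clip m t = t" if "\<bar>t\<bar> \<le> real m" for m t using that by (auto simp: clip_def)
  have clip_le: "\<bar>t - clip m t\<bar> \<le> \<bar>t\<bar>" for m t by (auto simp: clip_def)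
  have "(\<lambda>m. \<integral>z. \<bar>f z - clip m (f z)\<bar> ^ n \<partial>sphere_measure) \<longlonglongrightarrow> (\<integral>z. 0 \<partial>(sphere_measure :: (real ^ 'n) measure))"
  proof (rule integral_dominated_convergence[where w = "\<lambda>z. \<bar>f z\<bar> ^ n"])
    show "AE z in sphere_measure. (\<lambda>m. \<bar>f z - clip m (f z)\<bar> ^ n) \<longlonglongrightarrow> 0"
    proof (rule AE_I2)
      fix z
      obtain N where N: "\<bar>f z\<bar> \<le> real N" using real_arch_simple by blast
      then have "\<bar>f z - clip m (f z)\<bar> ^ n = 0" if "m \<ge> N" for m
        using clip_id[of "f z" m] that \<open>n \<ge> 1\<close> by simp
      then show "(\<lambda>m. \<bar>f z - clip m (f z)\<bar> ^ n) \<longlonglongrightarrow> 0"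
        by (intro tendsto_eventually) (auto simp: eventually_sequentially)
    qed
    show "AE z in sphere_measure. norm (\<bar>f z - clip m (f z)\<bar> ^ n) \<le> \<bar>f z\<bar> ^ n" for m
      by (intro AE_I2) (simp add: power_mono clip_le)
  qed (use fn in auto)
  moreover have "\<epsilon> / (2 * 2 ^ n) > 0" using \<open>\<epsilon> > 0\<close> by simp
  ultimately have "\<forall>\<^sub>F m in sequentially. (\<integral>z. \<bar>f z - clip m (f z)\<bar> ^ n \<partial>sphere_measure) < \<epsilon> / (2 * 2 ^ n)"
    by (intro order_tendstoD(2)[where y = 0]) auto
  then obtain m0 where m0: "\<And>m. m \<ge> m0 \<Longrightarrow> (\<integral>z. \<bar>f z - clip m (f z)\<bar> ^ n \<partial>sphere_measure) < \<epsilon> / (2 * 2 ^ n)"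
    by (auto simp: eventually_sequentially)
  define m where "m = Suc m0"
  let ?B = "(2 * real m) ^ (n - 1)"
  have "?B > 0" by (simp add: m_def)
  have i1: "integrable sphere_measure (\<lambda>z. clip m (f z))"
    using clip_abs by (intro integrable_const_bound[of _ "real m"]) auto
  have "\<epsilon> / (2 * 2 ^ n * ?B) > 0" using \<open>\<epsilon> > 0\<close> \<open>?B > 0\<close> by simp
  then obtain g where g: "continuous_on (sphere 0 1) g" "(\<integral>z. \<bar>clip m (f z) - g z\<bar> \<partial>sphere_measure) < \<epsilon> / (2 * 2 ^ n * ?B)"
    using sphere_integrable_approx[OF i1] by blast
  \<comment> \<open>Clipping \<open>g\<close> as well bounds it by \<open>m\<close>; as
    \<open>clip\<close> is 1-Lipschitz and fixes \<open>clip m (f z)\<close>, the distance does not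
    grow.\<close>
  define u where "u z = clip m (g z)" for z
  have u: "continuous_on (sphere 0 1) u"
    unfolding u_def clip_def by (intro continuous_intros g(1))
  have [measurable]: "g \<in> borel_measurable sphere_measure" "u \<in> borel_measurable sphere_measure"
    using g(1) u by (auto intro: measurable_sphere_continuous)
  have i2: "integrable sphere_measure (\<lambda>z. \<bar>clip m (f z) - g z\<bar>)"
    using i1 integrable_sphere_continuous[OF g(1)] by auto
  have i3: "integrable sphere_measure (\<lambda>z. \<bar>f z - clip m (f z)\<bar> ^ n)"
    by (rule Bochner_Integration.integrable_bound[OF fn]) (auto simp: power_mono clip_le)
  have pw: "\<bar>f z - u z\<bar> ^ n \<le> 2 ^ n * (\<bar>f z - clip m (f z)\<bar> ^ n + ?B * \<bar>clip m (f z) - g z\<bar>)" for z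
  proof -
    have "\<bar>f z - u z\<bar> ^ n \<le> (\<bar>f z - clip m (f z)\<bar> + \<bar>clip m (f z) - u z\<bar>) ^ n"
      by (intro power_mono) auto
    also have "\<dots> \<le> 2 ^ n * (\<bar>f z - clip m (f z)\<bar> ^ n + \<bar>clip m (f z) - u z\<bar> ^ n)"
      by (intro power_sum_le) auto
    also have "\<bar>clip m (f z) - u z\<bar> ^ n = \<bar>clip m (f z) - u z\<bar> ^ (n - 1) * \<bar>clip m (f z) - u z\<bar>"
      using \<open>n \<ge> 1\<close> by (cases n) auto
    also have "\<dots> \<le> ?B * \<bar>clip m (f z) - g z\<bar>"
    proof (intro mult_mono power_mono)
      show "\<bar>clip m (f z) - u z\<bar> \<le> 2 * real m"
        using clip_abs[of m "f z"] clip_abs[of m "g z"] by (simp add: u_def)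
      show "\<bar>clip m (f z) - u z\<bar> \<le> \<bar>clip m (f z) - g z\<bar>"
        using clip_lip[of m "clip m (f z)" "g z"] clip_id[OF clip_abs, of m "f z"] by (simp add: u_def)
    qed auto
    finally show ?thesis by simp
  qed
  have i4: "integrable sphere_measure (\<lambda>z. 2 ^ n * (\<bar>f z - clip m (f z)\<bar> ^ n + ?B * \<bar>clip m (f z) - g z\<bar>))"
    using i2 i3 by auto
  have i5: "integrable sphere_measure (\<lambda>z. \<bar>f z - u z\<bar> ^ n)"
    by (rule Bochner_Integration.integrable_bound[OF i4]) (auto intro!: AE_I2 order.trans[OF pw])
  have "(\<integral>z. \<bar>f z - u z\<bar> ^ n \<partial>sphere_measure) \<le> (\<integral>z. 2 ^ n * (\<bar>f z - clip m (f z)\<bar> ^ n + ?B * \<bar>clip m (f z) - g z\<bar>) \<partial>sphere_measure)"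
    by (intro integral_mono i4 i5 pw)
  also have "\<dots> = 2 ^ n * ((\<integral>z. \<bar>f z - clip m (f z)\<bar> ^ n \<partial>sphere_measure) + ?B * (\<integral>z. \<bar>clip m (f z) - g z\<bar> \<partial>sphere_measure))"
    using i2 i3 by simp
  also have "\<dots> < 2 ^ n * (\<epsilon> / (2 * 2 ^ n) + ?B * (\<epsilon> / (2 * 2 ^ n * ?B)))"
    using m0[of m] g(2) \<open>?B > 0\<close> by (intro mult_strict_left_mono add_strict_mono) (auto simp: m_def)
  also have "\<dots> = \<epsilon>"
  proof -
    have "2 ^ n * (\<epsilon> / (2 * 2 ^ n) + b * (\<epsilon> / (2 * 2 ^ n * b))) = \<epsilon>" if "b > 0" for b
      using that by (simp add: field_simps)
    from this[OF \<open>?B > 0\<close>] show ?thesis .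
  qed
  finally show ?thesis using u i5 by blast
qed

section \<open>Uniform approximation by spherical polynomials\<close>

text \<open>Powers of \<open>(1 + t) / 2\<close>, which peak at \<open>t = 1\<close>; the factor is
  the reciprocal of the corresponding Beta moment and normalises the mean to 1.\<close>

definition approx_identity :: "nat \<Rightarrow> nat \<Rightarrow> real poly" where
  "approx_identity d k = smult (pochhammer (real d) k / pochhammer (real d / 2) k) ([:1/2, 1/2:] ^ k)"

lemma degree_approx_identity: "degree (approx_identity d k) \<le> k"
  unfolding approx_identity_def
  by (intro order.trans[OF degree_smult_le]) (use degree_half_powers[of 0 k] in simp)

lemma approx_identity_nonneg: "d \<ge> 1 \<Longrightarrow> t \<in> {-1..1} \<Longrightarrow> poly (approx_identity d k) t \<ge> 0"
  by (auto simp: approx_identity_def intro!: mult_nonneg_nonneg divide_nonneg_nonneg pochhammer_nonneg zero_le_power)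

text \<open>The second mean expresses concentration: \<open>1 - t\<close> is half the squared
  distance of the two points, and its mean is of order \<open>1 / k\<close>.\<close>

lemma (in ultraspherical_mean) mean_approx_identity:
  "\<Lambda> (approx_identity d k) = 1" "\<Lambda> ([:1, -1:] * approx_identity d k) = real d / (real d + real k)"
proof -
  have pos: "pochhammer (real d / 2) k > 0" "pochhammer (real d) k > 0"
    using dim by (auto intro!: pochhammer_pos)
  show "\<Lambda> (approx_identity d k) = 1"
    using mean_half_powers[of 0 k] pos by (simp add: approx_identity_def mean_smult)
  have "[:1, -1:] * approx_identity d k = smult (2 * (pochhammer (real d) k / pochhammer (real d / 2) k)) ([:1/2, - (1/2):] ^ 1 * [:1/2, 1/2:] ^ k)"
  proof -
    have "[:1, -1:] = smult 2 [:1/2, - (1/2) :: real:]" by simp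
    then show ?thesis unfolding approx_identity_def
      by (simp only: mult_smult_left mult_smult_right smult_smult power_one_right mult.commute)
  qed
  then have "\<Lambda> ([:1, -1:] * approx_identity d k) =
    2 * (pochhammer (real d) k / pochhammer (real d / 2) k) * (pochhammer (real d / 2) 1 * pochhammer (real d / 2) k / pochhammer (real d) (1 + k))"
    by (simp only: mean_smult mean_half_powers)
  also have "\<dots> = real d / (real d + real k)"
    using pos dim by (simp add: pochhammer_Suc)
  finally show "\<Lambda> ([:1, -1:] * approx_identity d k) = real d / (real d + real k)" .
qed

text \<open>Korovkin's argument: \<open>|g z - g x|\<close> is at most \<open>\<epsilon> / 2\<close>
  plus a multiple of \<open>1 - x \<bullet> z\<close>, by uniform continuity near \<open>x\<close>
  and boundedness elsewhere; the kernel is nonnegative with mean 1 and gives \<open>1 - t\<close> a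
  small mean.\<close>

lemma zonal_conv_approx_identity:
  fixes g :: "real ^ 'n \<Rightarrow> real"
  assumes n: "CARD('n) = d + 1" "d \<ge> 2" and g: "continuous_on (sphere 0 1) g" and "\<epsilon> > 0"
  shows "\<exists>k. \<forall>x\<in>sphere 0 1. \<bar>zonal_conv (approx_identity d k) g x - g x\<bar> < \<epsilon>"
proof -
  have "uniformly_continuous_on (sphere 0 1) g"
    by (intro compact_uniformly_continuous g compact_sphere)
  then obtain \<delta> where \<delta>: "\<delta> > 0" "\<And>x z. x \<in> sphere 0 1 \<Longrightarrow> z \<in> sphere 0 1 \<Longrightarrow> dist z x < \<delta> \<Longrightarrow> dist (g z) (g x) < \<epsilon> / 2"
    unfolding uniformly_continuous_on_def using \<open>\<epsilon> > 0\<close> by (metis half_gt_zero)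
  have "bounded (g ` sphere 0 1)"
    by (intro compact_imp_bounded compact_continuous_image g compact_sphere)
  then obtain B where B: "\<And>z. z \<in> sphere 0 1 \<Longrightarrow> \<bar>g z\<bar> \<le> B"
    unfolding bounded_iff real_norm_def by blast
  have "axis undefined 1 \<in> sphere (0 :: real ^ 'n) 1" by simp
  from B[OF this] have "B \<ge> 0" by linarith
  \<comment> \<open>At distance at least \<delta> one has
    \<open>1 - x \<bullet> z \<ge> \<delta>^2 / 2\<close>, so \<open>D (1 - x \<bullet> z)\<close>
    reaches \<open>2 B\<close>, a bound for the oscillation of \<open>g\<close>.\<close>
  define D where "D = 4 * B / \<delta>\<^sup>2"
  have "D \<ge> 0" using \<open>B \<ge> 0\<close> by (simp add: D_def)
  obtain k :: nat where k: "real k > 2 * D * real d / \<epsilon>" using reals_Archimedean2 by blast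
  let ?q = "approx_identity d k"
  have "\<bar>zonal_conv ?q g x - g x\<bar> < \<epsilon>" if x: "x \<in> sphere 0 1" for x
  proof -
    have nx: "norm x = 1" using x by simp
    interpret ultraspherical_mean d "\<lambda>p. \<integral>z. poly p (x \<bullet> z) \<partial>sphere_measure"
      by (rule ultraspherical_sphere_mean[OF n nx])
    have q0: "poly ?q (x \<bullet> z) \<ge> 0" if "z \<in> sphere 0 1" for z
      using n by (intro approx_identity_nonneg inner_sphere_Icc x that) auto
    have pw: "\<bar>g z - g x\<bar> \<le> \<epsilon> / 2 + D * (1 - x \<bullet> z)" if z: "z \<in> sphere 0 1" for z
    proof (cases "dist z x < \<delta>")
      case True
      have "1 - x \<bullet> z \<ge> 0" using inner_sphere_Icc[OF x z] by simp
      then show ?thesis using \<delta>(2)[OF x z True] \<open>D \<ge> 0\<close> by (simp add: dist_real_def add_increasing2)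
    next
      case False
      have "x \<bullet> x = 1" "z \<bullet> z = 1" using x z by (simp_all add: dot_square_norm)
      then have "(dist z x)\<^sup>2 = 2 * (1 - x \<bullet> z)"
        by (simp add: dist_norm power2_norm_eq_inner inner_diff_left inner_diff_right inner_commute)
      moreover have "\<delta>\<^sup>2 \<le> (dist z x)\<^sup>2" using False \<delta>(1) by (intro power_mono) auto
      ultimately have "2 * B * \<delta>\<^sup>2 \<le> 2 * B * (2 * (1 - x \<bullet> z))"
        using \<open>B \<ge> 0\<close> by (intro mult_left_mono) auto
      then have "2 * B \<le> D * (1 - x \<bullet> z)" using \<delta>(1) by (simp add: D_def field_simps)
      then show ?thesis using B[OF x] B[OF z] \<open>\<epsilon> > 0\<close> by linarith
    qed
    have i1: "integrable sphere_measure (\<lambda>z. g z * poly ?q (x \<bullet> z))"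
      and i2: "integrable sphere_measure (\<lambda>z. g x * poly ?q (x \<bullet> z))"
      and i3: "integrable sphere_measure (\<lambda>z. \<epsilon> / 2 * poly ?q (x \<bullet> z))"
      and i4: "integrable sphere_measure (\<lambda>z. D * poly ([:1, -1:] * ?q) (x \<bullet> z))"
      by (intro integrable_sphere_continuous continuous_intros g)+
    have "zonal_conv ?q g x - g x = (\<integral>z. g z * poly ?q (x \<bullet> z) \<partial>sphere_measure) - (\<integral>z. g x * poly ?q (x \<bullet> z) \<partial>sphere_measure)"
      using mean_approx_identity(1)[of k] by (simp add: zonal_conv_def)
    also have "\<dots> = (\<integral>z. g z * poly ?q (x \<bullet> z) - g x * poly ?q (x \<bullet> z) \<partial>sphere_measure)"
      by (rule Bochner_Integration.integral_diff[symmetric, OF i1 i2])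
    finally have "\<bar>zonal_conv ?q g x - g x\<bar> \<le> (\<integral>z. \<bar>g z * poly ?q (x \<bullet> z) - g x * poly ?q (x \<bullet> z)\<bar> \<partial>sphere_measure)"
      using integral_norm_bound[of sphere_measure "\<lambda>z. g z * poly ?q (x \<bullet> z) - g x * poly ?q (x \<bullet> z)"] by simp
    also have "\<dots> \<le> (\<integral>z. \<epsilon> / 2 * poly ?q (x \<bullet> z) + D * poly ([:1, -1:] * ?q) (x \<bullet> z) \<partial>sphere_measure)"
    proof (intro integral_mono integrable_abs Bochner_Integration.integrable_diff Bochner_Integration.integrable_add i1 i2 i3 i4)
      fix z :: "real ^ 'n" assume "z \<in> space sphere_measure"
      then have z: "z \<in> sphere 0 1" by simp
      have "\<bar>g z * poly ?q (x \<bullet> z) - g x * poly ?q (x \<bullet> z)\<bar> = \<bar>g z - g x\<bar> * poly ?q (x \<bullet> z)"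
        using q0[OF z] by (simp add: left_diff_distrib[symmetric] abs_mult)
      also have "\<dots> \<le> (\<epsilon> / 2 + D * (1 - x \<bullet> z)) * poly ?q (x \<bullet> z)"
        by (intro mult_right_mono pw q0 z)
      finally show "\<bar>g z * poly ?q (x \<bullet> z) - g x * poly ?q (x \<bullet> z)\<bar> \<le> \<epsilon> / 2 * poly ?q (x \<bullet> z) + D * poly ([:1, -1:] * ?q) (x \<bullet> z)"
        by (simp add: algebra_simps)
    qed
    also have "\<dots> = \<epsilon> / 2 + D * (real d / (real d + real k))"
      using mean_approx_identity[of k] by (subst Bochner_Integration.integral_add[OF i3 i4]) (simp only: integral_mult_right_zero mult_1_right)
    also have "\<dots> < \<epsilon>"
    proof -
      have "2 * D * real d < \<epsilon> * real k" using k \<open>\<epsilon> > 0\<close> by (simp add: field_simps)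
      also have "\<dots> \<le> \<epsilon> * (real d + real k)" using \<open>\<epsilon> > 0\<close> by simp
      finally have "D * (real d / (real d + real k)) < \<epsilon> / 2"
        using n by (simp add: field_simps)
      then show ?thesis by linarith
    qed
    finally show ?thesis .
  qed
  then show ?thesis by blast
qed

section \<open>Strong convergence to the identity\<close>

text \<open>A convolution with \<open>q\<close> is a superposition of the functions
  \<open>y \<mapsto> q (z \<bullet> y)\<close>, each of which the kernel reproduces; Fubini
  exchanges the two integrations.\<close>

lemma needlet_kernel_reproduces_conv:
  fixes g :: "real ^ 'n \<Rightarrow> real"
  assumes n: "CARD('n) = d + 1" "d \<ge> 2" and g: "continuous_on (sphere 0 1) g" and q: "degree q \<le> L"
    and x: "x \<in> sphere 0 1"
  shows "zonal_conv (needlet_kernel d \<kappa> h L) (zonal_conv q g) x = zonal_conv q g x"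
proof -
  let ?k = "needlet_kernel d \<kappa> h L"
  have [measurable]: "g \<in> borel_measurable sphere_measure" using g by (rule measurable_sphere_continuous)
  have "bounded (g ` sphere 0 1)"
    by (intro compact_imp_bounded compact_continuous_image g compact_sphere)
  then obtain B where B: "\<And>z. z \<in> sphere 0 1 \<Longrightarrow> \<bar>g z\<bar> \<le> B"
    unfolding bounded_iff real_norm_def by blast
  obtain Q where Q: "\<And>t. t \<in> {-1..1} \<Longrightarrow> \<bar>poly q t\<bar> \<le> Q" using poly_bound_Icc by blast
  obtain K where K: "\<And>t. t \<in> {-1..1} \<Longrightarrow> \<bar>poly ?k t\<bar> \<le> K" using poly_bound_Icc by blast
  have "B \<ge> 0" by (rule order_trans[OF abs_ge_zero B[OF x]])
  have "Q \<ge> 0" by (rule order_trans[OF abs_ge_zero[of "poly q 0"] Q]) simp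
  have "zonal_conv ?k (zonal_conv q g) x = (\<integral>y. (\<integral>z. g z * poly q (y \<bullet> z) * poly ?k (x \<bullet> y) \<partial>sphere_measure) \<partial>sphere_measure)"
    unfolding zonal_conv_def by simp
  also have "\<dots> = (\<integral>z. (\<integral>y. g z * poly q (y \<bullet> z) * poly ?k (x \<bullet> y) \<partial>sphere_measure) \<partial>sphere_measure)"
  proof (rule sphere_fubini[of "\<lambda>z y. g z * poly q (y \<bullet> z) * poly ?k (x \<bullet> y)" "B * Q * K"])
    fix z y :: "real ^ 'n" assume zy: "z \<in> sphere 0 1" "y \<in> sphere 0 1"
    show "\<bar>g z * poly q (y \<bullet> z) * poly ?k (x \<bullet> y)\<bar> \<le> B * Q * K"
      unfolding abs_mult using \<open>B \<ge> 0\<close> \<open>Q \<ge> 0\<close>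
      by (intro mult_mono B Q K inner_sphere_Icc zy x mult_nonneg_nonneg) auto
  qed measurable
  also have "\<dots> = (\<integral>z. g z * zonal_conv ?k (\<lambda>y. poly q (z \<bullet> y)) x \<partial>sphere_measure)"
    unfolding zonal_conv_def by (simp add: mult.assoc inner_commute)
  also have "\<dots> = zonal_conv q g x"
    unfolding zonal_conv_def[of q]
    by (intro Bochner_Integration.integral_cong refl) (simp add: needlet_kernel_reproduces[OF n x _ q])
  finally show ?thesis .
qed

text \<open>Serves twice: it controls the error left after subtraction of an approximating
  polynomial, and along the paths of the field it supplies the dominating function.\<close>

lemma zonal_conv_residual_bound:
  fixes r :: "real ^ 'n \<Rightarrow> real"
  assumes r [measurable]: "r \<in> borel_measurable sphere_measure" and rm: "integrable sphere_measure (\<lambda>y. \<bar>r y\<bar> ^ m)"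
    and "m \<ge> 1"
    and C: "C > 0" "\<And>x. x \<in> sphere (0 :: real ^ 'n) 1 \<Longrightarrow> (\<integral>y. \<bar>poly q (x \<bullet> y)\<bar> \<partial>sphere_measure) \<le> C"
  shows "(\<integral>\<^sup>+x. ennreal (\<bar>r x - zonal_conv q r x\<bar> ^ m) \<partial>sphere_measure)
    \<le> ennreal (2 ^ m * (1 + C ^ m)) * (\<integral>\<^sup>+x. ennreal (\<bar>r x\<bar> ^ m) \<partial>sphere_measure)"
proof -
  let ?I = "\<integral>\<^sup>+x. ennreal (\<bar>r x\<bar> ^ m) \<partial>sphere_measure"
  have "(\<integral>\<^sup>+x. ennreal (\<bar>r x - zonal_conv q r x\<bar> ^ m) \<partial>sphere_measure)
    \<le> (\<integral>\<^sup>+x. ennreal (2 ^ m) * (ennreal (\<bar>r x\<bar> ^ m) + ennreal (\<bar>zonal_conv q r x\<bar> ^ m)) \<partial>sphere_measure)"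
  proof (rule nn_integral_mono)
    fix x :: "real ^ 'n" assume "x \<in> space sphere_measure"
    then have "\<bar>r x - zonal_conv q r x\<bar> ^ m \<le> (\<bar>r x\<bar> + \<bar>zonal_conv q r x\<bar>) ^ m"
      by (intro power_mono) auto
    also have "\<dots> \<le> 2 ^ m * (\<bar>r x\<bar> ^ m + \<bar>zonal_conv q r x\<bar> ^ m)"
      by (intro power_sum_le) auto
    finally show "ennreal (\<bar>r x - zonal_conv q r x\<bar> ^ m) \<le> ennreal (2 ^ m) * (ennreal (\<bar>r x\<bar> ^ m) + ennreal (\<bar>zonal_conv q r x\<bar> ^ m))"
      by (simp add: ennreal_plus[symmetric] ennreal_mult'[symmetric] ennreal_leI del: ennreal_plus)
  qed
  also have "\<dots> = ennreal (2 ^ m) * (?I + (\<integral>\<^sup>+x. ennreal (\<bar>zonal_conv q r x\<bar> ^ m) \<partial>sphere_measure))"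
    by (subst nn_integral_cmult, measurable, subst nn_integral_add) (auto intro!: measurable_compose[OF measurable_zonal_conv])
  also have "\<dots> \<le> ennreal (2 ^ m) * (?I + ennreal (C ^ m) * ?I)"
    by (intro mult_left_mono add_left_mono zonal_conv_power_bound rm r \<open>m \<ge> 1\<close> C) auto
  also have "\<dots> = ennreal (2 ^ m * (1 + C ^ m)) * ?I"
    using C(1) by (simp add: ennreal_mult' distrib_right mult.assoc)
  finally show ?thesis .
qed

text \<open>Density argument: for a spherical polynomial \<open>p\<close> close to \<open>f\<close>
  and large \<open>L\<close>, the kernel reproduces \<open>p\<close>, so \<open>f\<close> and
  \<open>r = f - p\<close> have the same error, and that of \<open>r\<close> is small uniformly in
  \<open>L\<close>.\<close>

lemma zonal_conv_needlet_kernel_tendsto: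
  fixes f :: "real ^ 'n \<Rightarrow> real"
  assumes n: "CARD('n) = d + 1" "d \<ge> 2" and "m \<ge> 1"
    and C: "C > 0" "\<And>L x. L \<ge> L0 \<Longrightarrow> x \<in> sphere (0 :: real ^ 'n) 1 \<Longrightarrow>
      (\<integral>y. \<bar>poly (needlet_kernel d \<kappa> h L) (x \<bullet> y)\<bar> \<partial>sphere_measure) \<le> C"
    and f [measurable]: "f \<in> borel_measurable sphere_measure" and fm: "integrable sphere_measure (\<lambda>y. \<bar>f y\<bar> ^ m)"
  shows "(\<lambda>L. \<integral>\<^sup>+x. ennreal (\<bar>f x - zonal_conv (needlet_kernel d \<kappa> h L) f x\<bar> ^ m) \<partial>sphere_measure) \<longlonglongrightarrow> 0"
proof (rule order_tendstoI)
  interpret prob_space "sphere_measure :: (real ^ 'n) measure" by (rule prob_space_sphere_measure)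
  fix a :: ennreal assume "a > 0"
  then obtain \<epsilon> where \<epsilon>: "\<epsilon> > 0" "ennreal \<epsilon> < a"
    by (metis dense ennreal_cases ennreal_less_zero_iff less_top not_less_iff_gr_or_eq top_greatest)
  define A where "A = 2 ^ m * (1 + C ^ m) * 2 ^ m"
  have "A > 0" using C(1) by (simp add: A_def add_pos_pos)
  \<comment> \<open>The estimates end at \<open>A * 2 * \<eta> = \<epsilon> / 2\<close>; the factor
    2 accounts for the two approximations, of \<open>f\<close> by \<open>g\<close> and of
    \<open>g\<close> by \<open>p\<close>.\<close>
  define \<eta> where "\<eta> = \<epsilon> / (4 * A)"
  have "\<eta> > 0" using \<epsilon> \<open>A > 0\<close> by (simp add: \<eta>_def)
  obtain g where g: "continuous_on (sphere 0 1) g" "integrable sphere_measure (\<lambda>z. \<bar>f z - g z\<bar> ^ m)"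
    "(\<integral>z. \<bar>f z - g z\<bar> ^ m \<partial>sphere_measure) < \<eta>"
    using sphere_power_approx[OF f fm \<open>m \<ge> 1\<close> \<open>\<eta> > 0\<close>] by blast
  \<comment> \<open>The minimum with 1 lets the \<open>m\<close>-th power of the deviation be
    bounded by the deviation itself.\<close>
  obtain k where k: "\<And>x. x \<in> sphere 0 1 \<Longrightarrow> \<bar>zonal_conv (approx_identity d k) g x - g x\<bar> < min 1 \<eta>"
  proof -
    have "min 1 \<eta> > 0" using \<open>\<eta> > 0\<close> by simp
    from zonal_conv_approx_identity[OF n g(1) this] show ?thesis using that by blast
  qed
  define p where "p = zonal_conv (approx_identity d k) g"
  have [measurable]: "g \<in> borel_measurable sphere_measure" using g(1) by (rule measurable_sphere_continuous)
  have [measurable]: "p \<in> borel_measurable sphere_measure" unfolding p_def by measurable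
  have gp: "\<bar>g x - p x\<bar> ^ m \<le> \<eta>" if "x \<in> sphere 0 1" for x
  proof -
    have "\<bar>g x - p x\<bar> < min 1 \<eta>" using k[OF that] by (simp add: p_def abs_minus_commute)
    then have "\<bar>g x - p x\<bar> ^ m \<le> \<bar>g x - p x\<bar> ^ 1" using \<open>m \<ge> 1\<close> by (intro power_decreasing) auto
    then show ?thesis using \<open>\<bar>g x - p x\<bar> < min 1 \<eta>\<close> by simp
  qed
  define r where "r x = f x - p x" for x
  have [measurable]: "r \<in> borel_measurable sphere_measure" unfolding r_def[abs_def] by measurable
  have pw: "\<bar>r z\<bar> ^ m \<le> 2 ^ m * (\<bar>f z - g z\<bar> ^ m + \<eta>)" if "z \<in> sphere 0 1" for z
  proof -
    have "\<bar>r z\<bar> ^ m \<le> (\<bar>f z - g z\<bar> + \<bar>g z - p z\<bar>) ^ m" by (intro power_mono) (auto simp: r_def)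
    also have "\<dots> \<le> 2 ^ m * (\<bar>f z - g z\<bar> ^ m + \<bar>g z - p z\<bar> ^ m)" by (intro power_sum_le) auto
    also have "\<dots> \<le> 2 ^ m * (\<bar>f z - g z\<bar> ^ m + \<eta>)" using gp[OF that] by simp
    finally show ?thesis .
  qed
  have i1: "integrable sphere_measure (\<lambda>z. 2 ^ m * (\<bar>f z - g z\<bar> ^ m + \<eta>))" using g(2) by simp
  have rm: "integrable sphere_measure (\<lambda>z. \<bar>r z\<bar> ^ m)"
    by (rule Bochner_Integration.integrable_bound[OF i1]) (auto intro!: AE_I2 order.trans[OF pw])
  have "(\<integral>z. \<bar>r z\<bar> ^ m \<partial>sphere_measure) \<le> (\<integral>z. 2 ^ m * (\<bar>f z - g z\<bar> ^ m + \<eta>) \<partial>sphere_measure)"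
    by (intro integral_mono rm i1 pw) simp
  also have "\<dots> = 2 ^ m * ((\<integral>z. \<bar>f z - g z\<bar> ^ m \<partial>sphere_measure) + \<eta>)"
    using g(2) prob_space by simp
  also have "\<dots> \<le> 2 ^ m * (2 * \<eta>)" using g(3) by simp
  finally have R: "(\<integral>z. \<bar>r z\<bar> ^ m \<partial>sphere_measure) \<le> 2 ^ m * (2 * \<eta>)" .
  have fi: "integrable sphere_measure f"
    using integrable_power_imp_integrable[OF finite_measure_axioms f fm \<open>m \<ge> 1\<close>] by (simp add: integrable_abs_iff)
  have "integrable sphere_measure (\<lambda>x. \<bar>r x\<bar> ^ 1)"
    by (rule integrable_power_imp_integrable[OF finite_measure_axioms _ rm \<open>m \<ge> 1\<close>]) measurable
  then have ri: "integrable sphere_measure r" by (simp add: integrable_abs_iff)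
  have pi: "integrable sphere_measure p"
    using Bochner_Integration.integrable_diff[OF fi ri] by (simp add: r_def)
  have main: "(\<integral>\<^sup>+x. ennreal (\<bar>f x - zonal_conv (needlet_kernel d \<kappa> h L) f x\<bar> ^ m) \<partial>sphere_measure) < a"
    if L: "L \<ge> max L0 k" for L
  proof -
    let ?k = "needlet_kernel d \<kappa> h L"
    have V: "f x - zonal_conv ?k f x = r x - zonal_conv ?k r x" if x: "x \<in> sphere 0 1" for x
    proof -
      have "zonal_conv ?k p x = p x" unfolding p_def
        using L order.trans[OF degree_approx_identity[of d k], of L]
        by (intro needlet_kernel_reproduces_conv n g(1) x) auto
      then show ?thesis using zonal_conv_diff[OF fi pi x, of ?k] by (simp add: r_def[abs_def])
    qed
    have "(\<integral>\<^sup>+x. ennreal (\<bar>f x - zonal_conv ?k f x\<bar> ^ m) \<partial>sphere_measure)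
      = (\<integral>\<^sup>+x. ennreal (\<bar>r x - zonal_conv ?k r x\<bar> ^ m) \<partial>sphere_measure)"
      by (intro nn_integral_cong) (simp add: V)
    also have "\<dots> \<le> ennreal (2 ^ m * (1 + C ^ m)) * (\<integral>\<^sup>+x. ennreal (\<bar>r x\<bar> ^ m) \<partial>sphere_measure)"
      using L by (intro zonal_conv_residual_bound rm \<open>m \<ge> 1\<close> C) auto
    also have "(\<integral>\<^sup>+x. ennreal (\<bar>r x\<bar> ^ m) \<partial>sphere_measure) = ennreal (\<integral>x. \<bar>r x\<bar> ^ m \<partial>sphere_measure)"
      by (intro nn_integral_eq_integral rm) auto
    also have "ennreal (2 ^ m * (1 + C ^ m)) * ennreal (\<integral>x. \<bar>r x\<bar> ^ m \<partial>sphere_measure)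
      = ennreal (2 ^ m * (1 + C ^ m) * (\<integral>x. \<bar>r x\<bar> ^ m \<partial>sphere_measure))"
      using C(1) by (intro ennreal_mult'[symmetric]) auto
    also have "\<dots> \<le> ennreal (2 ^ m * (1 + C ^ m) * (2 ^ m * (2 * \<eta>)))"
      using C(1) by (intro ennreal_leI mult_left_mono R) auto
    also have "2 ^ m * (1 + C ^ m) * (2 ^ m * (2 * \<eta>)) = A * 2 * \<eta>" by (simp add: A_def)
    also have "ennreal (A * 2 * \<eta>) \<le> ennreal \<epsilon>"
      using \<open>A > 0\<close> \<epsilon> by (intro ennreal_leI) (simp add: \<eta>_def)
    finally show ?thesis using \<epsilon>(2) by simp
  qed
  then show "\<forall>\<^sub>F L in sequentially. (\<integral>\<^sup>+x. ennreal (\<bar>f x - zonal_conv (needlet_kernel d \<kappa> h L) f x\<bar> ^ m) \<partial>sphere_measure) < a"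
    by (auto simp: eventually_sequentially intro!: exI[of _ "max L0 k"])
qed simp

section \<open>Needlets\<close>

lemma poly_functions_mono: "q \<in> poly_functions m \<Longrightarrow> m \<le> n \<Longrightarrow> q \<in> poly_functions n"
proof -
  assume q: "q \<in> poly_functions m" and "m \<le> n"
  then obtain c where c: "\<And>x. q x = (\<Sum>a | (\<Sum>i\<in>UNIV. a i) \<le> m. c a * (\<Prod>i\<in>UNIV. (x $ i) ^ a i))"
    unfolding poly_functions_def by blast
  have "q x = (\<Sum>a | (\<Sum>i\<in>UNIV. a i) \<le> n. (if (\<Sum>i\<in>UNIV. a i) \<le> m then c a else 0) * (\<Prod>i\<in>UNIV. (x $ i) ^ a i))" for x
    unfolding c using \<open>m \<le> n\<close>
    by (intro sum.mono_neutral_cong_left finite_exponents) auto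
  then show ?thesis unfolding poly_functions_def by (intro CollectI exI allI)
qed

lemma poly_functions_sum:
  assumes "\<And>s. s \<in> A \<Longrightarrow> q s \<in> poly_functions n"
  shows "(\<lambda>x. \<Sum>s\<in>A. q s x) \<in> poly_functions n"
proof -
  have ex: "\<exists>c. \<forall>x. q s x = (\<Sum>a | (\<Sum>i\<in>UNIV. a i) \<le> n. c a * (\<Prod>i\<in>UNIV. (x $ i) ^ a i))" if "s \<in> A" for s
    using assms[OF that] unfolding poly_functions_def by blast
  define c where "c s = (SOME c. \<forall>x. q s x = (\<Sum>a | (\<Sum>i\<in>UNIV. a i) \<le> n. c a * (\<Prod>i\<in>UNIV. (x $ i) ^ a i)))" for s
  have c: "q s x = (\<Sum>a | (\<Sum>i\<in>UNIV. a i) \<le> n. c s a * (\<Prod>i\<in>UNIV. (x $ i) ^ a i))" if "s \<in> A" for s x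
    using someI_ex[OF ex[OF that]] unfolding c_def by blast
  have "(\<Sum>s\<in>A. q s x) = (\<Sum>a | (\<Sum>i\<in>UNIV. a i) \<le> n. (\<Sum>s\<in>A. c s a) * (\<Prod>i\<in>UNIV. (x $ i) ^ a i))" for x
    unfolding sum_distrib_right by (subst sum.swap) (intro sum.cong refl, simp add: c)
  then show ?thesis unfolding poly_functions_def by (intro CollectI exI allI)
qed

lemma poly_functions_cmult:
  assumes "q \<in> poly_functions n"
  shows "(\<lambda>x. k * q x) \<in> poly_functions n"
proof -
  obtain c where "\<And>x. q x = (\<Sum>a | (\<Sum>i\<in>UNIV. a i) \<le> n. c a * (\<Prod>i\<in>UNIV. (x $ i) ^ a i))"
    using assms unfolding poly_functions_def by blast
  then have "k * q x = (\<Sum>a | (\<Sum>i\<in>UNIV. a i) \<le> n. (k * c a) * (\<Prod>i\<in>UNIV. (x $ i) ^ a i))" for x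
    by (simp add: sum_distrib_left mult.assoc)
  then show ?thesis unfolding poly_functions_def by (intro CollectI exI allI)
qed

lemma poly_functions_monomial:
  fixes a :: "'n::finite \<Rightarrow> nat"
  assumes "(\<Sum>i\<in>UNIV. a i) \<le> n"
  shows "(\<lambda>x :: real ^ 'n. \<Prod>i\<in>UNIV. (x $ i) ^ a i) \<in> poly_functions n"
proof -
  have "(\<Prod>i\<in>UNIV. (x $ i) ^ a i) = (\<Sum>b | (\<Sum>i\<in>UNIV. b i) \<le> n. (if b = a then 1 else 0) * (\<Prod>i\<in>UNIV. (x $ i) ^ b i))"
    for x :: "real ^ 'n"
  proof -
    have "(\<Sum>b | (\<Sum>i\<in>UNIV. b i) \<le> n. (if b = a then 1 else 0) * (\<Prod>i\<in>UNIV. (x $ i) ^ b i))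
      = (\<Sum>b | (\<Sum>i\<in>UNIV. b i) \<le> n. if b = a then (\<Prod>i\<in>UNIV. (x $ i) ^ a i) else 0)"
      by (intro sum.cong) auto
    also have "\<dots> = (\<Prod>i\<in>UNIV. (x $ i) ^ a i)"
      using assms finite_exponents[of n, where 'n = 'n] by (simp add: sum.delta)
    finally show ?thesis by simp
  qed
  then show ?thesis unfolding poly_functions_def by (intro CollectI exI allI)
qed

lemma poly_functions_mult:
  assumes "p \<in> poly_functions m" "q \<in> poly_functions n"
  shows "(\<lambda>x. p x * q x) \<in> poly_functions (m + n)"
proof -
  obtain c where c: "\<And>x. p x = (\<Sum>a | (\<Sum>i\<in>UNIV. a i) \<le> m. c a * (\<Prod>i\<in>UNIV. (x $ i) ^ a i))"
    using assms unfolding poly_functions_def by blast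
  obtain e where e: "\<And>x. q x = (\<Sum>a | (\<Sum>i\<in>UNIV. a i) \<le> n. e a * (\<Prod>i\<in>UNIV. (x $ i) ^ a i))"
    using assms unfolding poly_functions_def by blast
  have "p x * q x = (\<Sum>a | (\<Sum>i\<in>UNIV. a i) \<le> m. \<Sum>b | (\<Sum>i\<in>UNIV. b i) \<le> n.
      (c a * e b) * (\<Prod>i\<in>UNIV. (x $ i) ^ (a i + b i)))" for x
    unfolding c e sum_product by (intro sum.cong refl) (simp add: power_add prod.distrib mult_ac)
  moreover have "(\<lambda>x. \<Sum>a | (\<Sum>i\<in>UNIV. a i) \<le> m. \<Sum>b | (\<Sum>i\<in>UNIV. b i) \<le> n.
      (c a * e b) * (\<Prod>i\<in>UNIV. (x $ i) ^ (a i + b i))) \<in> poly_functions (m + n)"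
    by (intro poly_functions_sum poly_functions_cmult poly_functions_monomial) (simp add: sum.distrib)
  ultimately show ?thesis by (simp only:)
qed

lemma poly_functions_const: "(\<lambda>x. c) \<in> poly_functions n"
  using poly_functions_cmult[OF poly_functions_monomial[of "\<lambda>_. 0" n], of c] by simp

lemma poly_functions_inner: "(\<lambda>u. z \<bullet> u) \<in> poly_functions 1" for z :: "real ^ 'n"
proof -
  have "(\<lambda>u :: real ^ 'n. u $ j) \<in> poly_functions 1" for j
  proof -
    have "(\<lambda>x :: real ^ 'n. \<Prod>i\<in>UNIV. (x $ i) ^ (if i = j then 1 else 0)) \<in> poly_functions 1"
      by (rule poly_functions_monomial) simp
    also have "(\<lambda>x :: real ^ 'n. \<Prod>i\<in>UNIV. (x $ i) ^ (if i = j then 1 else 0)) = (\<lambda>u. u $ j)"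
    proof
      fix x :: "real ^ 'n"
      have "(\<Prod>i\<in>UNIV. (x $ i) ^ (if i = j then 1 else 0)) = (\<Prod>i\<in>UNIV. if i = j then x $ i else 1)"
        by (intro prod.cong) auto
      then show "(\<Prod>i\<in>UNIV. (x $ i) ^ (if i = j then 1 else 0)) = x $ j" by simp
    qed
    finally show ?thesis .
  qed
  then have "(\<lambda>u. \<Sum>j\<in>UNIV. z $ j * u $ j) \<in> poly_functions 1"
    by (intro poly_functions_sum poly_functions_cmult)
  then show ?thesis by (simp add: inner_vec_def)
qed

lemma poly_functions_zonal: "degree p \<le> n \<Longrightarrow> (\<lambda>u. poly p (z \<bullet> u)) \<in> poly_functions n" for z :: "real ^ 'n"
proof -
  assume "degree p \<le> n"
  have "(\<lambda>u. (z \<bullet> u) ^ k) \<in> poly_functions k" for k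
  proof (induction k)
    case 0
    then show ?case using poly_functions_const[of 1 0] by simp
  next
    case (Suc k)
    then show ?case using poly_functions_mult[OF poly_functions_inner Suc] by simp
  qed
  then have "(\<lambda>u. \<Sum>k\<le>degree p. coeff p k * (z \<bullet> u) ^ k) \<in> poly_functions n"
    using \<open>degree p \<le> n\<close>
    by (intro poly_functions_sum poly_functions_cmult) (auto intro: poly_functions_mono)
  then show ?thesis by (simp add: poly_altdef)
qed

section \<open>From needlets to zonal kernels\<close>

lemma degree_zonal_sum: "degree (zonal_sum d (Suc K) f) \<le> K"
  unfolding zonal_sum_def
  by (intro degree_sum_le finite_lessThan order.trans[OF degree_smult_le] order.trans[OF degree_gegenbauer_poly_le]) simp

lemma zonal_sum_extend:
  assumes "K \<le> K'" "\<And>l. l \<ge> K \<Longrightarrow> f l = 0"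
  shows "zonal_sum d K f = zonal_sum d K' f"
  unfolding zonal_sum_def using assms by (intro sum.mono_neutral_left) auto

lemma zonal_sum_sum: "zonal_sum d K (\<lambda>l. \<Sum>j\<in>A. f j l) = (\<Sum>j\<in>A. zonal_sum d K (f j))"
  unfolding zonal_sum_def sum_distrib_right smult_sum by (rule sum.swap)

text \<open>Convolution multiplies eigenvalues, so a kernel convolved with itself has squared
  coefficients; this is where the squares of \<open>h\<close> in the profile come from.\<close>

lemma zonal_sum_convolution:
  fixes x z :: "real ^ 'n"
  assumes n: "CARD('n) = d + 1" "d \<ge> 2" and x: "norm x = 1" "norm z = 1"
  shows "(\<integral>u. poly (zonal_sum d K f) (z \<bullet> u) * poly (zonal_sum d K f) (x \<bullet> u) \<partial>sphere_measure)
    = poly (zonal_sum d K (\<lambda>l. (f l)\<^sup>2)) (x \<bullet> z)"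
proof -
  have e: "norm (axis undefined 1 :: real ^ 'n) = 1" by simp
  interpret ultraspherical_mean d "\<lambda>p. \<integral>z. poly p ((axis undefined 1 :: real ^ 'n) \<bullet> z) \<partial>sphere_measure"
    by (rule ultraspherical_sphere_mean[OF n e])
  have xz: "x \<in> sphere 0 1" "z \<in> sphere 0 1" using x by simp_all
  have "(\<integral>u. poly (zonal_sum d K f) (z \<bullet> u) * poly (zonal_sum d K f) (x \<bullet> u) \<partial>sphere_measure)
    = (\<integral>u. (\<Sum>m<K. f m * Z d m * (gegenbauer d m (z \<bullet> u) * poly (zonal_sum d K f) (x \<bullet> u))) \<partial>sphere_measure)"
    unfolding poly_zonal_sum[of d K f "z \<bullet> _"] sum_distrib_right by (simp only: mult.assoc)
  also have "\<dots> = (\<Sum>m<K. \<integral>u. f m * Z d m * (gegenbauer d m (z \<bullet> u) * poly (zonal_sum d K f) (x \<bullet> u)) \<partial>sphere_measure)"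
    unfolding poly_gegenbauer_poly[symmetric]
    by (intro Bochner_Integration.integral_sum integrable_sphere_continuous continuous_intros)
  also have "\<dots> = (\<Sum>m<K. f m * Z d m * zonal_conv (zonal_sum d K f) (\<lambda>u. gegenbauer d m (z \<bullet> u)) x)"
    by (simp add: zonal_conv_def)
  also have "\<dots> = poly (zonal_sum d K (\<lambda>l. (f l)\<^sup>2)) (x \<bullet> z)"
    unfolding poly_zonal_sum
    by (intro sum.cong refl) (simp add: zonal_conv_zonal_sum_gegenbauer[OF n xz] power2_eq_square)
  finally show ?thesis .
qed

text \<open>Level 0, where the needlets are constant, is treated as a filter concentrated on degree
  0, so that all levels take the same zonal form.\<close>

definition level_coeff :: "(real \<Rightarrow> real) \<Rightarrow> nat \<Rightarrow> nat \<Rightarrow> real" where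
  "level_coeff h j l = (if j = 0 then if l = 0 then 1 else 0 else h (real l / 2 ^ (j - 1)))"

text \<open>For \<open>j \<ge> 1\<close> and \<open>l \<ge> 2^j\<close> the filter is evaluated at
  some \<open>t \<ge> 2\<close>, where it vanishes. Hence level \<open>j\<close> has degree below
  \<open>2^j\<close>, and a product of two of its kernels stays within the exactness of the
  quadrature.\<close>

lemma level_coeff_support:
  assumes "needlet_filter \<kappa> h" "l \<ge> 2 ^ j"
  shows "level_coeff h j l = 0"
proof (cases j)
  case 0
  then show ?thesis using assms by (simp add: level_coeff_def)
next
  case (Suc i)
  have "real l \<ge> 2 ^ j" using assms(2) by (metis of_nat_le_iff of_nat_numeral of_nat_power)
  then have "real l / 2 ^ i \<ge> 2" by (simp add: Suc field_simps)
  then show ?thesis using needlet_filter_zero[OF assms(1), of "real l / 2 ^ i"] by (simp add: level_coeff_def Suc)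
qed

lemma needlet_eq:
  assumes n: "d \<ge> 2" and h: "needlet_filter \<kappa> h"
  shows "needlet d h w y j k x = sqrt (w j k) * poly (zonal_sum d (2 ^ j) (level_coeff h j)) (x \<bullet> y j k)"
proof (cases "j = 0")
  case True
  \<comment> \<open>The constant needlet carries no factor \<open>Z\<close>, so level 0 fits the
    common form because \<open>Z d 0 = 1\<close>.\<close>
  have "Z d 0 = 1"
  proof -
    have g: "Gamma (real d) = (real d - 1) * Gamma (real d - 1)"
      using Gamma_plus1[of "real d - 1"] nonpos_Ints_nonpos[of "real d - 1"] n by fastforce
    have "Gamma (real d) > 0" using n by (intro Gamma_real_pos) simp
    have "Z d 0 = (real d - 1) * Gamma (real d - 1) / Gamma (real d)" by (simp add: Z_def)
    then show ?thesis unfolding g[symmetric] using \<open>Gamma (real d) > 0\<close> by simp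
  qed
  then show ?thesis using True by (simp add: needlet_def poly_zonal_sum level_coeff_def gegenbauer_def jacobi_def)
next
  case False
  have "(\<Sum>l. h (real l / 2 ^ (j - 1)) * Z d l * gegenbauer d l (x \<bullet> y j k))
    = (\<Sum>l<2 ^ j. h (real l / 2 ^ (j - 1)) * Z d l * gegenbauer d l (x \<bullet> y j k))"
    using level_coeff_support[OF h, of j] False by (intro suminf_finite) (auto simp: level_coeff_def)
  then show ?thesis using False by (simp add: needlet_def poly_zonal_sum level_coeff_def)
qed

text \<open>Telescoping through the partition of unity: the next level adds
  \<open>h (l / 2^(J+1))^2\<close>, which vanishes for \<open>l \<le> 2^J\<close>, completes the old
  tail to 1 for \<open>2^J < l \<le> 2^(J+1)\<close>, and is the new tail beyond, where the old one
  vanishes.\<close>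

lemma sum_level_coeff:
  assumes h: "needlet_filter \<kappa> h"
  shows "(\<Sum>j\<le>Suc J. (level_coeff h j l)\<^sup>2) = profile h (2 ^ J) l"
proof (induction J)
  case 0
  have "h 0 = 0" "h (1/2) = 0" using needlet_filter_zero[OF h] by auto
  moreover have "(h (1/2))\<^sup>2 + (h (2 * (1/2)))\<^sup>2 = 1"
    using h unfolding needlet_filter_def by (elim conjE bspec) auto
  ultimately have "h 0 = 0" "(h 1)\<^sup>2 = 1" by simp_all
  then show ?case by (auto simp: level_coeff_def profile_def le_Suc_eq)
next
  case (Suc J)
  let ?L = "2 ^ J :: nat" and ?t = "real l / 2 ^ Suc J"
  have "(\<Sum>j\<le>Suc (Suc J). (level_coeff h j l)\<^sup>2) = profile h ?L l + (h ?t)\<^sup>2"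
    using Suc by (simp add: level_coeff_def)
  also have "\<dots> = profile h (2 ^ Suc J) l"
  proof -
    consider "l \<le> ?L" | "?L < l" "l \<le> 2 * ?L" | "2 * ?L < l" by linarith
    then show ?thesis
    proof cases
      case 1
      then have "real l \<le> 2 ^ J" by (metis of_nat_le_iff of_nat_numeral of_nat_power)
      then have "?t \<le> 1/2" by (simp add: field_simps)
      then have "h ?t = 0" using needlet_filter_zero[OF h, of ?t] by simp
      then show ?thesis using 1 by (simp add: profile_def)
    next
      case 2
      then have "real l \<le> real (2 * 2 ^ J)" "real (2 ^ J) < real l" by (simp_all only: of_nat_le_iff of_nat_less_iff)
      then have "?t \<in> {1/2..1}" by (simp add: field_simps)
      then have "(h ?t)\<^sup>2 + (h (2 * ?t))\<^sup>2 = 1"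
        using h unfolding needlet_filter_def by blast
      then show ?thesis using 2 by (simp add: profile_def)
    next
      case 3
      then have "real (2 * 2 ^ J) < real l" by (simp only: of_nat_less_iff)
      then have "real l / real ?L \<ge> 2" by (simp add: field_simps)
      then have "h (real l / real ?L) = 0" using needlet_filter_zero[OF h, of "real l / real ?L"] by simp
      then show ?thesis using 3 by (simp add: profile_def)
    qed
  qed
  finally show ?case .
qed

lemma sum_level_kernels:
  assumes h: "needlet_filter \<kappa> h"
  shows "(\<Sum>j\<le>Suc J. zonal_sum d (2 ^ j) (\<lambda>l. (level_coeff h j l)\<^sup>2)) = needlet_kernel d \<kappa> h (2 ^ J)"
proof -
  let ?K = "Suc (2 * 2 ^ J + \<kappa>)"
  have "(\<Sum>j\<le>Suc J. zonal_sum d (2 ^ j) (\<lambda>l. (level_coeff h j l)\<^sup>2))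
    = (\<Sum>j\<le>Suc J. zonal_sum d ?K (\<lambda>l. (level_coeff h j l)\<^sup>2))"
  proof (intro sum.cong refl zonal_sum_extend)
    fix j assume "j \<in> {..Suc J}"
    then have "(2::nat) ^ j \<le> 2 ^ Suc J" by (intro power_increasing) auto
    then show "2 ^ j \<le> ?K" by simp
  qed (simp add: level_coeff_support[OF h])
  also have "\<dots> = zonal_sum d ?K (\<lambda>l. \<Sum>j\<le>Suc J. (level_coeff h j l)\<^sup>2)"
    by (rule zonal_sum_sum[symmetric])
  also have "\<dots> = needlet_kernel d \<kappa> h (2 ^ J)"
    unfolding sum_level_coeff[OF h] needlet_kernel_def ..
  finally show ?thesis .
qed

text \<open>The sum over the nodes is moved under the integral, where it is a quadrature for the
  product of two kernels of level \<open>j\<close> and equals their convolution. Order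
  \<open>Suc J\<close> corresponds to scale \<open>2^J\<close>, since level \<open>j\<close> filters
  at \<open>2^(j - 1)\<close>.\<close>

lemma needlet_approx_eq_zonal_conv:
  fixes T :: "'w \<Rightarrow> real ^ 'n \<Rightarrow> real" and x :: "real ^ 'n"
  assumes n: "CARD('n) = d + 1" "d \<ge> 2" and h: "needlet_filter \<kappa> h" and quad: "needlet_quadrature N w y"
    and x: "x \<in> sphere 0 1" and T: "integrable sphere_measure (T \<omega>)"
  shows "needlet_approx d h N w y (Suc J) T \<omega> x = zonal_conv (needlet_kernel d \<kappa> h (2 ^ J)) (T \<omega>) x"
proof -
  let ?P = "\<lambda>j. zonal_sum d (2 ^ j) (level_coeff h j)" and ?R = "\<lambda>j. zonal_sum d (2 ^ j) (\<lambda>l. (level_coeff h j l)\<^sup>2)"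
  have level: "(\<Sum>k=1..N j. sphere_inner (T \<omega>) (needlet d h w y j k) * needlet d h w y j k x) = zonal_conv (?R j) (T \<omega>) x" for j
  proof -
    have node: "y j k \<in> sphere 0 1" "w j k > 0" if "k \<in> {1..N j}" for k
      using quad that unfolding needlet_quadrature_def by blast+
    \<comment> \<open>The product of two such factors has degree at most \<open>2^(j+1) - 2\<close>,
      just within the exactness of the quadrature.\<close>
    have "degree (?P j) \<le> 2 ^ j - 1"
      using degree_zonal_sum[of d "2 ^ j - 1"] by simp
    then have "(\<lambda>u. poly (?P j) (z \<bullet> u) * poly (?P j) (x \<bullet> u)) \<in> poly_functions ((2 ^ j - 1) + (2 ^ j - 1))" for z
      by (intro poly_functions_mult poly_functions_zonal)
    then have "(\<lambda>u. poly (?P j) (z \<bullet> u) * poly (?P j) (x \<bullet> u)) \<in> poly_functions (2 ^ (j + 1) - 1)" for z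
      by (rule poly_functions_mono) simp
    then have quadj: "(\<integral>u. poly (?P j) (z \<bullet> u) * poly (?P j) (x \<bullet> u) \<partial>sphere_measure)
        = (\<Sum>k=1..N j. w j k * (poly (?P j) (z \<bullet> y j k) * poly (?P j) (x \<bullet> y j k)))" for z
      using quad unfolding needlet_quadrature_def by blast
    have "(\<Sum>k=1..N j. sphere_inner (T \<omega>) (needlet d h w y j k) * needlet d h w y j k x)
      = (\<Sum>k=1..N j. \<integral>z. T \<omega> z * poly (?P j) (y j k \<bullet> z) * (w j k * poly (?P j) (x \<bullet> y j k)) \<partial>sphere_measure)"
    proof (intro sum.cong refl)
      fix k assume "k \<in> {1..N j}"
      then have "w j k > 0" by (rule node(2))
      then have "sqrt (w j k) * sqrt (w j k) = w j k" by simp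
      have "sphere_inner (T \<omega>) (needlet d h w y j k) * needlet d h w y j k x
        = (\<integral>z. T \<omega> z * (sqrt (w j k) * poly (?P j) (z \<bullet> y j k)) \<partial>sphere_measure) * (sqrt (w j k) * poly (?P j) (x \<bullet> y j k))"
        unfolding sphere_inner_def needlet_eq[OF n(2) h] by simp
      also have "\<dots> = (\<integral>z. T \<omega> z * (sqrt (w j k) * poly (?P j) (z \<bullet> y j k)) * (sqrt (w j k) * poly (?P j) (x \<bullet> y j k)) \<partial>sphere_measure)"
        by simp
      also have "\<dots> = (\<integral>z. T \<omega> z * poly (?P j) (y j k \<bullet> z) * (w j k * poly (?P j) (x \<bullet> y j k)) \<partial>sphere_measure)"
      proof (intro Bochner_Integration.integral_cong refl)
        fix z
        have "a * (sqrt (w j k) * b) * (sqrt (w j k) * c) = a * b * ((sqrt (w j k) * sqrt (w j k)) * c)" for a b c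
          by (simp only: mult_ac)
        then show "T \<omega> z * (sqrt (w j k) * poly (?P j) (z \<bullet> y j k)) * (sqrt (w j k) * poly (?P j) (x \<bullet> y j k))
          = T \<omega> z * poly (?P j) (y j k \<bullet> z) * (w j k * poly (?P j) (x \<bullet> y j k))"
          unfolding \<open>sqrt (w j k) * sqrt (w j k) = w j k\<close> inner_commute[of z] .
      qed
      finally show "sphere_inner (T \<omega>) (needlet d h w y j k) * needlet d h w y j k x
        = (\<integral>z. T \<omega> z * poly (?P j) (y j k \<bullet> z) * (w j k * poly (?P j) (x \<bullet> y j k)) \<partial>sphere_measure)" .
    qed
    also have "\<dots> = (\<integral>z. (\<Sum>k=1..N j. T \<omega> z * poly (?P j) (y j k \<bullet> z) * (w j k * poly (?P j) (x \<bullet> y j k))) \<partial>sphere_measure)"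
      using node(1) by (intro Bochner_Integration.integral_sum[symmetric] integrable_mult_left integrable_mult_zonal T) auto
    also have "\<dots> = (\<integral>z. T \<omega> z * (\<integral>u. poly (?P j) (z \<bullet> u) * poly (?P j) (x \<bullet> u) \<partial>sphere_measure) \<partial>sphere_measure)"
      unfolding quadj sum_distrib_left by (simp add: inner_commute mult_ac)
    also have "\<dots> = zonal_conv (?R j) (T \<omega>) x"
      unfolding zonal_conv_def using x
      by (intro Bochner_Integration.integral_cong refl) (simp add: zonal_sum_convolution[OF n])
    finally show ?thesis .
  qed
  have "needlet_approx d h N w y (Suc J) T \<omega> x = (\<Sum>j\<le>Suc J. zonal_conv (?R j) (T \<omega>) x)"
    unfolding needlet_approx_def level ..
  also have "\<dots> = (\<integral>z. (\<Sum>j\<le>Suc J. T \<omega> z * poly (?R j) (x \<bullet> z)) \<partial>sphere_measure)"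
    unfolding zonal_conv_def by (intro Bochner_Integration.integral_sum[symmetric] integrable_mult_zonal T x)
  also have "\<dots> = zonal_conv (\<Sum>j\<le>Suc J. ?R j) (T \<omega>) x"
    unfolding zonal_conv_def poly_sum sum_distrib_left ..
  finally show ?thesis unfolding sum_level_kernels[OF h] .
qed

section \<open>Isotropic random fields\<close>

lemma power_integrable_add:
  fixes f g :: "'a \<Rightarrow> real"
  assumes [measurable]: "f \<in> borel_measurable N" "g \<in> borel_measurable N"
    and int: "integrable N (\<lambda>u. \<bar>f u\<bar> ^ n)" "integrable N (\<lambda>u. \<bar>g u\<bar> ^ n)"
  shows "integrable N (\<lambda>u. \<bar>f u + g u\<bar> ^ n)"
proof (rule Bochner_Integration.integrable_bound)
  show "integrable N (\<lambda>u. 2 ^ n * (\<bar>f u\<bar> ^ n + \<bar>g u\<bar> ^ n))" using int by simp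
  have "\<bar>f u + g u\<bar> ^ n \<le> 2 ^ n * (\<bar>f u\<bar> ^ n + \<bar>g u\<bar> ^ n)" for u
    using power_mono[OF abs_triangle_ineq[of "f u" "g u"], of n] power_sum_le[of "\<bar>f u\<bar>" "\<bar>g u\<bar>" n] by simp
  then show "AE u in N. norm (\<bar>f u + g u\<bar> ^ n) \<le> norm (2 ^ n * (\<bar>f u\<bar> ^ n + \<bar>g u\<bar> ^ n))" by simp
qed measurable

lemma power_integrable_sum:
  fixes f :: "'i \<Rightarrow> 'a \<Rightarrow> real"
  assumes "n \<ge> 1" "finite I" "\<And>i. i \<in> I \<Longrightarrow> f i \<in> borel_measurable N" "\<And>i. i \<in> I \<Longrightarrow> integrable N (\<lambda>u. \<bar>f i u\<bar> ^ n)"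
  shows "integrable N (\<lambda>u. \<bar>\<Sum>i\<in>I. f i u\<bar> ^ n)"
  using assms(2-)
proof (induction I)
  case empty
  then show ?case using \<open>n \<ge> 1\<close> by (simp add: power_0_left)
next
  case (insert i I)
  then have "integrable N (\<lambda>u. \<bar>f i u + (\<Sum>i\<in>I. f i u)\<bar> ^ n)"
    by (intro power_integrable_add borel_measurable_sum) auto
  then show ?case using insert by simp
qed

text \<open>In place of Hoelder's inequality, all factors are dominated by the single function
  \<open>Y\<close>, the sum of 1, \<open>|g|\<close> and all \<open>|f i|\<close>; as
  \<open>Y\<close> is at least 1, its power \<open>card I + k\<close> lies below its
  \<open>n\<close>-th power.\<close>

lemma integrable_product:
  fixes f :: "'i \<Rightarrow> 'a \<Rightarrow> real"
  assumes N: "finite_measure N" and n: "n \<ge> 1" and I: "finite I" "card I + k \<le> n"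
    and f: "\<And>i. i \<in> I \<Longrightarrow> f i \<in> borel_measurable N" "\<And>i. i \<in> I \<Longrightarrow> integrable N (\<lambda>u. \<bar>f i u\<bar> ^ n)"
    and g: "g \<in> borel_measurable N" "integrable N (\<lambda>u. \<bar>g u\<bar> ^ n)"
  shows "integrable N (\<lambda>u. (\<Prod>i\<in>I. f i u) * g u ^ k)"
proof -
  interpret N: finite_measure N by fact
  define Y where "Y u = (1 + \<bar>g u\<bar>) + (\<Sum>i\<in>I. \<bar>f i u\<bar>)" for u
  have Y: "integrable N (\<lambda>u. \<bar>Y u\<bar> ^ n)"
    unfolding Y_def using f g
    by (intro power_integrable_add power_integrable_sum n I borel_measurable_sum borel_measurable_add borel_measurable_abs borel_measurable_const) auto
  have fY: "\<bar>f i u\<bar> \<le> Y u" if "i \<in> I" for i u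
    using member_le_sum[of i I "\<lambda>i. \<bar>f i u\<bar>"] that I(1) by (simp add: Y_def add_increasing)
  have gY: "\<bar>g u\<bar> \<le> Y u" "1 \<le> Y u" for u
    using sum_nonneg[of I "\<lambda>i. \<bar>f i u\<bar>"] by (simp_all add: Y_def add_increasing2)
  show ?thesis
  proof (rule Bochner_Integration.integrable_bound[OF Y])
    show "(\<lambda>u. (\<Prod>i\<in>I. f i u) * g u ^ k) \<in> borel_measurable N"
      using f g by (intro borel_measurable_times borel_measurable_prod borel_measurable_power) auto
    have "\<bar>(\<Prod>i\<in>I. f i u) * g u ^ k\<bar> \<le> \<bar>Y u\<bar> ^ n" for u
    proof -
      have "\<bar>(\<Prod>i\<in>I. f i u) * g u ^ k\<bar> = (\<Prod>i\<in>I. \<bar>f i u\<bar>) * \<bar>g u\<bar> ^ k"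
        by (simp add: abs_mult abs_prod power_abs)
      also have "\<dots> \<le> (\<Prod>i\<in>I. Y u) * Y u ^ k"
        using fY gY by (intro mult_mono prod_mono power_mono prod_nonneg) (auto intro: order_trans[OF zero_le_one])
      also have "\<dots> = Y u ^ (card I + k)" by (simp add: power_add)
      also have "\<dots> \<le> Y u ^ n" using gY I(2) by (intro power_increasing) auto
      finally show ?thesis using gY(2)[of u] by simp
    qed
    then show "AE u in N. norm ((\<Prod>i\<in>I. f i u) * g u ^ k) \<le> norm (\<bar>Y u\<bar> ^ n)" by simp
  qed
qed

section \<open>Moments of the field and of its zonal convolution\<close>

text \<open>The kernel \<open>q\<close> is an arbitrary polynomial, so the statements apply to the
  needlet kernel of every scale; the instance \<open>q = 0\<close> serves for facts about the field
  alone.\<close>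

locale isotropic_field = prob_space M for M :: "'w measure" +
  fixes T :: "'w \<Rightarrow> real ^ 'n \<Rightarrow> real" and n :: nat and q :: "real poly"
  assumes field: "random_field M T" and isotropic: "weakly_isotropic n M T"
    and n_even: "even n" and dim2: "2 \<le> CARD('n)"
begin

sublocale S: prob_space "sphere_measure :: (real ^ 'n) measure"
  by (rule prob_space_sphere_measure)

sublocale MS: pair_prob_space M "sphere_measure :: (real ^ 'n) measure" ..

lemma n_pos: "n \<ge> 1"
  using isotropic by (simp add: weakly_isotropic_def)

lemma measurable_field [measurable]: "case_prod T \<in> borel_measurable (M \<Otimes>\<^sub>M sphere_measure)"
  using field unfolding random_field_def
  by (subst measurable_cong_sets[OF sets_pair_measure_cong[OF refl sets_sphere_measure] refl])

lemma measurable_field' [measurable (raw)]: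
  assumes "f \<in> measurable N M" "g \<in> measurable N sphere_measure"
  shows "(\<lambda>u. T (f u) (g u)) \<in> borel_measurable N"
  using measurable_compose[OF measurable_Pair[OF assms] measurable_field] by simp

lemma measurable_at: "x \<in> sphere 0 1 \<Longrightarrow> (\<lambda>\<omega>. T \<omega> x) \<in> borel_measurable M"
  by (intro measurable_field' measurable_const) auto

lemma measurable_path: "\<omega> \<in> space M \<Longrightarrow> T \<omega> \<in> borel_measurable sphere_measure"
  by (intro measurable_field' measurable_const measurable_ident_sets) auto

definition moment :: real where
  "moment = (\<integral>\<omega>. \<bar>T \<omega> (axis undefined 1)\<bar> ^ n \<partial>M)"

lemma integrable_at: "x \<in> sphere 0 1 \<Longrightarrow> integrable M (\<lambda>\<omega>. \<bar>T \<omega> x\<bar> ^ n)"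
  using isotropic by (simp add: weakly_isotropic_def)

text \<open>Isotropy for \<open>n\<close> coinciding points; evenness of \<open>n\<close> turns
  \<open>|T|^n\<close> into a product of values of \<open>T\<close>.\<close>

lemma moment_at:
  assumes "x \<in> sphere 0 1"
  shows "(\<integral>\<omega>. \<bar>T \<omega> x\<bar> ^ n \<partial>M) = moment"
proof -
  let ?e = "axis undefined 1 :: real ^ 'n"
  obtain Q where Q: "rotation_matrix Q" "Q *v ?e = x"
    using unit_rotation[OF dim2, of ?e x] assms by auto
  have "(\<integral>\<omega>. (\<Prod>i=1..n. T \<omega> ?e) \<partial>M) = (\<integral>\<omega>. (\<Prod>i=1..n. T \<omega> (Q *v ?e)) \<partial>M)"
    using isotropic Q(1) n_pos unfolding weakly_isotropic_def
    by (elim conjE ballE[of _ _ n] allE[of _ "\<lambda>_. ?e"] allE[of _ Q]) auto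
  then show ?thesis using n_even by (simp add: Q(2) moment_def power_even_abs)
qed

text \<open>Tonelli: the \<open>n\<close>-th moment is finite and the same at every point, so its
  average over the probability measure on the sphere is finite.\<close>

lemma integrable_field_power: "integrable (M \<Otimes>\<^sub>M sphere_measure) (\<lambda>(\<omega>, y). \<bar>T \<omega> y\<bar> ^ n)"
proof (rule integrableI_bounded)
  have "(\<integral>\<^sup>+z. ennreal (norm (case z of (\<omega>, y) \<Rightarrow> \<bar>T \<omega> y\<bar> ^ n)) \<partial>(M \<Otimes>\<^sub>M sphere_measure))
    = (\<integral>\<^sup>+y. (\<integral>\<^sup>+\<omega>. ennreal (\<bar>T \<omega> y\<bar> ^ n) \<partial>M) \<partial>sphere_measure)"
    by (subst MS.nn_integral_snd[symmetric]) auto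
  also have "\<dots> = (\<integral>\<^sup>+y. ennreal moment \<partial>(sphere_measure :: (real ^ 'n) measure))"
    by (intro nn_integral_cong) (simp add: nn_integral_eq_integral integrable_at moment_at)
  also have "\<dots> < \<infinity>" by (simp add: S.emeasure_space_1[simplified])
  finally show "(\<integral>\<^sup>+z. ennreal (norm (case z of (\<omega>, y) \<Rightarrow> \<bar>T \<omega> y\<bar> ^ n)) \<partial>(M \<Otimes>\<^sub>M sphere_measure)) < \<infinity>" .
qed measurable

lemma AE_path_integrable: "AE \<omega> in M. integrable sphere_measure (\<lambda>y. \<bar>T \<omega> y\<bar> ^ n)"
  using MS.AE_integrable_fst'[OF integrable_field_power] by simp

definition V :: "'w \<Rightarrow> real ^ 'n \<Rightarrow> real" where
  "V \<omega> x = zonal_conv q (T \<omega>) x"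

lemma measurable_V [measurable]: "case_prod V \<in> borel_measurable (M \<Otimes>\<^sub>M sphere_measure)"
  unfolding V_def[abs_def] zonal_conv_def by measurable

lemma measurable_V_at [measurable (raw)]:
  assumes "f \<in> measurable N M" "g \<in> measurable N sphere_measure"
  shows "(\<lambda>u. V (f u) (g u)) \<in> borel_measurable N"
  using measurable_compose[OF measurable_Pair[OF assms] measurable_V] by simp

text \<open>Jensen along almost every path, with the kernel bounded by its maximum; the path
  integral of \<open>|T|^n\<close> is integrable by joint integrability.\<close>

lemma integrable_V_power:
  assumes x: "x \<in> sphere 0 1"
  shows "integrable M (\<lambda>\<omega>. \<bar>V \<omega> x\<bar> ^ n)"
proof -
  obtain B where B: "\<And>t. t \<in> {-1..1} \<Longrightarrow> \<bar>poly q t\<bar> \<le> B" using poly_bound_Icc by blast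
  have "B \<ge> 0" by (rule order_trans[OF abs_ge_zero[of "poly q 0"] B]) simp
  have [measurable]: "(\<lambda>\<omega>. V \<omega> x) \<in> borel_measurable M"
    using x by (intro measurable_V_at measurable_const) auto
  have Bx: "\<bar>poly q (x \<bullet> y)\<bar> \<le> B" if "y \<in> space sphere_measure" for y
    using that x by (intro B inner_sphere_Icc) auto
  \<comment> \<open>The summand 1 provides the strictly positive constant that Jensen's inequality
    asks for.\<close>
  have C: "(\<integral>y. \<bar>poly q (x \<bullet> y)\<bar> \<partial>sphere_measure) \<le> B + 1"
  proof -
    have "(\<integral>y. \<bar>poly q (x \<bullet> y)\<bar> \<partial>sphere_measure) \<le> (\<integral>y. B \<partial>(sphere_measure :: (real ^ 'n) measure))"
      by (intro integral_mono Bx integrable_sphere_continuous continuous_intros)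
    also have "\<dots> = B" using S.prob_space by simp
    finally show ?thesis by simp
  qed
  show ?thesis
  proof (rule Bochner_Integration.integrable_bound)
    have "integrable M (\<lambda>\<omega>. \<integral>y. \<bar>T \<omega> y\<bar> ^ n \<partial>sphere_measure)"
      using MS.integrable_fst'[OF integrable_field_power] by simp
    then show "integrable M (\<lambda>\<omega>. (B + 1) ^ (n - 1) * (B * (\<integral>y. \<bar>T \<omega> y\<bar> ^ n \<partial>sphere_measure)))"
      by (intro integrable_mult_right)
    show "AE \<omega> in M. norm (\<bar>V \<omega> x\<bar> ^ n) \<le> norm ((B + 1) ^ (n - 1) * (B * (\<integral>y. \<bar>T \<omega> y\<bar> ^ n \<partial>sphere_measure)))"
      using AE_path_integrable AE_space
    proof eventually_elim
      case (elim \<omega>)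
      have "\<bar>V \<omega> x\<bar> ^ n \<le> (B + 1) ^ (n - 1) * (\<integral>y. \<bar>T \<omega> y\<bar> ^ n * \<bar>poly q (x \<bullet> y)\<bar> \<partial>sphere_measure)"
        unfolding V_def using \<open>B \<ge> 0\<close> elim by (intro zonal_conv_jensen measurable_path n_pos x C) auto
      also have "(\<integral>y. \<bar>T \<omega> y\<bar> ^ n * \<bar>poly q (x \<bullet> y)\<bar> \<partial>sphere_measure) \<le> (\<integral>y. B * \<bar>T \<omega> y\<bar> ^ n \<partial>sphere_measure)"
      proof (intro integral_mono)
        show "integrable sphere_measure (\<lambda>y. \<bar>T \<omega> y\<bar> ^ n * \<bar>poly q (x \<bullet> y)\<bar>)"
          using integrable_abs[OF integrable_mult_zonal[OF elim(1) x]] by (simp add: abs_mult)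
        show "\<bar>T \<omega> y\<bar> ^ n * \<bar>poly q (x \<bullet> y)\<bar> \<le> B * \<bar>T \<omega> y\<bar> ^ n" if "y \<in> space sphere_measure" for y
          unfolding mult.commute[of B] by (intro mult_left_mono Bx that) simp
      qed (use elim in simp)
      also have "(\<integral>y. B * \<bar>T \<omega> y\<bar> ^ n \<partial>sphere_measure) = B * (\<integral>y. \<bar>T \<omega> y\<bar> ^ n \<partial>sphere_measure)" by simp
      finally show ?case using \<open>B \<ge> 0\<close> by (simp add: mult_left_mono)
    qed
  qed measurable
qed

lemma integrable_pair_fst:
  assumes "integrable M f"
  shows "integrable (M \<Otimes>\<^sub>M sphere_measure) (\<lambda>(\<omega>, y :: real ^ 'n). f \<omega> :: real)"
proof (rule integrableI_bounded)
  have [measurable]: "f \<in> borel_measurable M" using assms by simp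
  show "(\<lambda>(\<omega>, y :: real ^ 'n). f \<omega>) \<in> borel_measurable (M \<Otimes>\<^sub>M sphere_measure)" by measurable
  have "(\<integral>\<^sup>+z. ennreal (norm (case z of (\<omega>, y :: real ^ 'n) \<Rightarrow> f \<omega>)) \<partial>(M \<Otimes>\<^sub>M sphere_measure))
    = (\<integral>\<^sup>+\<omega>. (\<integral>\<^sup>+y. ennreal (norm (f \<omega>)) \<partial>(sphere_measure :: (real ^ 'n) measure)) \<partial>M)"
    by (subst S.nn_integral_fst[symmetric]) auto
  also have "\<dots> = (\<integral>\<^sup>+\<omega>. ennreal (norm (f \<omega>)) \<partial>M)" using S.emeasure_space_1 by simp
  also have "\<dots> < \<infinity>" using assms by (simp add: integrable_iff_bounded)
  finally show "(\<integral>\<^sup>+z. ennreal (norm (case z of (\<omega>, y :: real ^ 'n) \<Rightarrow> f \<omega>)) \<partial>(M \<Otimes>\<^sub>M sphere_measure)) < \<infinity>" .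
qed

lemma measurable_fst_at: "x \<in> sphere 0 1 \<Longrightarrow> (\<lambda>(\<omega>, y :: real ^ 'n). T \<omega> x) \<in> borel_measurable (M \<Otimes>\<^sub>M sphere_measure)"
  unfolding split_beta by (intro measurable_compose[OF measurable_fst measurable_at])

text \<open>Weak isotropy passes to the joint moments of \<open>T\<close> and the powers of its zonal convolution: one
  factor \<open>V \<omega> x = \<integral> T \<omega> y q (x \<bullet> y) dy\<close> at a time is replaced by a further evaluation point \<open>y\<close>.\<close>

lemma mixed_moment_rotation:
  assumes Q: "rotation_matrix Q" and x: "x \<in> sphere 0 1"
    and "m + k \<le> n" "\<And>i. i \<in> {1..m} \<Longrightarrow> p i \<in> sphere 0 1"
  shows "(\<integral>\<omega>. (\<Prod>i=1..m. T \<omega> (p i)) * V \<omega> x ^ k \<partial>M)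
    = (\<integral>\<omega>. (\<Prod>i=1..m. T \<omega> (Q *v p i)) * V \<omega> (Q *v x) ^ k \<partial>M)"
  using assms(3,4)
\<comment> \<open>Replacing one factor \<open>V\<close> lowers \<open>k\<close> and raises
  \<open>m\<close> by one, so \<open>m + k \<le> n\<close> is preserved while \<open>m\<close> and
  the points must vary.\<close>
proof (induction k arbitrary: m p)
  case 0
  show ?case
  \<comment> \<open>Isotropy concerns at least one point; for the empty product both sides are the
    integral of 1.\<close>
  proof (cases "m = 0")
    case False
    then have "m \<in> {1..n}" using 0 by auto
    then show ?thesis using isotropic Q 0(2) unfolding weakly_isotropic_def by simp
  qed simp
next
  case (Suc k)
  have o: "orthogonal_matrix Q" using Q by (simp add: rotation_matrix_def)
  have rot: "Q *v z \<in> sphere 0 1" if "z \<in> sphere 0 1" for z using that norm_orthogonal[OF o, of z] by simp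
  have expand: "(\<integral>\<omega>. (\<Prod>i=1..m. T \<omega> (p i)) * V \<omega> x ^ Suc k \<partial>M)
    = (\<integral>y. (\<integral>\<omega>. (\<Prod>i=1..Suc m. T \<omega> ((p(Suc m := y)) i)) * V \<omega> x ^ k \<partial>M) * poly q (x \<bullet> y) \<partial>sphere_measure)"
    if x: "x \<in> sphere 0 1" and p: "\<And>i. i \<in> {1..m} \<Longrightarrow> p i \<in> sphere 0 1" for x and p :: "nat \<Rightarrow> real ^ 'n"
  proof -
    let ?F = "\<lambda>\<omega> y. ((\<Prod>i=1..m. T \<omega> (p i)) * T \<omega> y) * V \<omega> x ^ k * poly q (x \<bullet> y)"
    have Vx: "(\<lambda>\<omega>. V \<omega> x) \<in> borel_measurable M"
      using x by (intro measurable_V_at measurable_const) auto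
    have prods: "(\<Prod>i=1..Suc m. T \<omega> ((p(Suc m := y)) i)) = (\<Prod>i=1..m. T \<omega> (p i)) * T \<omega> y" for \<omega> y
    proof -
      have "(\<Prod>i=1..m. T \<omega> ((p(Suc m := y)) i)) = (\<Prod>i=1..m. T \<omega> (p i))"
        by (intro prod.cong) auto
      then show ?thesis by simp
    qed
    \<comment> \<open>Factors on the product space: index \<open>Suc m\<close> carries the
      integration variable, the others a fixed point. Fubini requires joint integrability of their
      product with the power of \<open>V\<close>.\<close>
    define f where "f i u = (if i = Suc m then T (fst u) (snd u) else T (fst u) (p i))" for i and u :: "'w \<times> (real ^ 'n)"
    have meas_f: "f i \<in> borel_measurable (M \<Otimes>\<^sub>M sphere_measure)" if "i \<in> {1..Suc m}" for i
      using that measurable_field measurable_fst_at[of "p i"] p[of i] unfolding f_def split_beta by (cases "i = Suc m") auto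
    have int_f: "integrable (M \<Otimes>\<^sub>M sphere_measure) (\<lambda>u. \<bar>f i u\<bar> ^ n)" if "i \<in> {1..Suc m}" for i
      using that integrable_field_power integrable_pair_fst[OF integrable_at[of "p i"]] p[of i]
      unfolding f_def split_beta by (cases "i = Suc m") auto
    have "integrable (M \<Otimes>\<^sub>M sphere_measure) (\<lambda>u. (\<Prod>i\<in>{1..Suc m}. f i u) * (\<lambda>u. V (fst u) x) u ^ k)"
    proof (intro integrable_product[where n = n] meas_f int_f n_pos)
      show "finite_measure (M \<Otimes>\<^sub>M (sphere_measure :: (real ^ 'n) measure))" by unfold_locales
      show "card {1..Suc m} + k \<le> n" using Suc.prems by simp
      show "(\<lambda>u. V (fst u) x) \<in> borel_measurable (M \<Otimes>\<^sub>M (sphere_measure :: (real ^ 'n) measure))"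
        by (intro measurable_compose[OF measurable_fst Vx])
      show "integrable (M \<Otimes>\<^sub>M sphere_measure) (\<lambda>u :: 'w \<times> (real ^ 'n). \<bar>V (fst u) x\<bar> ^ n)"
        using integrable_pair_fst[OF integrable_V_power[OF x]] by (simp add: case_prod_unfold)
    qed auto
    also have "(\<lambda>u. (\<Prod>i\<in>{1..Suc m}. f i u) * V (fst u) x ^ k) = (\<lambda>(\<omega>, y). ((\<Prod>i=1..m. T \<omega> (p i)) * T \<omega> y) * V \<omega> x ^ k)"
    proof
      fix u :: "'w \<times> (real ^ 'n)"
      have "(\<Prod>i=1..m. f i u) = (\<Prod>i=1..m. T (fst u) (p i))" by (intro prod.cong) (auto simp: f_def)
      then show "(\<Prod>i\<in>{1..Suc m}. f i u) * V (fst u) x ^ k = (case u of (\<omega>, y) \<Rightarrow> ((\<Prod>i=1..m. T \<omega> (p i)) * T \<omega> y) * V \<omega> x ^ k)"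
        by (simp add: f_def split_beta)
    qed
    finally have int: "integrable (M \<Otimes>\<^sub>M sphere_measure) (\<lambda>(\<omega>, y). ((\<Prod>i=1..m. T \<omega> (p i)) * T \<omega> y) * V \<omega> x ^ k)" .
    have intF: "integrable (M \<Otimes>\<^sub>M sphere_measure) (case_prod ?F)"
    proof -
      obtain B where B: "\<And>t. t \<in> {-1..1} \<Longrightarrow> \<bar>poly q t\<bar> \<le> B" using poly_bound_Icc by blast
      have "B \<ge> 0" by (rule order_trans[OF abs_ge_zero[of "poly q 0"] B]) simp
      have xq: "(\<lambda>u. poly q (x \<bullet> snd u)) \<in> borel_measurable (M \<Otimes>\<^sub>M (sphere_measure :: (real ^ 'n) measure))"
        by measurable
      show ?thesis
      proof (rule Bochner_Integration.integrable_bound[OF integrable_mult_right[OF int, of B]])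
        show "case_prod ?F \<in> borel_measurable (M \<Otimes>\<^sub>M sphere_measure)"
          using borel_measurable_times[OF borel_measurable_integrable[OF int] xq] by (simp add: split_beta)
        show "AE u in M \<Otimes>\<^sub>M sphere_measure. norm (case u of (\<omega>, y) \<Rightarrow> ?F \<omega> y)
          \<le> norm (B * (case u of (\<omega>, y) \<Rightarrow> ((\<Prod>i=1..m. T \<omega> (p i)) * T \<omega> y) * V \<omega> x ^ k))"
        proof (rule AE_I2)
          fix u assume "u \<in> space (M \<Otimes>\<^sub>M (sphere_measure :: (real ^ 'n) measure))"
          then have "\<bar>poly q (x \<bullet> snd u)\<bar> \<le> B"
            using x by (intro B inner_sphere_Icc) (auto simp: space_pair_measure)
          then have "\<bar>poly q (x \<bullet> snd u)\<bar> * \<bar>a\<bar> \<le> B * \<bar>a\<bar>" for a by (intro mult_right_mono) auto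
          from this[of "((\<Prod>i=1..m. T (fst u) (p i)) * T (fst u) (snd u)) * V (fst u) x ^ k"]
          show "norm (case u of (\<omega>, y) \<Rightarrow> ?F \<omega> y)
            \<le> norm (B * (case u of (\<omega>, y) \<Rightarrow> ((\<Prod>i=1..m. T \<omega> (p i)) * T \<omega> y) * V \<omega> x ^ k))"
            using \<open>B \<ge> 0\<close> by (simp add: split_beta abs_mult mult_ac)
        qed
      qed
    qed
    have "(\<integral>\<omega>. (\<Prod>i=1..m. T \<omega> (p i)) * V \<omega> x ^ Suc k \<partial>M) = (\<integral>\<omega>. (\<integral>y. ?F \<omega> y \<partial>sphere_measure) \<partial>M)"
    proof (intro Bochner_Integration.integral_cong refl)
      fix \<omega>
      have "(\<integral>y. ?F \<omega> y \<partial>sphere_measure) = (\<integral>y. ((\<Prod>i=1..m. T \<omega> (p i)) * V \<omega> x ^ k) * (T \<omega> y * poly q (x \<bullet> y)) \<partial>sphere_measure)"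
        by (intro Bochner_Integration.integral_cong refl) (simp only: mult_ac)
      also have "\<dots> = ((\<Prod>i=1..m. T \<omega> (p i)) * V \<omega> x ^ k) * V \<omega> x"
        by (simp only: integral_mult_right_zero V_def zonal_conv_def)
      finally show "(\<Prod>i=1..m. T \<omega> (p i)) * V \<omega> x ^ Suc k = (\<integral>y. ?F \<omega> y \<partial>sphere_measure)"
        by (simp add: mult_ac)
    qed
    also have "\<dots> = (\<integral>y. (\<integral>\<omega>. ?F \<omega> y \<partial>M) \<partial>sphere_measure)"
      by (rule MS.Fubini_integral[OF intF, symmetric])
    also have "\<dots> = (\<integral>y. (\<integral>\<omega>. (\<Prod>i=1..Suc m. T \<omega> ((p(Suc m := y)) i)) * V \<omega> x ^ k \<partial>M) * poly q (x \<bullet> y) \<partial>sphere_measure)"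
      by (simp only: integral_mult_left_zero prods)
    finally show ?thesis .
  qed
  \<comment> \<open>The integrand at the rotated points, as a function of the rotated integration
    variable. The induction hypothesis produces \<open>G (Q *v y)\<close>, invariance of the sphere
    measure removes the rotation, and \<open>expand\<close> read backwards reassembles the power of
    \<open>V\<close>.\<close>
  define G where "G y = (\<integral>\<omega>. (\<Prod>i=1..Suc m. T \<omega> (((\<lambda>i. Q *v p i)(Suc m := y)) i)) * V \<omega> (Q *v x) ^ k \<partial>M) * poly q ((Q *v x) \<bullet> y)" for y
  have "(\<integral>\<omega>. (\<Prod>i=1..m. T \<omega> (p i)) * V \<omega> x ^ Suc k \<partial>M)
    = (\<integral>y. (\<integral>\<omega>. (\<Prod>i=1..Suc m. T \<omega> ((p(Suc m := y)) i)) * V \<omega> x ^ k \<partial>M) * poly q (x \<bullet> y) \<partial>sphere_measure)"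
    using Suc.prems by (intro expand x) auto
  also have "\<dots> = (\<integral>y. G (Q *v y) \<partial>sphere_measure)"
  proof (intro Bochner_Integration.integral_cong refl)
    fix y :: "real ^ 'n" assume "y \<in> space sphere_measure"
    then have y: "y \<in> sphere 0 1" by simp
    have "(\<integral>\<omega>. (\<Prod>i=1..Suc m. T \<omega> ((p(Suc m := y)) i)) * V \<omega> x ^ k \<partial>M)
      = (\<integral>\<omega>. (\<Prod>i=1..Suc m. T \<omega> (Q *v (p(Suc m := y)) i)) * V \<omega> (Q *v x) ^ k \<partial>M)"
      using Suc.prems y by (intro Suc.IH) auto
    moreover have "Q *v (p(Suc m := y)) i = ((\<lambda>i. Q *v p i)(Suc m := Q *v y)) i" for i by simp
    ultimately show "(\<integral>\<omega>. (\<Prod>i=1..Suc m. T \<omega> ((p(Suc m := y)) i)) * V \<omega> x ^ k \<partial>M) * poly q (x \<bullet> y) = G (Q *v y)"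
      by (simp only: G_def inner_orthogonal[OF o])
  qed
  also have "\<dots> = (\<integral>y. G y \<partial>sphere_measure)"
  proof (rule integral_sphere_orthogonal[OF o])
    show "G \<in> borel_measurable sphere_measure"
    proof -
      have Vx: "(\<lambda>\<omega>. V \<omega> (Q *v x)) \<in> borel_measurable M"
        using rot[OF x] by (intro measurable_V_at measurable_const) auto
      have Tp: "(\<lambda>\<omega>. T \<omega> (Q *v p i)) \<in> borel_measurable M" if "i \<in> {1..m}" for i
        using that Suc.prems by (intro measurable_at rot) auto
      have 1: "(\<Prod>i=1..Suc m. T \<omega> (((\<lambda>i. Q *v p i)(Suc m := y)) i)) = (\<Prod>i=1..m. T \<omega> (Q *v p i)) * T \<omega> y" for \<omega> y
      proof -
        have "(\<Prod>i=1..m. T \<omega> (((\<lambda>i. Q *v p i)(Suc m := y)) i)) = (\<Prod>i=1..m. T \<omega> (Q *v p i))"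
          by (intro prod.cong) auto
        then show ?thesis by simp
      qed
      define A where "A \<omega> = (\<Prod>i=1..m. T \<omega> (Q *v p i)) * V \<omega> (Q *v x) ^ k" for \<omega>
      have [measurable]: "A \<in> borel_measurable M"
        unfolding A_def[abs_def] using Tp Vx by (intro borel_measurable_times borel_measurable_prod borel_measurable_power) auto
      have "G = (\<lambda>y. (\<integral>\<omega>. A \<omega> * T \<omega> y \<partial>M) * poly q ((Q *v x) \<bullet> y))"
        unfolding G_def[abs_def] 1 A_def by (simp only: mult_ac)
      also have "\<dots> \<in> borel_measurable sphere_measure" by measurable
      finally show ?thesis .
    qed
  qed
  also have "\<dots> = (\<integral>\<omega>. (\<Prod>i=1..m. T \<omega> (Q *v p i)) * V \<omega> (Q *v x) ^ Suc k \<partial>M)"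
    unfolding G_def using Suc.prems by (intro expand[symmetric] rot x) auto
  finally show ?case .
qed

lemma integrable_error: "x \<in> sphere 0 1 \<Longrightarrow> integrable M (\<lambda>\<omega>. \<bar>T \<omega> x - V \<omega> x\<bar> ^ n)"
  using power_integrable_add[of "\<lambda>\<omega>. T \<omega> x" M "\<lambda>\<omega>. - V \<omega> x"] integrable_V_power[of x] integrable_at[of x] measurable_at[of x]
    measurable_V_at[OF measurable_ident_sets[OF refl] measurable_const[of x sphere_measure]]
  by simp

text \<open>For even \<open>n\<close> the absolute value disappears, and the binomial theorem
  expresses the moment through mixed moments with all evaluation points equal to
  \<open>x\<close>.\<close>

lemma error_moment_rotation:
  assumes Q: "rotation_matrix Q" and x: "x \<in> sphere 0 1"
  shows "(\<integral>\<omega>. \<bar>T \<omega> x - V \<omega> x\<bar> ^ n \<partial>M) = (\<integral>\<omega>. \<bar>T \<omega> (Q *v x) - V \<omega> (Q *v x)\<bar> ^ n \<partial>M)"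
proof -
  have expand: "(\<integral>\<omega>. \<bar>T \<omega> x - V \<omega> x\<bar> ^ n \<partial>M)
    = (\<Sum>k\<le>n. real (n choose k) * (- 1) ^ (n - k) * (\<integral>\<omega>. (\<Prod>i=1..k. T \<omega> x) * V \<omega> x ^ (n - k) \<partial>M))"
    if x: "x \<in> sphere 0 1" for x
  proof -
    have Vx: "(\<lambda>\<omega>. V \<omega> x) \<in> borel_measurable M"
      using x by (intro measurable_V_at measurable_const) auto
    have int: "integrable M (\<lambda>\<omega>. (\<Prod>i\<in>{1..k}. T \<omega> x) * V \<omega> x ^ (n - k))" if "k \<le> n" for k
      using that by (intro integrable_product[where n = n] finite_measure_axioms n_pos Vx integrable_V_power integrable_at measurable_at x) auto
    have "\<bar>T \<omega> x - V \<omega> x\<bar> ^ n = (\<Sum>k\<le>n. real (n choose k) * (- 1) ^ (n - k) * ((\<Prod>i=1..k. T \<omega> x) * V \<omega> x ^ (n - k)))" for \<omega>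
    proof -
      have "\<bar>T \<omega> x - V \<omega> x\<bar> ^ n = (T \<omega> x + (- V \<omega> x)) ^ n" using n_even by (simp add: power_even_abs)
      also have "\<dots> = (\<Sum>k\<le>n. real (n choose k) * T \<omega> x ^ k * (- V \<omega> x) ^ (n - k))" by (rule binomial_ring)
      finally show ?thesis by (simp add: power_minus[of "V \<omega> x"] mult_ac)
    qed
    then have "(\<integral>\<omega>. \<bar>T \<omega> x - V \<omega> x\<bar> ^ n \<partial>M)
      = (\<Sum>k\<le>n. \<integral>\<omega>. real (n choose k) * (- 1) ^ (n - k) * ((\<Prod>i=1..k. T \<omega> x) * V \<omega> x ^ (n - k)) \<partial>M)"
      by (simp only:) (intro Bochner_Integration.integral_sum integrable_mult_right int, simp)
    then show ?thesis by (simp only: integral_mult_right_zero)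
  qed
  have "orthogonal_matrix Q" using Q by (simp add: rotation_matrix_def)
  then have Qx: "Q *v x \<in> sphere 0 1" using x norm_orthogonal[of Q x] by simp
  show ?thesis unfolding expand[OF x] expand[OF Qx]
    by (intro sum.cong refl arg_cong2[where f = "(*)"] mixed_moment_rotation[OF Q x]) (use x in auto)
qed

lemma error_moment_eq:
  assumes x: "x \<in> sphere 0 1"
  shows "(\<integral>\<^sup>+\<omega>. ennreal (\<bar>T \<omega> x - V \<omega> x\<bar> ^ n) \<partial>M)
    = (\<integral>\<^sup>+\<omega>. (\<integral>\<^sup>+z. ennreal (\<bar>T \<omega> z - V \<omega> z\<bar> ^ n) \<partial>sphere_measure) \<partial>M)"
proof -
  have "(\<integral>\<^sup>+\<omega>. ennreal (\<bar>T \<omega> x - V \<omega> x\<bar> ^ n) \<partial>M) = (\<integral>\<^sup>+\<omega>. ennreal (\<bar>T \<omega> z - V \<omega> z\<bar> ^ n) \<partial>M)"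
    if z: "z \<in> sphere 0 1" for z
  proof -
    obtain Q where "rotation_matrix Q" "Q *v x = z"
      using unit_rotation[OF dim2, of x z] x z by auto
    then show ?thesis
      using error_moment_rotation[of Q x] x z by (simp add: nn_integral_eq_integral integrable_error)
  qed
  then have eq: "(\<integral>\<^sup>+\<omega>. ennreal (\<bar>T \<omega> x - V \<omega> x\<bar> ^ n) \<partial>M) = (\<integral>\<^sup>+\<omega>. ennreal (\<bar>T \<omega> z - V \<omega> z\<bar> ^ n) \<partial>M)"
    if "z \<in> space sphere_measure" for z
    using that by (simp only: space_sphere_measure)
  have "(\<integral>\<^sup>+z. (\<integral>\<^sup>+\<omega>. ennreal (\<bar>T \<omega> x - V \<omega> x\<bar> ^ n) \<partial>M) \<partial>(sphere_measure :: (real ^ 'n) measure))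
    = (\<integral>\<^sup>+z. (\<integral>\<^sup>+\<omega>. ennreal (\<bar>T \<omega> z - V \<omega> z\<bar> ^ n) \<partial>M) \<partial>sphere_measure)"
    by (rule nn_integral_cong) (rule eq)
  also have "\<dots> = (\<integral>\<^sup>+\<omega>. (\<integral>\<^sup>+z. ennreal (\<bar>T \<omega> z - V \<omega> z\<bar> ^ n) \<partial>sphere_measure) \<partial>M)"
    by (rule MS.Fubini') measurable
  finally show ?thesis using S.emeasure_space_1 by simp
qed

end

section \<open>From the even moment to the exponent \<open>p\<close>, and the limit\<close>

lemma even_ceiling: "even (even_ceiling p)" "p \<le> real (even_ceiling p)"
proof -
  have "even (2 * nat \<lceil>p\<rceil>)" "p \<le> real (2 * nat \<lceil>p\<rceil>)" by simp linarith
  then have "\<exists>n. even n \<and> p \<le> real n" by blast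
  then have "even (even_ceiling p) \<and> p \<le> real (even_ceiling p)"
    unfolding even_ceiling_def by (rule LeastI_ex)
  then show "even (even_ceiling p)" "p \<le> real (even_ceiling p)" by simp_all
qed

text \<open>Comparison of powers: for \<open>t \<ge> 0\<close> and every positive \<delta> one has
  \<open>t^p \<le> \<delta>^p + \<delta>^(p - n) t^n\<close>, by monotonicity if
  \<open>t \<le> \<delta>\<close> and because \<open>p - n \<le> 0\<close> otherwise.\<close>

lemma (in prob_space) Lp_tendsto_zero_of_power:
  fixes X :: "nat \<Rightarrow> 'a \<Rightarrow> real"
  assumes [measurable]: "\<And>J. X J \<in> borel_measurable M" and "0 < p" "p \<le> real n"
    and lim: "(\<lambda>J. \<integral>\<^sup>+\<omega>. ennreal (\<bar>X J \<omega>\<bar> ^ n) \<partial>M) \<longlonglongrightarrow> 0"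
  shows "(\<lambda>J. \<integral>\<^sup>+\<omega>. ennreal (\<bar>X J \<omega>\<bar> powr p) \<partial>M) \<longlonglongrightarrow> 0"
proof (rule order_tendstoI)
  fix a :: ennreal assume "a > 0"
  then obtain \<epsilon> where \<epsilon>: "\<epsilon> > 0" "ennreal \<epsilon> < a"
    by (metis dense ennreal_cases ennreal_less_zero_iff less_top not_less_iff_gr_or_eq top_greatest)
  \<comment> \<open>Makes \<open>\<delta> powr p\<close> equal to \<open>\<epsilon> / 2\<close>; the
    other term will contribute at most \<open>\<epsilon> / 4\<close>.\<close>
  define \<delta> where "\<delta> = (\<epsilon> / 2) powr (1 / p)"
  have \<delta>: "\<delta> > 0" "\<delta> powr p = \<epsilon> / 2"
    using \<epsilon>(1) \<open>0 < p\<close> by (simp_all add: \<delta>_def powr_powr)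
  define K where "K = \<delta> powr (p - real n)"
  have "K > 0" using \<delta>(1) by (simp add: K_def)
  have pw: "t powr p \<le> \<epsilon> / 2 + K * t ^ n" if "t \<ge> 0" for t
  proof (cases "t \<le> \<delta>")
    case True
    then have "t powr p \<le> \<delta> powr p" using that \<open>0 < p\<close> by (intro powr_mono2) auto
    then show ?thesis using \<delta>(2) \<open>K > 0\<close> that by (simp add: add_increasing2)
  next
    case False
    then have "t > 0" using \<delta>(1) by simp
    have "t powr p = t powr (p - real n) * t powr real n" by (simp add: powr_add[symmetric])
    also have "\<dots> = t powr (p - real n) * t ^ n" using \<open>t > 0\<close> by (simp add: powr_realpow)
    also have "\<dots> \<le> K * t ^ n"
      unfolding K_def using False \<delta>(1) that assms(3) by (intro mult_right_mono powr_mono2') auto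
    finally show ?thesis using \<epsilon>(1) by simp
  qed
  have "\<epsilon> / (4 * K) > 0" using \<epsilon> \<open>K > 0\<close> by simp
  then have "\<forall>\<^sub>F J in sequentially. (\<integral>\<^sup>+\<omega>. ennreal (\<bar>X J \<omega>\<bar> ^ n) \<partial>M) < ennreal (\<epsilon> / (4 * K))"
    using order_tendstoD(2)[OF lim, of "ennreal (\<epsilon> / (4 * K))"] by simp
  then show "\<forall>\<^sub>F J in sequentially. (\<integral>\<^sup>+\<omega>. ennreal (\<bar>X J \<omega>\<bar> powr p) \<partial>M) < a"
  proof eventually_elim
    case (elim J)
    have "(\<integral>\<^sup>+\<omega>. ennreal (\<bar>X J \<omega>\<bar> powr p) \<partial>M) \<le> (\<integral>\<^sup>+\<omega>. ennreal (\<epsilon> / 2) + ennreal K * ennreal (\<bar>X J \<omega>\<bar> ^ n) \<partial>M)"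
      using \<epsilon>(1) \<open>K > 0\<close> pw[OF abs_ge_zero]
      by (intro nn_integral_mono) (simp add: ennreal_mult'[symmetric] ennreal_plus[symmetric] ennreal_leI del: ennreal_plus)
    also have "\<dots> = ennreal (\<epsilon> / 2) + ennreal K * (\<integral>\<^sup>+\<omega>. ennreal (\<bar>X J \<omega>\<bar> ^ n) \<partial>M)"
      by (subst nn_integral_add) (auto simp: nn_integral_cmult emeasure_space_1)
    also have "\<dots> \<le> ennreal (\<epsilon> / 2) + ennreal K * ennreal (\<epsilon> / (4 * K))"
      using elim by (intro add_left_mono mult_left_mono) auto
    also have "\<dots> = ennreal (\<epsilon> / 2 + K * (\<epsilon> / (4 * K)))"
      using \<epsilon>(1) \<open>K > 0\<close> by (subst ennreal_plus) (auto simp: ennreal_mult'[symmetric])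
    also have "\<dots> \<le> ennreal \<epsilon>" using \<epsilon>(1) \<open>K > 0\<close> by (intro ennreal_leI) (simp add: field_simps)
    finally show ?case using \<epsilon>(2) by simp
  qed
qed simp

context isotropic_field
begin

lemma measurable_path_error: "(\<lambda>\<omega>. \<integral>\<^sup>+z. ennreal (\<bar>T \<omega> z - V \<omega> z\<bar> ^ n) \<partial>sphere_measure) \<in> borel_measurable M"
  by measurable

lemma measurable_path_moment: "(\<lambda>\<omega>. \<integral>\<^sup>+z. ennreal (\<bar>T \<omega> z\<bar> ^ n) \<partial>sphere_measure) \<in> borel_measurable M"
  by measurable

lemma path_moment_finite: "(\<integral>\<^sup>+\<omega>. (\<integral>\<^sup>+z. ennreal (\<bar>T \<omega> z\<bar> ^ n) \<partial>sphere_measure) \<partial>M) < \<infinity>"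
proof -
  have "(\<integral>\<^sup>+\<omega>. (\<integral>\<^sup>+z. ennreal (\<bar>T \<omega> z\<bar> ^ n) \<partial>sphere_measure) \<partial>M)
    = (\<integral>\<^sup>+u. ennreal (norm (case u of (\<omega>, y) \<Rightarrow> \<bar>T \<omega> y\<bar> ^ n)) \<partial>(M \<Otimes>\<^sub>M sphere_measure))"
    by (subst S.nn_integral_fst[symmetric]) auto
  also have "\<dots> < \<infinity>" using integrable_field_power unfolding integrable_iff_bounded by blast
  finally show ?thesis .
qed

lemma AE_path: "AE \<omega> in M. T \<omega> \<in> borel_measurable sphere_measure \<and> integrable sphere_measure (\<lambda>y. \<bar>T \<omega> y\<bar> ^ n)
  \<and> integrable sphere_measure (T \<omega>)"
  using AE_path_integrable AE_space
proof eventually_elim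
  case (elim \<omega>)
  have T: "T \<omega> \<in> borel_measurable sphere_measure" using elim by (intro measurable_path)
  have "integrable sphere_measure (\<lambda>y. \<bar>T \<omega> y\<bar> ^ 1)"
    by (rule integrable_power_imp_integrable[OF S.finite_measure_axioms T elim(1) n_pos])
  then show ?case using T elim by (simp add: integrable_abs_iff)
qed

end

theorem theorem3p5:
  fixes d \<kappa> :: nat and p :: real
    and M :: "'w measure"
    and T :: "'w \<Rightarrow> real ^ 'n \<Rightarrow> real"
    and h :: "real \<Rightarrow> real"
    and N :: "nat \<Rightarrow> nat"
    and w :: "nat \<Rightarrow> nat \<Rightarrow> real"
    and y :: "nat \<Rightarrow> nat \<Rightarrow> real ^ 'n"
    and x :: "real ^ 'n"
  assumes "d \<ge> 2" and "CARD('n) = d + 1"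
    and "p \<ge> 1"
    and "prob_space M"
    and "random_field M T"
    and "weakly_isotropic (even_ceiling p) M T"
    and "needlet_filter \<kappa> h"
    and "int \<kappa> \<ge> \<lfloor>(real d + 3) / 2\<rfloor>"
    and "needlet_quadrature N w y"
    and "x \<in> sphere 0 1"
  shows "(\<lambda>J. \<integral>\<^sup>+ \<omega>. ennreal (\<bar>T \<omega> x - needlet_approx d h N w y J T \<omega> x\<bar> powr p) \<partial>M)
           \<longlonglongrightarrow> 0"
proof -
  interpret prob_space M by fact
  note dims = \<open>CARD('n) = d + 1\<close> \<open>d \<ge> 2\<close>
  define n where "n = even_ceiling p"
  define q where "q J = needlet_kernel d \<kappa> h (2 ^ J)" for J
  have iso: "isotropic_field M T n"
    using assms even_ceiling(1)[of p] by unfold_locales (simp_all add: n_def)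
  interpret I: isotropic_field M T n 0 by (rule iso)
  have V: "isotropic_field.V T q \<omega> z = zonal_conv q (T \<omega>) z" for q \<omega> z
    by (rule isotropic_field.V_def[OF iso])
  \<comment> \<open>For even \<open>d\<close> the two bounds coincide; for odd \<open>d\<close> the
    hypothesis exceeds this one by 1.\<close>
  have "\<kappa> \<ge> d div 2 + 1"
  proof -
    have "real_of_int (int (d div 2 + 1)) \<le> (real d + 3) / 2"
    proof -
      have "2 * (d div 2) \<le> d" by simp
      then have "real (2 * (d div 2)) \<le> real d" by (simp only: of_nat_le_iff)
      then show ?thesis by simp
    qed
    then have "int (d div 2 + 1) \<le> \<lfloor>(real d + 3) / 2\<rfloor>" by (simp only: le_floor_iff)
    then show ?thesis using assms(8) by linarith
  qed
  then obtain C L0 where C: "C > 0" "\<And>L x. L \<ge> L0 \<Longrightarrow> x \<in> sphere (0 :: real ^ 'n) 1 \<Longrightarrow>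
      (\<integral>z. \<bar>poly (needlet_kernel d \<kappa> h L) (x \<bullet> z)\<bar> \<partial>sphere_measure) \<le> C"
    using needlet_kernel_L1[OF dims assms(7)] by blast
  define u where "u J \<omega> = (\<integral>\<^sup>+z. ennreal (\<bar>T \<omega> z - zonal_conv (q J) (T \<omega>) z\<bar> ^ n) \<partial>sphere_measure)" for J \<omega>
  let ?I = "\<lambda>\<omega>. \<integral>\<^sup>+z. ennreal (\<bar>T \<omega> z\<bar> ^ n) \<partial>sphere_measure"
  have u_meas: "u J \<in> borel_measurable M" for J
    using isotropic_field.measurable_path_error[OF iso, where q = "q J"] unfolding u_def[abs_def] V .
  \<comment> \<open>The shift puts every scale \<open>2^(J + L0)\<close> above \<open>L0\<close>, so
    the \<open>L_1\<close> bound holds for all terms and one dominating function serves the whole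
    sequence.\<close>
  have "(\<lambda>J. \<integral>\<^sup>+\<omega>. u (J + L0) \<omega> \<partial>M) \<longlonglongrightarrow> (\<integral>\<^sup>+\<omega>. 0 \<partial>M)"
  proof (rule nn_integral_dominated_convergence[where w = "\<lambda>\<omega>. ennreal (2 ^ n * (1 + C ^ n)) * ?I \<omega>"])
    have "(\<integral>\<^sup>+\<omega>. ennreal (2 ^ n * (1 + C ^ n)) * ?I \<omega> \<partial>M) = ennreal (2 ^ n * (1 + C ^ n)) * (\<integral>\<^sup>+\<omega>. ?I \<omega> \<partial>M)"
      by (rule nn_integral_cmult[OF I.measurable_path_moment])
    also have "\<dots> < \<infinity>" using I.path_moment_finite by (simp add: ennreal_mult_less_top)
    finally show "(\<integral>\<^sup>+\<omega>. ennreal (2 ^ n * (1 + C ^ n)) * ?I \<omega> \<partial>M) < \<infinity>" .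
    have L0: "L0 \<le> 2 ^ (J + L0)" for J
      using less_exp[of "J + L0"] by linarith
    show "AE \<omega> in M. u (J + L0) \<omega> \<le> ennreal (2 ^ n * (1 + C ^ n)) * ?I \<omega>" for J
      using I.AE_path
    proof eventually_elim
      case (elim \<omega>)
      then show ?case unfolding u_def q_def
        by (intro zonal_conv_residual_bound I.n_pos C L0) auto
    qed
    show "AE \<omega> in M. (\<lambda>J. u (J + L0) \<omega>) \<longlonglongrightarrow> 0"
      using I.AE_path
    proof eventually_elim
      case (elim \<omega>)
      have pow: "filterlim (\<lambda>J. 2 ^ J :: nat) at_top sequentially"
        by (rule filterlim_subseq, rule strict_monoI) simp
      define F where "F L = (\<integral>\<^sup>+z. ennreal (\<bar>T \<omega> z - zonal_conv (needlet_kernel d \<kappa> h L) (T \<omega>) z\<bar> ^ n) \<partial>sphere_measure)" for L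
      have "F \<longlonglongrightarrow> 0" unfolding F_def[abs_def]
      proof (rule zonal_conv_needlet_kernel_tendsto[OF dims I.n_pos C(1), where ?L0.0 = L0])
        show "(\<integral>y. \<bar>poly (needlet_kernel d \<kappa> h L) (x \<bullet> y)\<bar> \<partial>sphere_measure) \<le> C"
          if "L \<ge> L0" "x \<in> sphere (0 :: real ^ 'n) 1" for L x
          using that by (rule C(2))
      qed (use elim in blast)+
      then have "(\<lambda>J. F (2 ^ J)) \<longlonglongrightarrow> 0" using pow by (rule filterlim_compose)
      then have "(\<lambda>J. u J \<omega>) \<longlonglongrightarrow> 0" by (simp only: F_def u_def q_def)
      then show ?case using LIMSEQ_ignore_initial_segment[of "\<lambda>J. u J \<omega>" 0 L0] by simp
    qed
  qed (use u_meas I.measurable_path_moment in auto)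
  then have "(\<lambda>J. \<integral>\<^sup>+\<omega>. u J \<omega> \<partial>M) \<longlonglongrightarrow> 0"
    using LIMSEQ_offset[of "\<lambda>J. \<integral>\<^sup>+\<omega>. u J \<omega> \<partial>M" L0 0] by simp
  moreover have "(\<integral>\<^sup>+\<omega>. u J \<omega> \<partial>M) = (\<integral>\<^sup>+\<omega>. ennreal (\<bar>T \<omega> x - zonal_conv (q J) (T \<omega>) x\<bar> ^ n) \<partial>M)" for J
    using isotropic_field.error_moment_eq[OF iso assms(10), where q = "q J"] unfolding V u_def by simp
  ultimately have "(\<lambda>J. \<integral>\<^sup>+\<omega>. ennreal (\<bar>T \<omega> x - zonal_conv (q J) (T \<omega>) x\<bar> ^ n) \<partial>M) \<longlonglongrightarrow> 0"
    by simp
  moreover have "(\<lambda>\<omega>. T \<omega> x - zonal_conv (q J) (T \<omega>) x) \<in> borel_measurable M" for J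
  proof -
    interpret IJ: isotropic_field M T n "q J" by (rule iso)
    have "(\<lambda>\<omega>. T \<omega> x - IJ.V \<omega> x) \<in> borel_measurable M"
      using assms(10) by (intro borel_measurable_diff IJ.measurable_at IJ.measurable_V_at measurable_const) auto
    then show ?thesis unfolding V .
  qed
  ultimately have "(\<lambda>J. \<integral>\<^sup>+\<omega>. ennreal (\<bar>T \<omega> x - zonal_conv (q J) (T \<omega>) x\<bar> powr p) \<partial>M) \<longlonglongrightarrow> 0"
    using even_ceiling(2)[of p] \<open>p \<ge> 1\<close> by (intro Lp_tendsto_zero_of_power[where n = n]) (auto simp: n_def)
  moreover have "(\<integral>\<^sup>+\<omega>. ennreal (\<bar>T \<omega> x - zonal_conv (q J) (T \<omega>) x\<bar> powr p) \<partial>M)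
    = (\<integral>\<^sup>+ \<omega>. ennreal (\<bar>T \<omega> x - needlet_approx d h N w y (Suc J) T \<omega> x\<bar> powr p) \<partial>M)" for J
  \<comment> \<open>The needlet approximation is a convolution on integrable paths, and these are
    almost all.\<close>
  proof (rule nn_integral_cong_AE)
    show "AE \<omega> in M. ennreal (\<bar>T \<omega> x - zonal_conv (q J) (T \<omega>) x\<bar> powr p)
      = ennreal (\<bar>T \<omega> x - needlet_approx d h N w y (Suc J) T \<omega> x\<bar> powr p)"
      using I.AE_path
    proof eventually_elim
      case (elim \<omega>)
      then show ?case
        unfolding q_def by (subst needlet_approx_eq_zonal_conv[OF dims assms(7,9,10)]) auto
    qed
  qed
  ultimately have "(\<lambda>J. \<integral>\<^sup>+ \<omega>. ennreal (\<bar>T \<omega> x - needlet_approx d h N w y (Suc J) T \<omega> x\<bar> powr p) \<partial>M) \<longlonglongrightarrow> 0"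
    by simp
  \<comment> \<open>The kernels describe the orders \<open>Suc J\<close>; dropping order 0 leaves
    the limit unchanged.\<close>
  then show ?thesis by (rule LIMSEQ_imp_Suc)
qed

end
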